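(* Let $|\cdot|$ be a norm on $\mathbb{R}^d$ and let $\mathbf{X}=\{\mathbf{X}_j,j\in\mathbb{Z}\}$ be a strictly stationary, regularly varying $\mathbb{R}^d$-valued time series with tail process $\mathbf{Y}$. Let $u_n>0$ and positive integers $r_n$ satisfy $u_n\to\infty$, $r_n\to\infty$, $nw_n\to\infty$, $r_n/n\to0$, $r_nw_n\to0$, where $w_n=\mathbb{P}(|\mathbf{X}_0|>u_n)$. Assume $\mathcal{AC}(r_n,u_n)$ holds and there is a sequence $\ell_n$ with $\ell_n\to\infty$, $\ell_n/r_n\to0$, $(n/r_n)\beta_{\ell_n}\to0$. Fix $\gamma>0$. Then: (1) for any $G\in\mathcal{H}(0)$, $\tilde{\tilde{\boldsymbol{\nu}}}^*_{n,r_n}(T_{\max}^\gamma G)\to(1+\gamma)^{-1}\boldsymbol{\nu}^*(G)$ in probability; (2) the finite-dimensional distributions of $\{\tilde{\mathbb{L}}_n(G),G\in\mathcal{H}(0)\}$ converge to those of a centered Gaussian process $\tilde{\mathbb{L}}$ on $\mathcal{H}(0)$ with covariance $\mathrm{cov}(\tilde{\mathbb{L}}(G),\tilde{\mathbb{L}}(G'))=(2\gamma+1)^{-1}\boldsymbol{\nu}^*(GG')$.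
   Context: Tail process: for all $i\le j$ the law of $x^{-1}(\mathbf{X}_i,\dots,\mathbf{X}_j)$ given $|\mathbf{X}_0|>x$ converges weakly to that of $(\mathbf{Y}_i,\dots,\mathbf{Y}_j)$ as $x\to\infty$. $\beta_j$ is the $\beta$-mixing coefficient of $\mathbf{X}$ at lag $j$. $\mathcal{AC}(r_n,u_n)$: for all $s,t>0$, $\lim_{\ell\to\infty}\limsup_{n\to\infty}\mathbb{P}(\max_{\ell\le|j|\le r_n}|\mathbf{X}_j|>u_ns\mid|\mathbf{X}_0|>u_nt)=0$. Assume $n=m_nr_n$ and let $\mathbb{X}_j=u_n^{-1}(\mathbf{X}_{(j-1)r_n+1},\dots,\mathbf{X}_{jr_n})$, $j=1,\dots,m_n$, each identified with the sequence having these entries at coordinates $1,\dots,r_n$ and $\mathbf{0}$ elsewhere. For $\mathbf{x}$ in $\ell_0(\mathbb{R}^d)$ (sequences tending to $0$ at $\pm\infty$): $T_{\min}(\mathbf{x})=\inf\{j:|\mathbf{x}_j|>1\}$, $T_{\max}(\mathbf{x})=\sup\{j:|\mathbf{x}_j|>1\}$, $\mathrm{exc}(\mathbf{x})=\sum_j\mathbf{1}\{|\mathbf{x}_j|>1\}$, $\mathbf{x}_{i,j}=(\mathbf{x}_i,\dots,\mathbf{x}_j)$; $T_{\max}^\gamma G$ is understood as $0$ where $G=0$. $\mathcal{H}(0)$ is the class of $G:\ell_0(\mathbb{R}^d)\to\mathbb{R}_+$ with: (i) $G$ continuous at almost every realization of $\mathbf{Y}$; (ii) $G(\mathbf{x})=0$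 if $\mathrm{exc}(\mathbf{x})=0$; (iii) if $\mathrm{exc}(\mathbf{x})>0$, $G(\mathbf{x})=G(\mathbf{x}_{T_{\min}(\mathbf{x}),T_{\max}(\mathbf{x})})$; (iv) $G$ is bounded. Define $\tilde{\tilde{\boldsymbol{\nu}}}^*_{n,r_n}(H)=\frac{1}{nr_n^\gamma w_n}\sum_{j=1}^{m_n}H(\mathbb{X}_j)$ and, for $G\in\mathcal{H}(0)$ with $H=T_{\max}^\gamma G$, $\tilde{\mathbb{L}}_n(G)=\frac{1}{\sqrt{nw_n}\,r_n^\gamma}\sum_{j=1}^{m_n}\{H(\mathbb{X}_j)-\mathbb{E}[H(\mathbb{X}_j)]\}$. For nonnegative $H$ vanishing when $\sup_j|\mathbf{x}_j|\le1$, $\boldsymbol{\nu}^*(H)=\mathbb{E}[H(\mathbf{Y})\mathbf{1}\{\sup_{j\le-1}|\mathbf{Y}_j|\le1\}]$. *)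

theory Defs
  imports "HOL-Probability.Probability"
begin

definition is_norm :: "('a::real_vector \<Rightarrow> real) \<Rightarrow> bool" where
  "is_norm N \<longleftrightarrow> (\<forall>x. N x = 0 \<longleftrightarrow> x = 0) \<and> (\<forall>x y. N (x + y) \<le> N x + N y)
     \<and> (\<forall>c x. N (c *\<^sub>R x) = \<bar>c\<bar> * N x)"

definition weak_conv_to :: "('i \<Rightarrow> 'a::topological_space measure) \<Rightarrow> 'a measure \<Rightarrow> 'i filter \<Rightarrow> bool" where
  "weak_conv_to P \<mu> F \<longleftrightarrow>
     (\<forall>f::'a \<Rightarrow> real. continuous_on UNIV f \<and> bounded (range f) \<longrightarrow>
        ((\<lambda>i. \<integral>x. f x \<partial>P i) \<longlongrightarrow> (\<integral>x. f x \<partial>\<mu>)) F)"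

definition stationary :: "'w measure \<Rightarrow> (int \<Rightarrow> 'w \<Rightarrow> 'a::topological_space) \<Rightarrow> bool" where
  "stationary M X \<longleftrightarrow> (\<forall>h::int.
     distr M (PiM UNIV (\<lambda>_. borel)) (\<lambda>\<omega> j. X (j + h) \<omega>) =
     distr M (PiM UNIV (\<lambda>_. borel)) (\<lambda>\<omega> j. X j \<omega>))"

(* Tail process: for all i \<le> j, the law of x^{-1}(X_i,...,X_j) given N(X_0) > x converges
   weakly to the law of (Y_i,...,Y_j).  Test functions: bounded continuous functions
   of the sequence (product topology) depending only on the coordinates i..j. *)
definition is_tail_process :: "('a::real_normed_vector \<Rightarrow> real) \<Rightarrow> 'w measure \<Rightarrow> (int \<Rightarrow> 'w \<Rightarrow> 'a)
     \<Rightarrow> 'e measure \<Rightarrow> (int \<Rightarrow> 'e \<Rightarrow> 'a) \<Rightarrow> bool" where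
  "is_tail_process N M X MY Y \<longleftrightarrow>
     (\<forall>(i::int) (j::int) (f::(int \<Rightarrow> 'a) \<Rightarrow> real).
        i \<le> j \<and> continuous_on UNIV f \<and> bounded (range f)
        \<and> (\<forall>x y. (\<forall>k\<in>{i..j}. x k = y k) \<longrightarrow> f x = f y) \<longrightarrow>
        ((\<lambda>x::real. (\<integral>\<omega>. f (\<lambda>k. (1 / x) *\<^sub>R X k \<omega>) * indicator {\<omega>\<in>space M. N (X 0 \<omega>) > x} \<omega> \<partial>M)
                     / measure M {\<omega>\<in>space M. N (X 0 \<omega>) > x})
          \<longlongrightarrow> (\<integral>\<eta>. f (\<lambda>k. Y k \<eta>) \<partial>MY)) at_top)"

(* Regularly varying time series with tail process Y (Basrak--Segers characterisation):
   Y is a process with Pareto(alpha) norm at time 0 and is the tail process of X. *)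
definition reg_var_with_tail :: "('a::real_normed_vector \<Rightarrow> real) \<Rightarrow> 'w measure \<Rightarrow> (int \<Rightarrow> 'w \<Rightarrow> 'a)
     \<Rightarrow> 'e measure \<Rightarrow> (int \<Rightarrow> 'e \<Rightarrow> 'a) \<Rightarrow> bool" where
  "reg_var_with_tail N M X MY Y \<longleftrightarrow>
     prob_space MY \<and> (\<forall>j. Y j \<in> borel_measurable MY)
     \<and> (\<exists>\<alpha>>0. \<forall>y\<ge>1. measure MY {\<eta>\<in>space MY. N (Y 0 \<eta>) > y} = y powr (-\<alpha>))
     \<and> is_tail_process N M X MY Y"

definition past_sa :: "'w measure \<Rightarrow> (int \<Rightarrow> 'w \<Rightarrow> 'a::topological_space) \<Rightarrow> int \<Rightarrow> 'w set set" where
  "past_sa M X j = sigma_sets (space M) {X k -` B \<inter> space M | k B. k \<le> j \<and> B \<in> sets borel}"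

definition future_sa :: "'w measure \<Rightarrow> (int \<Rightarrow> 'w \<Rightarrow> 'a::topological_space) \<Rightarrow> int \<Rightarrow> 'w set set" where
  "future_sa M X j = sigma_sets (space M) {X k -` B \<inter> space M | k B. k \<ge> j \<and> B \<in> sets borel}"

definition beta_mix :: "'w measure \<Rightarrow> (int \<Rightarrow> 'w \<Rightarrow> 'a::topological_space) \<Rightarrow> nat \<Rightarrow> real" where
  "beta_mix M X j = Sup {(\<Sum>a\<in>I. \<Sum>b\<in>J. \<bar>measure M (A a \<inter> B b) - measure M (A a) * measure M (B b)\<bar>) / 2
       | (I::nat set) (J::nat set) A B. finite I \<and> finite J
         \<and> (\<forall>a\<in>I. A a \<in> past_sa M X 0) \<and> (\<forall>b\<in>J. B b \<in> future_sa M X (int j))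
         \<and> disjoint_family_on A I \<and> disjoint_family_on B J
         \<and> (\<Union>a\<in>I. A a) = space M \<and> (\<Union>b\<in>J. B b) = space M}"

definition anticlust :: "('a::real_normed_vector \<Rightarrow> real) \<Rightarrow> 'w measure \<Rightarrow> (int \<Rightarrow> 'w \<Rightarrow> 'a)
     \<Rightarrow> (nat \<Rightarrow> real) \<Rightarrow> (nat \<Rightarrow> nat) \<Rightarrow> bool" where
  "anticlust N M X u r \<longleftrightarrow> (\<forall>s>0. \<forall>t>0.
     ((\<lambda>l::nat. limsup (\<lambda>n. ereal (
         measure M {\<omega>\<in>space M. (\<exists>j::int. int l \<le> \<bar>j\<bar> \<and> \<bar>j\<bar> \<le> int (r n) \<and> N (X j \<omega>) > u n * s)
                                  \<and> N (X 0 \<omega>) > u n * t}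
         / measure M {\<omega>\<in>space M. N (X 0 \<omega>) > u n * t})))
      \<longlongrightarrow> 0) sequentially)"

definition in_l0 :: "(int \<Rightarrow> 'a::real_normed_vector) \<Rightarrow> bool" where
  "in_l0 x \<longleftrightarrow> (x \<longlongrightarrow> 0) at_top \<and> (x \<longlongrightarrow> 0) at_bot"

definition exc :: "('a \<Rightarrow> real) \<Rightarrow> (int \<Rightarrow> 'a) \<Rightarrow> nat" where
  "exc N x = card {j. N (x j) > 1}"

definition Tmin :: "('a \<Rightarrow> real) \<Rightarrow> (int \<Rightarrow> 'a) \<Rightarrow> int" where
  "Tmin N x = Min {j. N (x j) > 1}"

definition Tmax :: "('a \<Rightarrow> real) \<Rightarrow> (int \<Rightarrow> 'a) \<Rightarrow> int" where
  "Tmax N x = Max {j. N (x j) > 1}"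

(* x_{i,j} = (x_i,...,x_j), identified with the element of l_0 carrying these entries
   at coordinates 0..j-i and 0 elsewhere *)
definition seg :: "(int \<Rightarrow> 'a::zero) \<Rightarrow> int \<Rightarrow> int \<Rightarrow> (int \<Rightarrow> 'a)" where
  "seg x i j = (\<lambda>k. if 0 \<le> k \<and> k \<le> j - i then x (i + k) else 0)"

definition cont_l0 :: "('a::real_normed_vector \<Rightarrow> real) \<Rightarrow> ((int \<Rightarrow> 'a) \<Rightarrow> real) \<Rightarrow> (int \<Rightarrow> 'a) \<Rightarrow> bool" where
  "cont_l0 N G x \<longleftrightarrow> (\<forall>\<epsilon>>0. \<exists>\<delta>>0. \<forall>y. in_l0 y \<and> (\<forall>j. N (y j - x j) < \<delta>) \<longrightarrow> \<bar>G y - G x\<bar> < \<epsilon>)"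

(* The class H(0) (G measurable w.r.t. the product sigma-algebra, as implicit in the paper) *)
definition inH0 :: "('a::{real_normed_vector,second_countable_topology} \<Rightarrow> real) \<Rightarrow> 'e measure
     \<Rightarrow> (int \<Rightarrow> 'e \<Rightarrow> 'a) \<Rightarrow> ((int \<Rightarrow> 'a) \<Rightarrow> real) \<Rightarrow> bool" where
  "inH0 N MY Y G \<longleftrightarrow>
     G \<in> borel_measurable (PiM UNIV (\<lambda>_::int. borel))
     \<and> (\<forall>x. in_l0 x \<longrightarrow> G x \<ge> 0)
     \<and> (AE \<eta> in MY. cont_l0 N G (\<lambda>j. Y j \<eta>))
     \<and> (\<forall>x. in_l0 x \<and> exc N x = 0 \<longrightarrow> G x = 0)
     \<and> (\<forall>x. in_l0 x \<and> exc N x > 0 \<longrightarrow> G x = G (seg x (Tmin N x) (Tmax N x)))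
     \<and> (\<exists>C. \<forall>x. in_l0 x \<longrightarrow> G x \<le> C)"

definition TmaxG :: "('a \<Rightarrow> real) \<Rightarrow> real \<Rightarrow> ((int \<Rightarrow> 'a) \<Rightarrow> real) \<Rightarrow> (int \<Rightarrow> 'a) \<Rightarrow> real" where
  "TmaxG N \<gamma> G x = (if G x = 0 then 0 else real_of_int (Tmax N x) powr \<gamma> * G x)"

definition nu_star :: "('a \<Rightarrow> real) \<Rightarrow> 'e measure \<Rightarrow> (int \<Rightarrow> 'e \<Rightarrow> 'a) \<Rightarrow> ((int \<Rightarrow> 'a) \<Rightarrow> real) \<Rightarrow> real" where
  "nu_star N MY Y H = (\<integral>\<eta>. H (\<lambda>j. Y j \<eta>) * indicator {\<eta>\<in>space MY. \<forall>j<0. N (Y j \<eta>) \<le> 1} \<eta> \<partial>MY)"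

definition block :: "(nat \<Rightarrow> real) \<Rightarrow> (nat \<Rightarrow> nat) \<Rightarrow> (int \<Rightarrow> 'w \<Rightarrow> 'a::real_vector) \<Rightarrow> nat \<Rightarrow> nat \<Rightarrow> 'w \<Rightarrow> (int \<Rightarrow> 'a)" where
  "block u r X n j \<omega> = (\<lambda>i. if 1 \<le> i \<and> i \<le> int (r n) then (1 / u n) *\<^sub>R X ((int j - 1) * int (r n) + i) \<omega> else 0)"

definition nu_tt :: "(nat \<Rightarrow> real) \<Rightarrow> (nat \<Rightarrow> nat) \<Rightarrow> (nat \<Rightarrow> real) \<Rightarrow> real \<Rightarrow> (int \<Rightarrow> 'w \<Rightarrow> 'a::real_vector)
     \<Rightarrow> ((int \<Rightarrow> 'a) \<Rightarrow> real) \<Rightarrow> nat \<Rightarrow> 'w \<Rightarrow> real" where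
  "nu_tt u r w \<gamma> X H n \<omega> =
     (\<Sum>j=1..n div r n. H (block u r X n j \<omega>)) / (real n * real (r n) powr \<gamma> * w n)"

definition Ln :: "('a \<Rightarrow> real) \<Rightarrow> 'w measure \<Rightarrow> (nat \<Rightarrow> real) \<Rightarrow> (nat \<Rightarrow> nat) \<Rightarrow> (nat \<Rightarrow> real) \<Rightarrow> real
     \<Rightarrow> (int \<Rightarrow> 'w \<Rightarrow> 'a::real_vector) \<Rightarrow> ((int \<Rightarrow> 'a) \<Rightarrow> real) \<Rightarrow> nat \<Rightarrow> 'w \<Rightarrow> real" where
  "Ln N M u r w \<gamma> X G n \<omega> =
     (\<Sum>j=1..n div r n. TmaxG N \<gamma> G (block u r X n j \<omega>)
                       - (\<integral>\<omega>'. TmaxG N \<gamma> G (block u r X n j \<omega>') \<partial>M))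
     / (sqrt (real n * w n) * real (r n) powr \<gamma>)"

definition conv_in_prob :: "'w measure \<Rightarrow> (nat \<Rightarrow> 'w \<Rightarrow> real) \<Rightarrow> real \<Rightarrow> bool" where
  "conv_in_prob M Z c \<longleftrightarrow>
     (\<forall>\<epsilon>>0. ((\<lambda>n. measure M {\<omega>\<in>space M. \<bar>Z n \<omega> - c\<bar> > \<epsilon>}) \<longlongrightarrow> 0) sequentially)"

definition gauss1 :: "real \<Rightarrow> real measure" where
  "gauss1 v = (if v = 0 then return borel 0 else density lborel (normal_density 0 (sqrt v)))"

definition centered_gaussian :: "('k::finite \<Rightarrow> 'k \<Rightarrow> real) \<Rightarrow> (real^'k) measure \<Rightarrow> bool" where
  "centered_gaussian S \<mu> \<longleftrightarrow> sets \<mu> = sets borel \<and> prob_space \<mu> \<and>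
     (\<forall>t::real^'k. distr \<mu> borel (\<lambda>x. t \<bullet> x) = gauss1 (\<Sum>a\<in>UNIV. \<Sum>b\<in>UNIV. t$a * S a b * t$b))"

end

theory Submission imports Defs begin

text \<open>
  Decomposing a block according to its first exceedance, stationarity and anticlustering give
  \<open>E[T\<^sub>m\<^sub>a\<^sub>x\<^sup>\<gamma> G(block)] / (r\<^sup>1\<^sup>+\<^sup>\<gamma> w) \<longlonglongrightarrow> \<nu>\<^sup>*(G) / (1 + \<gamma>)\<close>: given an exceedance at
  position \<open>i\<close> the cluster is concentrated in a bounded window around \<open>i\<close>, so that \<open>T\<^sub>m\<^sub>a\<^sub>x\<close>
  may be replaced by \<open>i\<close>, and the factor \<open>1 / (1 + \<gamma>)\<close> is the limit of the Riemann sums of \<open>s\<^sup>\<gamma>\<close>.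
  Since \<open>(T\<^sub>m\<^sub>a\<^sub>x\<^sup>\<gamma> G)\<^sup>2 = T\<^sub>m\<^sub>a\<^sub>x\<^sup>2\<^sup>\<gamma> G\<^sup>2\<close>, the same limit yields the variance of the block sums.
  Dropping the last \<open>l\<^sub>n\<close> entries of every block makes the blocks \<open>\<beta>\<close>-mixing separated, so the
  characteristic function of the sum factorises up to \<open>(n / r\<^sub>n) \<beta>(l\<^sub>n)\<close>; the truncation errors are
  negligible, as is seen by treating even and odd blocks separately. The summands are of
  order \<open>(n w\<^sub>n)\<^sup>-\<^sup>1\<^sup>/\<^sup>2\<close>, which replaces the Lindeberg condition.
\<close>

text \<open>The tail process controls only bounded continuous functions of finitely many
  coordinates, seen from an exceedance at time 0, while a block functional is neither continuous nor
  local. Hence the fixed window of radius \<open>L\<close> in \<open>anchored\<close>: apart from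
  the discontinuities of G itself, it can jump only where some entry has norm exactly 1, and the
  tail process almost surely avoids this, a fact extracted from regular variation. Anticlustering is
  an iterated limit, so \<open>L\<close> is always fixed before \<open>n\<close> grows.

  Both claims are instances of one limit, \<open>block_sum_char_limit\<close>, through its free
  factor \<open>a n\<close>: the value 1 gives the Gaussian limit, and 1 / sqrt(n w_n) makes the
  centred sum vanish in probability. Passing to vectors requires all linear combinations of members
  of H(0); these may be negative, hence \<open>cluster_functional\<close>. Characteristic functions
  take the place of independent copies of the blocks: decoupling, removal of negligible parts and
  identification of the limit then involve only integrals of bounded functions.\<close>

section \<open>Gaussian vectors and the multivariate continuity theorem\<close>

lemma quadratic_form_insert:
  fixes S :: "'a \<Rightarrow> 'a \<Rightarrow> real"
  assumes "finite I" "p \<notin> I" "\<And>b. b \<in> I \<Longrightarrow> S b p = S p b"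
  shows "(\<Sum>a\<in>insert p I. \<Sum>b\<in>insert p I. t a * S a b * t b)
    = (t p)\<^sup>2 * S p p + 2 * t p * (\<Sum>b\<in>I. S p b * t b) + (\<Sum>a\<in>I. \<Sum>b\<in>I. t a * S a b * t b)"
proof -
  have "(\<Sum>a\<in>insert p I. \<Sum>b\<in>insert p I. t a * S a b * t b)
     = t p * S p p * t p + (\<Sum>b\<in>I. t p * S p b * t b)
       + ((\<Sum>a\<in>I. t a * S a p * t p) + (\<Sum>a\<in>I. \<Sum>b\<in>I. t a * S a b * t b))"
    using assms(1,2) by (simp add: sum.distrib)
  also have "(\<Sum>a\<in>I. t a * S a p * t p) = (\<Sum>b\<in>I. t p * S p b * t b)"
    using assms(3) by (intro sum.cong) auto
  also have "(\<Sum>b\<in>I. t p * S p b * t b) = t p * (\<Sum>b\<in>I. S p b * t b)"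
    by (simp add: sum_distrib_left mult.assoc)
  finally show ?thesis by (simp add: power2_eq_square algebra_simps)
qed

text \<open>Cholesky factorisation by induction on the index set: a positive pivot is split off as a
  rank-one form and leaves its Schur complement, while a zero pivot forces its whole row to
  vanish.\<close>

lemma psd_factorization:
  fixes S :: "'a \<Rightarrow> 'a \<Rightarrow> real"
  assumes "finite I" "\<And>a b. a \<in> I \<Longrightarrow> b \<in> I \<Longrightarrow> S a b = S b a"
    and "\<And>t. 0 \<le> (\<Sum>a\<in>I. \<Sum>b\<in>I. t a * S a b * t b)"
  shows "\<exists>c. \<forall>a\<in>I. \<forall>b\<in>I. S a b = (\<Sum>i\<in>I. c a i * c b i)"
  using assms
proof (induction I arbitrary: S rule: finite_induct)
  case empty
  then show ?case by simp
next
  case (insert p I)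
  note sym = insert.prems(1) and psd = insert.prems(2)
  note Q = quadratic_form_insert[OF insert.hyps(1,2), of S, OF sym]
  have cong: "(\<Sum>b\<in>I. f b ((t(p := z)) b)) = (\<Sum>b\<in>I. f b (t b))" for f :: "'a \<Rightarrow> real \<Rightarrow> real" and t z
    using insert.hyps(2) by (intro sum.cong) auto
  have cong2: "(\<Sum>a\<in>I. \<Sum>b\<in>I. (t(p := z)) a * S a b * (t(p := z)) b) = (\<Sum>a\<in>I. \<Sum>b\<in>I. t a * S a b * t b)" for t z
    using insert.hyps(2) by (intro sum.cong) auto
  \<comment> \<open>Positivity holds for all \<open>t\<close>, so the entry at \<open>p\<close> can
    be chosen independently of the entries on \<open>I\<close>.\<close>
  have psd': "0 \<le> z\<^sup>2 * S p p + 2 * z * (\<Sum>b\<in>I. S p b * t b) + (\<Sum>a\<in>I. \<Sum>b\<in>I. t a * S a b * t b)" for z t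
  proof -
    have "0 \<le> ((t(p := z)) p)\<^sup>2 * S p p + 2 * (t(p := z)) p * (\<Sum>b\<in>I. S p b * (t(p := z)) b)
        + (\<Sum>a\<in>I. \<Sum>b\<in>I. (t(p := z)) a * S a b * (t(p := z)) b)"
      using psd[of "t(p := z)"] by (subst (asm) Q) auto
    then show ?thesis unfolding cong2 cong[of "\<lambda>b y. S p b * y" t z] by simp
  qed
  show ?case
  proof (cases "S p p = 0")
    case True
    have z: "S p b = 0" if b: "b \<in> I" for b
    proof (rule ccontr)
      assume nz: "S p b \<noteq> 0"
      define e where "e = (\<lambda>x. if x = b then 1 else 0 :: real)"
      have 1: "(\<Sum>c\<in>I. S p c * e c) = S p b"
        using b insert.hyps(1) by (simp add: e_def if_distrib sum.delta cong: if_cong)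
      \<comment> \<open>With a zero pivot the form is affine in the entry at \<open>p\<close>, with
        slope \<open>2 * S p b\<close>; this entry brings its value to -1.\<close>
      have "0 \<le> (- ((\<Sum>a\<in>I. \<Sum>b\<in>I. e a * S a b * e b) + 1) / (2 * S p b))\<^sup>2 * S p p +
          2 * (- ((\<Sum>a\<in>I. \<Sum>b\<in>I. e a * S a b * e b) + 1) / (2 * S p b)) * (\<Sum>c\<in>I. S p c * e c) + (\<Sum>a\<in>I. \<Sum>b\<in>I. e a * S a b * e b)"
        by (rule psd')
      also have "\<dots> = -1"
        using nz True unfolding 1 by (simp add: field_simps)
      finally show False by simp
    qed
    have "\<exists>c. \<forall>a\<in>I. \<forall>b\<in>I. S a b = (\<Sum>i\<in>I. c a i * c b i)"
    proof (rule insert.IH)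
      show "0 \<le> (\<Sum>a\<in>I. \<Sum>b\<in>I. t a * S a b * t b)" for t using psd'[of 0 t] by simp
    qed (use sym in auto)
    then obtain c where c: "\<And>a b. a \<in> I \<Longrightarrow> b \<in> I \<Longrightarrow> S a b = (\<Sum>i\<in>I. c a i * c b i)" by blast
    show ?thesis
    proof (intro exI[of _ "\<lambda>a i. if a = p \<or> i = p then 0 else c a i"] ballI)
      fix a b assume ab: "a \<in> insert p I" "b \<in> insert p I"
      show "S a b = (\<Sum>i\<in>insert p I. (if a = p \<or> i = p then 0 else c a i) * (if b = p \<or> i = p then 0 else c b i))"
      proof (cases "a = p \<or> b = p")
        case True
        then have "S a b = 0" using ab z sym \<open>S p p = 0\<close> by auto
        moreover have "(\<Sum>i\<in>insert p I. (if a = p \<or> i = p then 0 else c a i) * (if b = p \<or> i = p then 0 else c b i)) = 0"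
          using True by (intro sum.neutral) auto
        ultimately show ?thesis by simp
      next
        case False
        have "(\<Sum>i\<in>insert p I. (if a = p \<or> i = p then 0 else c a i) * (if b = p \<or> i = p then 0 else c b i)) = (\<Sum>i\<in>I. c a i * c b i)"
          using insert.hyps False by (simp, intro sum.cong) auto
        then show ?thesis using c ab False by auto
      qed
    qed
  next
    case False
    have pos: "S p p > 0" using psd'[of 1 "\<lambda>_. 0"] False by simp
    \<comment> \<open>The Schur complement of the pivot.\<close>
    define S' where "S' = (\<lambda>a b. S a b - S p a * S p b / S p p)"
    have "\<exists>c. \<forall>a\<in>I. \<forall>b\<in>I. S' a b = (\<Sum>i\<in>I. c a i * c b i)"
    proof (rule insert.IH)
      show "S' a b = S' b a" if "a \<in> I" "b \<in> I" for a b using that sym by (simp add: S'_def)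
      fix t
      define v where "v = (\<Sum>b\<in>I. S p b * t b)"
      have "(\<Sum>a\<in>I. \<Sum>b\<in>I. t a * S' a b * t b)
          = (\<Sum>a\<in>I. \<Sum>b\<in>I. t a * S a b * t b) - (\<Sum>a\<in>I. \<Sum>b\<in>I. (S p a * t a) * (S p b * t b) / S p p)"
        unfolding S'_def sum_subtractf[symmetric] by (intro sum.cong refl) (simp add: field_simps)
      also have "(\<Sum>a\<in>I. \<Sum>b\<in>I. (S p a * t a) * (S p b * t b) / S p p) = v * v / S p p"
        unfolding v_def sum_product sum_divide_distrib by simp
      finally have eq: "(\<Sum>a\<in>I. \<Sum>b\<in>I. t a * S' a b * t b) = (\<Sum>a\<in>I. \<Sum>b\<in>I. t a * S a b * t b) - v * v / S p p" .
      \<comment> \<open>The entry at \<open>p\<close> that minimises the form for fixed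
        \<open>t\<close> on \<open>I\<close>.\<close>
      have "0 \<le> (- v / S p p)\<^sup>2 * S p p + 2 * (- v / S p p) * v + (\<Sum>a\<in>I. \<Sum>b\<in>I. t a * S a b * t b)"
        unfolding v_def by (rule psd')
      also have "\<dots> = (\<Sum>a\<in>I. \<Sum>b\<in>I. t a * S a b * t b) - v * v / S p p"
        using pos by (simp add: field_simps power2_eq_square)
      finally show "0 \<le> (\<Sum>a\<in>I. \<Sum>b\<in>I. t a * S' a b * t b)" using eq by simp
    qed
    then obtain c where c: "\<And>a b. a \<in> I \<Longrightarrow> b \<in> I \<Longrightarrow> S' a b = (\<Sum>i\<in>I. c a i * c b i)" by blast
    show ?thesis
    proof (intro exI[of _ "\<lambda>a i. if i = p then S p a / sqrt (S p p) else if a = p then 0 else c a i"] ballI)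
      fix a b assume ab: "a \<in> insert p I" "b \<in> insert p I"
      have "(\<Sum>i\<in>insert p I. (if i = p then S p a / sqrt (S p p) else if a = p then 0 else c a i) * (if i = p then S p b / sqrt (S p p) else if b = p then 0 else c b i))
        = S p a * S p b / S p p + (\<Sum>i\<in>I. (if a = p then 0 else c a i) * (if b = p then 0 else c b i))"
        using insert.hyps pos by (simp, intro sum.cong) auto
      also have "\<dots> = S a b"
      proof (cases "a = p \<or> b = p")
        case True
        have "(\<Sum>i\<in>I. (if a = p then 0 else c a i) * (if b = p then 0 else c b i)) = 0"
          using True by (intro sum.neutral) auto
        then show ?thesis using True pos sym ab by auto
      next
        case False
        then have "a \<in> I" "b \<in> I" using ab by auto
        then show ?thesis using False c[of a b] by (simp add: S'_def)
      qed
      finally show "S a b = (\<Sum>i\<in>insert p I. (if i = p then S p a / sqrt (S p p) else if a = p then 0 else c a i) * (if i = p then S p b / sqrt (S p p) else if b = p then 0 else c b i))"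
        by simp
    qed
  qed
qed

section \<open>Gaussian laws on the line and in several dimensions\<close>

lemma real_distribution_gauss1: "v \<ge> 0 \<Longrightarrow> real_distribution (gauss1 v)"
  unfolding gauss1_def real_distribution_def real_distribution_axioms_def
  by (auto intro!: prob_space_return prob_space_normal_density)

text \<open>For v > 0 the law is the image of the standard normal law under multiplication by sqrt
  v; for v = 0 it is the point mass at 0, with characteristic function 1.\<close>

lemma char_gauss1:
  assumes "v \<ge> 0"
  shows "char (gauss1 v) t = complex_of_real (exp (- (t\<^sup>2 * v) / 2))"
proof (cases "v = 0")
  case True
  then show ?thesis by (simp add: char_def gauss1_def integral_return)
next
  case False
  with assms have v: "v > 0" by simp
  interpret std: prob_space std_normal_distribution
    by (rule prob_space_normal_density) simp
  have "distributed std_normal_distribution lborel (\<lambda>x. x) std_normal_density"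
    by (simp add: distributed_def distr_id2)
  then have "distributed std_normal_distribution lborel (\<lambda>x. 0 + sqrt v * x) (normal_density (0 + sqrt v * 0) (\<bar>sqrt v\<bar> * 1))"
    using v by (intro std.normal_density_affine) auto
  then have "distr std_normal_distribution lborel (\<lambda>x. sqrt v * x) = density lborel (normal_density 0 (sqrt v))"
    using v by (simp add: distributed_def)
  then have eq: "gauss1 v = distr std_normal_distribution lborel (\<lambda>x. sqrt v * x)"
    using v by (simp add: gauss1_def)
  have "char (gauss1 v) t = char std_normal_distribution (t * sqrt v)"
    unfolding eq char_def by (subst integral_distr) (auto simp: mult.assoc)
  then show ?thesis using v by (simp add: char_std_normal_distribution power_mult_distrib)
qed

lemma borel_measurable_vec_lambda:
  fixes f :: "'k::finite \<Rightarrow> 'a \<Rightarrow> real"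
  assumes "\<And>a. f a \<in> borel_measurable M"
  shows "(\<lambda>x. \<chi> a. f a x) \<in> borel_measurable M"
  using assms by (subst borel_measurable_iff_halfspace_le) (auto simp: Basis_vec_def inner_axis intro!: borel_measurable_le)

text \<open>The law sought is that of a linear image of independent standard normal variables, with
  matrix a factor \<open>c\<close> of S. Its projections are identified by their characteristic
  functions.\<close>

lemma centered_gaussian_exists:
  fixes S :: "'k::finite \<Rightarrow> 'k \<Rightarrow> real"
  assumes sym: "\<And>a b. S a b = S b a" and psd: "\<And>t. 0 \<le> (\<Sum>a\<in>UNIV. \<Sum>b\<in>UNIV. t a * S a b * t b)"
  shows "\<exists>\<mu>. centered_gaussian S \<mu>"
proof -
  have "\<exists>c. \<forall>a\<in>UNIV. \<forall>b\<in>UNIV. S a b = (\<Sum>i\<in>(UNIV::'k set). c a i * c b i)"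
    by (rule psd_factorization[OF finite sym psd])
  then obtain c :: "'k \<Rightarrow> 'k \<Rightarrow> real" where c: "\<And>a b. S a b = (\<Sum>i\<in>UNIV. c a i * c b i)" by blast
  interpret std: prob_space std_normal_distribution
    by (rule prob_space_normal_density) simp
  define P where "P = Pi\<^sub>M (UNIV :: 'k set) (\<lambda>_. std_normal_distribution)"
  interpret pp: product_prob_space "\<lambda>_::'k. std_normal_distribution" UNIV ..
  interpret P: prob_space P unfolding P_def by (rule prob_space_PiM) (rule std.prob_space_axioms)
  have setsP [measurable_cong]: "sets P = sets (Pi\<^sub>M UNIV (\<lambda>_. borel))"
    unfolding P_def by (intro sets_PiM_cong) auto
  define L where "L = (\<lambda>\<xi>::'k \<Rightarrow> real. (\<chi> a. \<Sum>i\<in>UNIV. c a i * \<xi> i) :: real^'k)"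
  have comp [measurable]: "(\<lambda>\<xi>. \<xi> i) \<in> borel_measurable P" for i by measurable
  have [measurable]: "L \<in> borel_measurable P"
    unfolding L_def by (intro borel_measurable_vec_lambda) measurable
  have *: "distr (distr P borel L) borel (\<lambda>x. t \<bullet> x) = gauss1 (\<Sum>a\<in>UNIV. \<Sum>b\<in>UNIV. t$a * S a b * t$b)" for t :: "real^'k"
  proof -
    \<comment> \<open>The coefficients of the projection \<open>t \<bullet> L \<xi>\<close> in the
      independent variables; its variance is the sum of their squares.\<close>
    define d where "d = (\<lambda>i. \<Sum>a\<in>UNIV. t$a * c a i)"
    have v: "(\<Sum>a\<in>UNIV. \<Sum>b\<in>UNIV. t$a * S a b * t$b) = (\<Sum>i\<in>UNIV. (d i)\<^sup>2)"
    proof -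
      have "(\<Sum>i\<in>UNIV. (d i)\<^sup>2) = (\<Sum>i\<in>UNIV. \<Sum>a\<in>UNIV. \<Sum>b\<in>UNIV. (t$a * c a i) * (t$b * c b i))"
        by (simp add: d_def power2_eq_square sum_product)
      also have "\<dots> = (\<Sum>a\<in>UNIV. \<Sum>i\<in>UNIV. \<Sum>b\<in>UNIV. (t$a * c a i) * (t$b * c b i))"
        by (rule sum.swap)
      also have "\<dots> = (\<Sum>a\<in>UNIV. \<Sum>b\<in>UNIV. \<Sum>i\<in>UNIV. (t$a * c a i) * (t$b * c b i))"
        by (intro sum.cong refl sum.swap)
      finally show ?thesis
        by (simp add: c sum_distrib_left sum_distrib_right mult_ac)
    qed
    have tL: "t \<bullet> L \<xi> = (\<Sum>i\<in>UNIV. d i * \<xi> i)" for \<xi>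
      unfolding d_def L_def inner_vec_def sum_distrib_right
      by (subst sum.swap) (simp add: sum_distrib_left mult_ac)
    have [measurable]: "(\<lambda>x::real^'k. t \<bullet> x) \<in> borel_measurable borel" by simp
    have dd: "distr (distr P borel L) borel (\<lambda>x. t \<bullet> x) = distr P borel (\<lambda>\<xi>. t \<bullet> L \<xi>)"
      by (subst distr_distr) (auto simp: comp_def)
    have "distr P borel (\<lambda>\<xi>. t \<bullet> L \<xi>) = gauss1 (\<Sum>i\<in>UNIV. (d i)\<^sup>2)"
    proof (rule Levy_uniqueness)
      show "real_distribution (distr P borel (\<lambda>\<xi>. t \<bullet> L \<xi>))"
        unfolding real_distribution_def real_distribution_axioms_def
        by (auto intro!: P.prob_space_distr)
      show "real_distribution (gauss1 (\<Sum>i\<in>UNIV. (d i)\<^sup>2))"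
        by (intro real_distribution_gauss1 sum_nonneg) auto
      show "char (distr P borel (\<lambda>\<xi>. t \<bullet> L \<xi>)) = char (gauss1 (\<Sum>i\<in>UNIV. (d i)\<^sup>2))"
      proof
        fix s
        have "char (distr P borel (\<lambda>\<xi>. t \<bullet> L \<xi>)) s = (\<integral>\<xi>. iexp (s * (t \<bullet> L \<xi>)) \<partial>P)"
          unfolding char_def by (subst integral_distr) auto
        also have "\<dots> = (\<integral>\<xi>. (\<Prod>i\<in>UNIV. iexp ((s * d i) * \<xi> i)) \<partial>P)"
          unfolding tL by (simp add: exp_sum[symmetric] sum_distrib_left mult_ac)
        also have "\<dots> = (\<Prod>i\<in>UNIV. (\<integral>x. iexp ((s * d i) * x) \<partial>std_normal_distribution))"
          unfolding P_def by (rule pp.product_integral_prod) 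
            (auto intro!: std.integrable_const_bound[where B=1])
        also have "\<dots> = (\<Prod>i\<in>UNIV. char std_normal_distribution (s * d i))"
          by (simp add: char_def)
        also have "\<dots> = complex_of_real (exp (- (s\<^sup>2 * (\<Sum>i\<in>UNIV. (d i)\<^sup>2)) / 2))"
          unfolding char_std_normal_distribution
          by (simp add: exp_sum[symmetric] sum_distrib_left power_mult_distrib sum_negf sum_divide_distrib flip: of_real_prod)
        finally show "char (distr P borel (\<lambda>\<xi>. t \<bullet> L \<xi>)) s = char (gauss1 (\<Sum>i\<in>UNIV. (d i)\<^sup>2)) s"
          by (subst char_gauss1) (auto intro!: sum_nonneg)
      qed
    qed
    then show ?thesis using dd v by simp
  qed
  have "prob_space (distr P borel L)" by (intro P.prob_space_distr) simp
  then have "centered_gaussian S (distr P borel L)"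
    unfolding centered_gaussian_def using * by simp
  then show ?thesis ..
qed

section \<open>Trigonometric polynomials and the continuity theorem in several dimensions\<close>

text \<open>These functions form an algebra, and their integrals are linear combinations of values
  of the characteristic function.\<close>

inductive trigpoly :: "(real^'k::finite \<Rightarrow> complex) \<Rightarrow> bool" where
  base: "trigpoly (\<lambda>x. c * iexp (t \<bullet> x))"
| add: "trigpoly p \<Longrightarrow> trigpoly q \<Longrightarrow> trigpoly (\<lambda>x. p x + q x)"

lemma trigpoly_const: "trigpoly (\<lambda>x. c)"
  using trigpoly.base[of c 0] by simp

lemma trigpoly_mult_base: "trigpoly q \<Longrightarrow> trigpoly (\<lambda>x. c * iexp (t \<bullet> x) * q x)"
proof (induction rule: trigpoly.induct)
  case (base d s)
  have "(\<lambda>x. c * iexp (t \<bullet> x) * (d * iexp (s \<bullet> x))) = (\<lambda>x. (c * d) * iexp ((t + s) \<bullet> x))"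
    by (auto simp: inner_add_left exp_add ring_distribs)
  then show ?case by (metis trigpoly.base)
next
  case (add p q)
  then show ?case by (auto simp: ring_distribs intro: trigpoly.add)
qed

lemma trigpoly_mult: "trigpoly p \<Longrightarrow> trigpoly q \<Longrightarrow> trigpoly (\<lambda>x. p x * q x)"
  by (induction rule: trigpoly.induct)
     (auto simp: ring_distribs intro: trigpoly.add trigpoly_mult_base)

lemma trigpoly_sum: "finite I \<Longrightarrow> (\<And>i. i \<in> I \<Longrightarrow> trigpoly (p i)) \<Longrightarrow> trigpoly (\<lambda>x. \<Sum>i\<in>I. p i x)"
  by (induction I rule: finite_induct) (auto intro: trigpoly.add trigpoly_const)

lemma trigpoly_sin: "trigpoly (\<lambda>x. complex_of_real (sin (a * x$i)))"
proof -
  have 1: "complex_of_real (sin (a * x$i)) = (-\<i>/2) * iexp (axis i a \<bullet> x) + (\<i>/2) * iexp (axis i (-a) \<bullet> x)" for x :: "real^'a"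
    by (simp add: inner_axis' sin_exp_eq field_simps flip: sin_of_real)
  show ?thesis unfolding 1 by (intro trigpoly.intros)
qed

text \<open>Linear forms and constants generate all polynomials under sums and products. Since the
  coordinates enter through their sines, the result is bounded on the whole space.\<close>

lemma trigpoly_polynomial_sin:
  fixes P :: "real^'k::finite \<Rightarrow> real"
  assumes "real_polynomial_function P"
  shows "trigpoly (\<lambda>x. complex_of_real (P (\<chi> i. sin (a * x$i))))"
  using assms
proof (induction rule: real_polynomial_function.induct)
  case (linear f)
  interpret bounded_linear f by fact
  have f_eq: "f v = (\<Sum>i\<in>UNIV. v$i * f (axis i 1))" for v
  proof -
    have "f v = f (\<Sum>i\<in>UNIV. v$i *\<^sub>R axis i 1)"
      using basis_expansion[of v] unfolding scalar_mult_eq_scaleR by (rule arg_cong[OF sym])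
    also have "\<dots> = (\<Sum>i\<in>UNIV. v$i * f (axis i 1))"
      unfolding sum scaleR by simp
    finally show ?thesis .
  qed
  have "(\<lambda>x. complex_of_real (f (\<chi> i. sin (a * x$i)))) = (\<lambda>x. \<Sum>i\<in>UNIV. complex_of_real (sin (a * x$i)) * complex_of_real (f (axis i 1)))"
    by (intro ext, subst f_eq) simp
  moreover have "trigpoly \<dots>"
    by (intro trigpoly_sum trigpoly_mult trigpoly_sin trigpoly_const) simp
  ultimately show ?case by simp
next
  case (add f g)
  then show ?case by (auto intro: trigpoly.add)
next
  case (mult f g)
  then show ?case by (auto intro: trigpoly_mult)
qed (auto intro: trigpoly_const)

lemma trigpoly_bounded_measurable:
  fixes q :: "real^'k::finite \<Rightarrow> complex"
  assumes "trigpoly q"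
  shows "q \<in> borel_measurable borel \<and> (\<exists>B. \<forall>x. norm (q x) \<le> B)"
  using assms
proof (induction rule: trigpoly.induct)
  case (base c t)
  have "(\<lambda>x::real^'k. c * iexp (t \<bullet> x)) \<in> borel_measurable borel"
    by (intro borel_measurable_continuous_onI continuous_intros)
  then show ?case by (auto simp: norm_mult intro!: exI[of _ "norm c"])
next
  case (add p q)
  then obtain B1 B2 where "\<forall>x. norm (p x) \<le> B1" "\<forall>x. norm (q x) \<le> B2" by auto
  then have "\<forall>x. norm (p x + q x) \<le> B1 + B2" by (auto intro!: norm_triangle_mono)
  with add show ?case by auto
qed

lemma trigpoly_integral_tendsto:
  fixes P :: "nat \<Rightarrow> (real^'k::finite) measure"
  assumes P: "\<And>n. prob_space (P n)" "\<And>n. sets (P n) = sets borel"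
    and \<mu>: "prob_space \<mu>" "sets \<mu> = sets borel"
    and char: "\<And>t. (\<lambda>n. \<integral>x. iexp (t \<bullet> x) \<partial>P n) \<longlonglongrightarrow> (\<integral>x. iexp (t \<bullet> x) \<partial>\<mu>)"
    and "trigpoly q"
  shows "(\<lambda>n. \<integral>x. q x \<partial>P n) \<longlonglongrightarrow> (\<integral>x. q x \<partial>\<mu>)"
  using \<open>trigpoly q\<close>
proof (induction rule: trigpoly.induct)
  case (base c t)
  show ?case using tendsto_mult_left[OF char[of t], of c] by simp
next
  case (add p q)
  have int: "integrable Q p" if "trigpoly p" "prob_space Q" "sets Q = sets borel" for p Q
  proof -
    interpret prob_space Q by fact
    from trigpoly_bounded_measurable[OF that(1)] obtain B where "\<And>x. norm (p x) \<le> B" "p \<in> borel_measurable borel" by auto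
    moreover from this have "p \<in> borel_measurable Q" using that(3) by (simp cong: measurable_cong_sets)
    ultimately show ?thesis by (intro integrable_const_bound[where B=B]) auto
  qed
  show ?case
    unfolding Bochner_Integration.integral_add[OF int[OF add.hyps(1) P] int[OF add.hyps(2) P]]
      Bochner_Integration.integral_add[OF int[OF add.hyps(1) \<mu>] int[OF add.hyps(2) \<mu>]]
    by (intro tendsto_add add.IH)
qed

text \<open>The one-dimensional continuity theorem, applied to the marginals, supplies tightness. On
  a large cube a bounded continuous function is then replaced by a trigonometric polynomial, whose
  integrals converge by \<open>trigpoly_integral_tendsto\<close>.\<close>

lemma weak_conv_to_of_char:
  fixes P :: "nat \<Rightarrow> (real^'k::finite) measure"
  assumes P: "\<And>n. prob_space (P n)" "\<And>n. sets (P n) = sets borel"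
    and \<mu>: "prob_space \<mu>" "sets \<mu> = sets borel"
    and char: "\<And>t. (\<lambda>n. \<integral>x. iexp (t \<bullet> x) \<partial>P n) \<longlonglongrightarrow> (\<integral>x. iexp (t \<bullet> x) \<partial>\<mu>)"
  shows "weak_conv_to P \<mu> sequentially"
  unfolding weak_conv_to_def
proof safe
  interpret P: prob_space "P n" for n by (rule P)
  interpret \<mu>: prob_space \<mu> by (rule \<mu>)
  note [measurable_cong] = P(2) \<mu>(2)
  \<comment> \<open>A continuous cutoff, 0 on [-A, A] and 1 outside [-A - 1, A + 1]. Summed over the
    coordinates it dominates the indicator of leaving a cube.\<close>
  define h where "h = (\<lambda>A x::real. min 1 (max 0 (\<bar>x\<bar> - A)))"
  have h01: "0 \<le> h A x" "h A x \<le> 1" for A x by (auto simp: h_def)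
  have [measurable]: "h A \<in> borel_measurable borel" for A unfolding h_def by measurable
  have comp [measurable]: "(\<lambda>x::real^'k. x $ a) \<in> borel_measurable borel" for a
    by (intro borel_measurable_continuous_onI continuous_intros)
  define H where "H = (\<lambda>A (x::real^'k). \<Sum>a\<in>UNIV. h A (x$a))"
  have [measurable]: "H A \<in> borel_measurable borel" for A unfolding H_def by measurable
  have H0: "0 \<le> H A x" for A x unfolding H_def by (intro sum_nonneg) (simp add: h01)
  have hint: "integrable Q (\<lambda>x. h A (x$a))" if "prob_space Q" "sets Q = sets borel" for Q A a
  proof -
    interpret prob_space Q by fact
    note [measurable_cong] = that(2)
    show ?thesis by (intro integrable_const_bound[where B=1]) (auto simp: h01)
  qed
  have Hint: "integrable (P n) (H A)" "integrable \<mu> (H A)" for n A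
    unfolding H_def by (intro Bochner_Integration.integrable_sum hint P \<mu>)+
  have Hconv: "(\<lambda>n. \<integral>x. H A x \<partial>P n) \<longlonglongrightarrow> (\<integral>x. H A x \<partial>\<mu>)" for A
  proof -
    have "(\<lambda>n. \<integral>x. h A (x$a) \<partial>P n) \<longlonglongrightarrow> (\<integral>x. h A (x$a) \<partial>\<mu>)" for a
    proof -
      have rd: "real_distribution (distr (P n) borel (\<lambda>x. x$a))" "real_distribution (distr \<mu> borel (\<lambda>x. x$a))" for n
        unfolding real_distribution_def real_distribution_axioms_def
        by (auto intro!: P.prob_space_distr \<mu>.prob_space_distr)
      have chardistr: "char (distr Q borel (\<lambda>x. x$a)) t = (\<integral>x. iexp (axis a t \<bullet> x) \<partial>Q)" if "sets Q = sets borel" for Q t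
      proof -
        note [measurable_cong] = that
        show ?thesis unfolding char_def by (subst integral_distr) (auto simp: inner_axis')
      qed
      have "weak_conv_m (\<lambda>n. distr (P n) borel (\<lambda>x. x$a)) (distr \<mu> borel (\<lambda>x. x$a))"
        by (intro levy_continuity rd) (simp add: chardistr P(2) \<mu>(2) char)
      then have "(\<lambda>n. integral\<^sup>L (distr (P n) borel (\<lambda>x. x$a)) (h A)) \<longlonglongrightarrow> integral\<^sup>L (distr \<mu> borel (\<lambda>x. x$a)) (h A)"
        using rd by (intro weak_conv_imp_integral_bdd_continuous_conv[where B=1]) (auto simp: h_def intro!: continuous_intros)
      then show ?thesis by (simp add: integral_distr)
    qed
    then show ?thesis
      unfolding H_def Bochner_Integration.integral_sum[OF hint[OF P]] Bochner_Integration.integral_sum[OF hint[OF \<mu>]]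
      by (intro tendsto_sum)
  qed
  have Htight: "(\<lambda>k. \<integral>x. H (real k) x \<partial>\<mu>) \<longlonglongrightarrow> 0"
  proof -
    have "(\<lambda>k. \<integral>x. h (real k) (x$a) \<partial>\<mu>) \<longlonglongrightarrow> (\<integral>x. 0 \<partial>\<mu>)" for a
    proof (rule integral_dominated_convergence[where w="\<lambda>_. 1"])
      show "AE x in \<mu>. (\<lambda>k. h (real k) (x$a)) \<longlonglongrightarrow> 0"
      proof (intro AE_I2 tendsto_eventually)
        fix x :: "real^'k"
        show "\<forall>\<^sub>F k in sequentially. h (real k) (x$a) = 0"
          using eventually_ge_at_top[of "nat \<lceil>\<bar>x$a\<bar>\<rceil>"]
        proof eventually_elim
          case (elim k)
          then have "\<bar>x$a\<bar> \<le> real k" by linarith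
          then show ?case by (simp add: h_def)
        qed
      qed
    qed (auto simp: h01)
    then have "(\<lambda>k. \<Sum>a\<in>UNIV. \<integral>x. h (real k) (x$a) \<partial>\<mu>) \<longlonglongrightarrow> (\<Sum>a\<in>(UNIV::'k set). 0)"
      by (intro tendsto_sum) simp
    then show ?thesis unfolding H_def Bochner_Integration.integral_sum[OF hint[OF \<mu>]] by simp
  qed
  fix f :: "real^'k \<Rightarrow> real" assume f: "continuous_on UNIV f" "bounded (range f)"
  from f(2) obtain B where B: "\<And>x. \<bar>f x\<bar> \<le> B" by (auto simp: bounded_iff)
  then have B0: "B \<ge> 0" using order_trans[OF abs_ge_zero B] by auto
  have [measurable]: "f \<in> borel_measurable borel" using f(1) by (rule borel_measurable_continuous_onI)
  show "(\<lambda>n. \<integral>x. f x \<partial>P n) \<longlonglongrightarrow> (\<integral>x. f x \<partial>\<mu>)"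
  proof (rule LIMSEQ_I)
    fix e0 :: real assume "e0 > 0"
    \<comment> \<open>The budget: (2 B + 2) e for each of the two laws and e for the trigonometric
      polynomial, in all (4 B + 5) e.\<close>
    define e where "e = min 1 (e0 / (2 * (2 * B + 3)))"
    have e: "e > 0" "e \<le> 1" using \<open>e0 > 0\<close> B0 by (auto simp: e_def)
    have "\<forall>\<^sub>F k in sequentially. (\<integral>x. H (real k) x \<partial>\<mu>) < e"
      using Htight e(1) by (rule order_tendstoD)
    then obtain k where k: "(\<integral>x. H (real k) x \<partial>\<mu>) < e" by (auto simp: eventually_sequentially)
    define A where "A = real k + 1"
    have A: "A > 0" by (simp add: A_def)
    define K :: "(real^'k) set" where "K = cbox (\<chi> i. -1) (\<chi> i. 1)"
    \<comment> \<open>The substitution s = sin(pi x / (2 A)) identifies the cube of half-width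
      \<open>A\<close> with \<open>K\<close>, so a polynomial in s given by Stone-Weierstrass is a
      trigonometric polynomial in x.\<close>
    define g where "g = (\<lambda>s::real^'k. f (\<chi> i. 2 * A / pi * arcsin (s$i)))"
    have "continuous_on K g" unfolding g_def
      by (intro continuous_on_compose2[OF f(1)] continuous_on_vec_lambda continuous_intros)
         (auto simp: K_def mem_box_cart)
    then obtain p where p: "real_polynomial_function p" "\<And>x. x \<in> K \<Longrightarrow> \<bar>g x - p x\<bar> < e"
      using Stone_Weierstrass_real_polynomial_function[of K g e] e by (auto simp: K_def)
    define q where "q = (\<lambda>x::real^'k. p (\<chi> i. sin (pi / (2 * A) * x$i)))"
    have inK: "(\<chi> i. sin (pi / (2 * A) * x$i)) \<in> K" for x :: "real^'k"
      by (auto simp: K_def mem_box_cart)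
    have tq: "trigpoly (\<lambda>x. complex_of_real (q x))"
      unfolding q_def using p(1) by (rule trigpoly_polynomial_sin)
    have qm [measurable]: "q \<in> borel_measurable borel"
      using measurable_compose[OF conjunct1[OF trigpoly_bounded_measurable[OF tq]] borel_measurable_Re] by simp
    \<comment> \<open>The sines stay in \<open>K\<close> for every x, so the approximation bounds
      \<open>q\<close> globally and not just on the cube.\<close>
    have qb: "\<bar>q x\<bar> \<le> B + e" for x
      using p(2)[OF inK[of x]] B[of "(\<chi> i. 2 * A / pi * arcsin (sin (pi / (2 * A) * x$i)))"]
      unfolding q_def g_def by simp
    have close: "\<bar>f x - q x\<bar> \<le> e" if "\<And>a. \<bar>x$a\<bar> \<le> A" for x
    proof -
      have "(\<chi> i. 2 * A / pi * arcsin (sin (pi / (2 * A) * x$i))) = x"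
      proof (simp add: vec_eq_iff, intro allI)
        fix i
        have "arcsin (sin (pi * x$i / (2 * A))) = pi * x$i / (2 * A)"
        proof (rule arcsin_sin)
          have "- A \<le> x$i" "x$i \<le> A" using that[of i] by auto
          then have "pi * (-A) \<le> pi * x$i" "pi * x$i \<le> pi * A" by (intro mult_left_mono; simp)+
          then show "- (pi / 2) \<le> pi * x$i / (2 * A)" "pi * x$i / (2 * A) \<le> pi / 2"
            using A by (simp_all add: field_simps)
        qed
        then show "2 * A * arcsin (sin (pi * x $ i / (2 * A))) / pi = x $ i" using A by simp
      qed
      then show ?thesis using p(2)[OF inK[of x]] by (simp add: q_def g_def)
    qed
    \<comment> \<open>Outside the cube the difference is at most 2 B + e, and the cutoff pays for it
      since \<open>H (real k) x\<close> is at least 1 there.\<close>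
    have diff: "\<bar>f x - q x\<bar> \<le> e + (2 * B + 1) * H (real k) x" for x
    proof (cases "\<forall>a. \<bar>x$a\<bar> \<le> A")
      case True
      then show ?thesis using close[of x] H0[of "real k" x] B0 by (smt (verit) mult_nonneg_nonneg)
    next
      case False
      then obtain a where "\<bar>x$a\<bar> > A" by (auto simp: not_le)
      then have "h (real k) (x$a) = 1" by (auto simp: h_def A_def)
      moreover have "h (real k) (x$a) \<le> H (real k) x"
        unfolding H_def by (rule member_le_sum) (auto simp: h01)
      ultimately have "(2 * B + 1) * 1 \<le> (2 * B + 1) * H (real k) x" using B0 by (intro mult_left_mono) auto
      moreover have "\<bar>f x - q x\<bar> \<le> B + (B + e)"
        by (rule order_trans[OF abs_triangle_ineq4 add_mono[OF B qb]])
      ultimately show ?thesis by simp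
    qed
    have dint: "\<bar>(\<integral>x. f x \<partial>Q) - (\<integral>x. q x \<partial>Q)\<bar> \<le> e + (2 * B + 1) * (\<integral>x. H (real k) x \<partial>Q)"
      if Q: "prob_space Q" "sets Q = sets borel" "integrable Q (H (real k))" for Q
    proof -
      interpret prob_space Q by fact
      note [measurable_cong] = Q(2)
      have 1: "integrable Q f" using B by (intro integrable_const_bound[where B=B]) auto
      have 2: "integrable Q q" using qb by (intro integrable_const_bound[where B="B + e"]) auto
      have "\<bar>(\<integral>x. f x \<partial>Q) - (\<integral>x. q x \<partial>Q)\<bar> = \<bar>\<integral>x. f x - q x \<partial>Q\<bar>" using 1 2 by simp
      also have "\<dots> \<le> (\<integral>x. \<bar>f x - q x\<bar> \<partial>Q)" by (rule integral_abs_bound)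
      also have "\<dots> \<le> (\<integral>x. e + (2 * B + 1) * H (real k) x \<partial>Q)"
        using 1 2 Q(3) by (intro integral_mono diff) auto
      also have "\<dots> = e + (2 * B + 1) * (\<integral>x. H (real k) x \<partial>Q)" using Q(3) by (simp add: prob_space)
      finally show ?thesis .
    qed
    have "(\<lambda>n. \<integral>x. complex_of_real (q x) \<partial>P n) \<longlonglongrightarrow> (\<integral>x. complex_of_real (q x) \<partial>\<mu>)"
      using P \<mu> char tq by (rule trigpoly_integral_tendsto)
    then have "(\<lambda>n. \<integral>x. q x \<partial>P n) \<longlonglongrightarrow> (\<integral>x. q x \<partial>\<mu>)"
      by (simp add: tendsto_of_real_iff)
    then have "\<forall>\<^sub>F n in sequentially. \<bar>(\<integral>x. q x \<partial>P n) - (\<integral>x. q x \<partial>\<mu>)\<bar> < e"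
      using e(1) by (auto dest!: tendstoD simp: dist_real_def)
    moreover have "\<forall>\<^sub>F n in sequentially. (\<integral>x. H (real k) x \<partial>P n) < e"
      using Hconv k by (rule order_tendstoD)
    ultimately have "\<forall>\<^sub>F n in sequentially. norm ((\<integral>x. f x \<partial>P n) - (\<integral>x. f x \<partial>\<mu>)) < e0"
    proof eventually_elim
      case (elim n)
      have "(2 * B + 1) * (\<integral>x. H (real k) x \<partial>P n) \<le> (2 * B + 1) * e" "(2 * B + 1) * (\<integral>x. H (real k) x \<partial>\<mu>) \<le> (2 * B + 1) * e"
        using elim k B0 by (auto intro!: mult_left_mono)
      then have "\<bar>(\<integral>x. f x \<partial>P n) - (\<integral>x. f x \<partial>\<mu>)\<bar> < e * (4 * B + 5)"
        using dint[OF P(1) P(2) Hint(1)[of n]] dint[OF \<mu> Hint(2)] elim by (simp add: algebra_simps)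
      also have "\<dots> \<le> e0"
      proof -
        have "e * (4 * B + 5) \<le> e0 / (2 * (2 * B + 3)) * (4 * B + 6)"
          using B0 \<open>e0 > 0\<close> by (intro mult_mono) (auto simp: e_def)
        also have "\<dots> = e0" using B0 by (simp add: field_simps)
        finally show ?thesis .
      qed
      finally show ?case by simp
    qed
    then show "\<exists>no. \<forall>n\<ge>no. norm ((\<integral>x. f x \<partial>P n) - (\<integral>x. f x \<partial>\<mu>)) < e0"
      by (auto simp: eventually_sequentially)
  qed
qed

section \<open>Mixing and a central limit theorem for separated blocks\<close>

definition shift :: "int \<Rightarrow> (int \<Rightarrow> 'a) \<Rightarrow> int \<Rightarrow> 'a" where
  "shift h x = (\<lambda>k. x (k + h))"

text \<open>A functional substitute for measurability with respect to the coordinates in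
  \<open>I\<close>; \<open>depends_on_sa_measurable\<close> links the two.\<close>

definition depends_on :: "((int \<Rightarrow> 'a) \<Rightarrow> 'b) \<Rightarrow> int set \<Rightarrow> bool" where
  "depends_on f I \<longleftrightarrow> (\<forall>x y. (\<forall>k\<in>I. x k = y k) \<longrightarrow> f x = f y)"

abbreviation seqM :: "(int \<Rightarrow> 'a::topological_space) measure" where
  "seqM \<equiv> Pi\<^sub>M UNIV (\<lambda>_. borel)"

lemma depends_onD: "depends_on f I \<Longrightarrow> (\<And>k. k \<in> I \<Longrightarrow> x k = y k) \<Longrightarrow> f x = f y"
  by (auto simp: depends_on_def)

lemma depends_on_mono: "depends_on f I \<Longrightarrow> I \<subseteq> J \<Longrightarrow> depends_on f J"
  unfolding depends_on_def by blast

lemma depends_on_shift: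
  assumes "depends_on f I" "\<And>k. k \<in> I \<Longrightarrow> k + h \<in> J"
  shows "depends_on (\<lambda>x. f (shift h x)) J"
  unfolding depends_on_def
proof (intro allI impI)
  fix x y :: "int \<Rightarrow> 'a" assume "\<forall>k\<in>J. x k = y k"
  then show "f (shift h x) = f (shift h y)"
    using assms(2) by (intro depends_onD[OF assms(1)]) (simp add: shift_def)
qed

lemma shift_measurable [measurable]: "shift h \<in> measurable seqM seqM"
  unfolding shift_def by (rule measurable_PiM_single') auto

text \<open>The upper half combines exp x \<ge> 1 + x with (1 - x + x^2) (1 + x) = 1 + x^3 \<ge>
  1.\<close>

lemma abs_exp_minus_le:
  fixes x :: real assumes "x \<ge> 0"
  shows "\<bar>exp (- x) - (1 - x)\<bar> \<le> x\<^sup>2"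
proof -
  have 1: "exp (- x) \<ge> 1 - x" using exp_ge_add_one_self[of "- x"] by simp
  have "exp (- x) \<le> 1 / (1 + x)"
    using exp_ge_add_one_self[of x] assms by (simp add: exp_minus field_simps)
  also have "\<dots> \<le> 1 - x + x\<^sup>2"
  proof -
    have "1 \<le> 1 + x^3" using assms by simp
    also have "\<dots> = (1 - x + x\<^sup>2) * (1 + x)" by (simp add: algebra_simps power2_eq_square power3_eq_cube)
    finally show ?thesis using assms by (simp add: pos_divide_le_eq)
  qed
  finally show ?thesis using 1 by auto
qed

section \<open>Stationary sequences and the sigma-algebras of their coordinates\<close>

locale stationary_sequence = prob_space M for M :: "'w measure" +
  fixes X :: "int \<Rightarrow> 'w \<Rightarrow> 'a::{real_normed_vector,second_countable_topology}"
  assumes X_measurable [measurable]: "\<And>j. X j \<in> borel_measurable M"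
    and stationary: "stationary M X"
begin

definition path :: "'w \<Rightarrow> int \<Rightarrow> 'a" where "path \<omega> = (\<lambda>k. X k \<omega>)"

lemma path_measurable [measurable]: "path \<in> measurable M seqM"
  unfolding path_def by (rule measurable_PiM_single') auto

lemma distr_shift: "distr M seqM (\<lambda>\<omega>. shift h (path \<omega>)) = distr M seqM path"
  using stationary unfolding stationary_def shift_def path_def by simp

lemma integral_shift:
  fixes F :: "_ \<Rightarrow> 'b::{banach,second_countable_topology}"
  assumes [measurable]: "F \<in> borel_measurable seqM"
  shows "(\<integral>\<omega>. F (shift h (path \<omega>)) \<partial>M) = (\<integral>\<omega>. F (path \<omega>) \<partial>M)"
proof -
  have "(\<integral>\<omega>. F (shift h (path \<omega>)) \<partial>M) = (\<integral>x. F x \<partial>distr M seqM (\<lambda>\<omega>. shift h (path \<omega>)))"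
    by (rule integral_distr[symmetric]) measurable
  also have "\<dots> = (\<integral>x. F x \<partial>distr M seqM path)" by (simp only: distr_shift)
  also have "\<dots> = (\<integral>\<omega>. F (path \<omega>) \<partial>M)" by (rule integral_distr) measurable
  finally show ?thesis .
qed

lemma prob_shift:
  assumes [measurable]: "Measurable.pred seqM Q"
  shows "prob {\<omega>\<in>space M. Q (shift h (path \<omega>))} = prob {\<omega>\<in>space M. Q (path \<omega>)}"
proof -
  have "prob {\<omega>\<in>space M. Q (g \<omega>)} = (\<integral>\<omega>. indicator {x. Q x} (g \<omega>) \<partial>M)"
    if [measurable]: "g \<in> measurable M seqM" for g
  proof -
    have "(\<integral>\<omega>. indicator {x. Q x} (g \<omega>) \<partial>M) = (\<integral>\<omega>. indicator {\<omega>\<in>space M. Q (g \<omega>)} \<omega> \<partial>M :: real)"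
      by (intro Bochner_Integration.integral_cong) (auto simp: indicator_def)
    also have "\<dots> = prob ({\<omega>\<in>space M. Q (g \<omega>)} \<inter> space M)" by (rule Bochner_Integration.integral_indicator)
    also have "{\<omega>\<in>space M. Q (g \<omega>)} \<inter> space M = {\<omega>\<in>space M. Q (g \<omega>)}" by auto
    finally show ?thesis by simp
  qed
  moreover have "(\<lambda>x. indicator {x. Q x} x :: real) \<in> borel_measurable seqM"
    by (simp add: indicator_def)
  ultimately show ?thesis
    using integral_shift[of "\<lambda>x. indicator {x. Q x} x :: real" h] by simp
qed

definition sa :: "int set \<Rightarrow> 'w measure" where
  "sa I = sigma (space M) {X k -` B \<inter> space M | k B. k \<in> I \<and> B \<in> sets borel}"

lemma space_sa [simp]: "space (sa I) = space M"
  unfolding sa_def by (simp add: space_measure_of_conv)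

lemma sets_sa: "sets (sa I) = sigma_sets (space M) {X k -` B \<inter> space M | k B. k \<in> I \<and> B \<in> sets borel}"
  unfolding sa_def by (rule sets_measure_of) auto

lemma past_sa_eq: "past_sa M X j = sets (sa {..j})"
  and future_sa_eq: "future_sa M X j = sets (sa {j..})"
  by (simp_all add: sets_sa past_sa_def future_sa_def)

lemma sets_sa_subset: "sets (sa I) \<subseteq> events"
  unfolding sets_sa
proof (rule sets.sigma_sets_subset, safe)
  fix k and B :: "'a set" assume "B \<in> sets borel"
  then show "X k -` B \<inter> space M \<in> events" by (rule measurable_sets[OF X_measurable])
qed

text \<open>Setting the coordinates outside \<open>I\<close> to 0 leaves the value of f unchanged
  and turns the path into a function measurable for \<open>sa I\<close>.\<close>

lemma depends_on_sa_measurable: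
  assumes [measurable]: "f \<in> measurable seqM N" and dep: "depends_on f I"
  shows "(\<lambda>\<omega>. f (path \<omega>)) \<in> measurable (sa I) N"
proof -
  define g where "g = (\<lambda>\<omega> k. if k \<in> I then X k \<omega> else 0)"
  have "g \<in> measurable (sa I) seqM" unfolding g_def
  proof (rule measurable_PiM_single')
    fix k :: int
    have "X k \<in> measurable (sa I) borel" if "k \<in> I"
      using that by (intro measurableI) (auto simp: sets_sa intro!: sigma_sets.Basic)
    then show "(\<lambda>\<omega>. if k \<in> I then X k \<omega> else 0) \<in> measurable (sa I) borel" by (cases "k \<in> I") auto
  qed auto
  then have "(\<lambda>\<omega>. f (g \<omega>)) \<in> measurable (sa I) N" by measurable
  moreover have "f (g \<omega>) = f (path \<omega>)" for \<omega>
    using dep by (rule depends_onD) (simp add: g_def path_def)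
  ultimately show ?thesis by simp
qed

section \<open>Covariance bounds from beta-mixing\<close>

lemma sum_prob_partition:
  assumes "finite I" "\<And>a. a \<in> I \<Longrightarrow> A a \<in> events" "disjoint_family_on A I" "(\<Union>a\<in>I. A a) = space M" "C \<in> events"
  shows "(\<Sum>a\<in>I. prob (A a \<inter> C)) = prob C"
proof -
  have "(\<Sum>a\<in>I. prob (A a \<inter> C)) = prob (\<Union>a\<in>I. A a \<inter> C)"
    using assms by (intro finite_measure_finite_Union[symmetric]) (auto simp: disjoint_family_on_def)
  also have "(\<Union>a\<in>I. A a \<inter> C) = C" using assms sets.sets_into_space[OF assms(5)] by auto
  finally show ?thesis .
qed

text \<open>A real \<open>Sup\<close> bounds its members only if the set is bounded above. Here 1 is
  a bound, because the joint masses and the product masses both add up to 1.\<close>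

lemma beta_mix_ge_partition:
  fixes I J :: "nat set"
  assumes "finite I" "finite J" "\<And>a. a \<in> I \<Longrightarrow> A a \<in> past_sa M X 0" "\<And>b. b \<in> J \<Longrightarrow> B b \<in> future_sa M X (int l)"
    "disjoint_family_on A I" "disjoint_family_on B J" "(\<Union>a\<in>I. A a) = space M" "(\<Union>b\<in>J. B b) = space M"
  shows "(\<Sum>a\<in>I. \<Sum>b\<in>J. \<bar>prob (A a \<inter> B b) - prob (A a) * prob (B b)\<bar>) \<le> 2 * beta_mix M X l"
proof -
  define Z where "Z = {(\<Sum>a\<in>I. \<Sum>b\<in>J. \<bar>measure M (A a \<inter> B b) - measure M (A a) * measure M (B b)\<bar>) / 2
       | (I::nat set) (J::nat set) A B. finite I \<and> finite J
         \<and> (\<forall>a\<in>I. A a \<in> past_sa M X 0) \<and> (\<forall>b\<in>J. B b \<in> future_sa M X (int l))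
         \<and> disjoint_family_on A I \<and> disjoint_family_on B J
         \<and> (\<Union>a\<in>I. A a) = space M \<and> (\<Union>b\<in>J. B b) = space M}"
  have le: "(\<Sum>a\<in>I. \<Sum>b\<in>J. \<bar>prob (A a \<inter> B b) - prob (A a) * prob (B b)\<bar>) / 2 \<le> 1"
    if H: "finite I" "finite J" "\<forall>a\<in>I. A a \<in> past_sa M X 0" "\<forall>b\<in>J. B b \<in> future_sa M X (int l)"
    "disjoint_family_on A I" "disjoint_family_on B J" "(\<Union>a\<in>I. A a) = space M" "(\<Union>b\<in>J. B b) = space M"
    for I J :: "nat set" and A B
  proof -
    have A: "A a \<in> events" if "a \<in> I" for a using H(3) that sets_sa_subset unfolding past_sa_eq by auto
    have B: "B b \<in> events" if "b \<in> J" for b using H(4) that sets_sa_subset unfolding future_sa_eq by auto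
    have sA: "(\<Sum>a\<in>I. prob (A a)) = 1"
      using sum_prob_partition[OF H(1) A H(5) H(7) sets.top] A by (simp add: prob_space Int_absorb2[OF sets.sets_into_space])
    have sB: "(\<Sum>b\<in>J. prob (B b)) = 1"
      using sum_prob_partition[OF H(2) B H(6) H(8) sets.top] B by (simp add: prob_space Int_absorb2[OF sets.sets_into_space])
    have "(\<Sum>a\<in>I. \<Sum>b\<in>J. \<bar>prob (A a \<inter> B b) - prob (A a) * prob (B b)\<bar>)
      \<le> (\<Sum>a\<in>I. \<Sum>b\<in>J. prob (A a \<inter> B b) + prob (A a) * prob (B b))"
      by (intro sum_mono order_trans[OF abs_triangle_ineq4]) simp
    also have "\<dots> = (\<Sum>a\<in>I. \<Sum>b\<in>J. prob (B b \<inter> A a)) + (\<Sum>a\<in>I. prob (A a)) * (\<Sum>b\<in>J. prob (B b))"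
      by (simp add: sum.distrib sum_product Int_commute)
    also have "(\<Sum>a\<in>I. \<Sum>b\<in>J. prob (B b \<inter> A a)) = (\<Sum>a\<in>I. prob (A a))"
      using sum_prob_partition[OF H(2) B H(6) H(8) A] by (intro sum.cong) auto
    finally show ?thesis unfolding sA sB by simp
  qed
  have "bdd_above Z"
  proof (rule bdd_aboveI[where M=1])
    fix z assume "z \<in> Z"
    then show "z \<le> 1" unfolding Z_def mem_Collect_eq
      by (elim exE conjE) (simp only:, rule le)
  qed
  moreover have "(\<Sum>a\<in>I. \<Sum>b\<in>J. \<bar>prob (A a \<inter> B b) - prob (A a) * prob (B b)\<bar>) / 2 \<in> Z"
    unfolding Z_def mem_Collect_eq using assms
    by (intro exI[of _ I] exI[of _ J] exI[of _ A] exI[of _ B] conjI ballI refl)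
  ultimately have "(\<Sum>a\<in>I. \<Sum>b\<in>J. \<bar>prob (A a \<inter> B b) - prob (A a) * prob (B b)\<bar>) / 2 \<le> Sup Z"
    by (intro cSup_upper)
  then show ?thesis unfolding beta_mix_def Z_def by simp
qed

lemma beta_mix_nonneg: "beta_mix M X l \<ge> 0"
proof -
  have "(\<Sum>a\<in>{0::nat}. \<Sum>b\<in>{0::nat}. \<bar>prob (space M \<inter> space M) - prob (space M) * prob (space M)\<bar>) \<le> 2 * beta_mix M X l"
    by (rule beta_mix_ge_partition[where A="\<lambda>_. space M" and B="\<lambda>_. space M"])
       (auto simp: past_sa_eq future_sa_eq disjoint_family_on_def intro: sets.top[of "sa _", simplified])
  then show ?thesis by (simp add: prob_space)
qed

text \<open>Rounding f and g to a grid of mesh 1 / K makes them step functions on finite partitions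
  of past and future; their covariance is then bounded by a partition sum, and K tends to
  infinity.\<close>

lemma covariance_le_beta_mix_0:
  fixes f g :: "(int \<Rightarrow> 'a) \<Rightarrow> real"
  assumes f [measurable]: "f \<in> borel_measurable seqM" and g [measurable]: "g \<in> borel_measurable seqM"
    and df: "depends_on f {..0}" and dg: "depends_on g {int l..}"
    and bf: "\<And>x. \<bar>f x\<bar> \<le> 1" and bg: "\<And>x. \<bar>g x\<bar> \<le> 1"
  shows "\<bar>(\<integral>\<omega>. f (path \<omega>) * g (path \<omega>) \<partial>M) - (\<integral>\<omega>. f (path \<omega>) \<partial>M) * (\<integral>\<omega>. g (path \<omega>) \<partial>M)\<bar> \<le> 2 * beta_mix M X l"
proof -
  \<comment> \<open>Rounding costs 2 / K for the integral of the product and 2 / K for the product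
    of the integrals.\<close>
  have step: "\<bar>(\<integral>\<omega>. f (path \<omega>) * g (path \<omega>) \<partial>M) - (\<integral>\<omega>. f (path \<omega>) \<partial>M) * (\<integral>\<omega>. g (path \<omega>) \<partial>M)\<bar>
     \<le> 2 * beta_mix M X l + 4 / real K" if K: "K > 0" for K :: nat
  proof -
    define d where "d = (\<lambda>y::real. real_of_int \<lfloor>real K * y\<rfloor> / real K)"
    have [measurable]: "d \<in> borel_measurable borel" unfolding d_def by measurable
    \<comment> \<open>The floor lies between -K and K; adding K makes the level sets indexed by the
      natural numbers up to 2 K, as the partitions in \<open>beta_mix\<close> are.\<close>
    define A where "A = (\<lambda>h a. {\<omega>\<in>space M. \<lfloor>real K * h (path \<omega>)\<rfloor> = int a - int K})"
    define v where "v = (\<lambda>a::nat. (real a - real K) / real K)"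
    have fl: "\<lfloor>real K * y\<rfloor> \<le> int K \<and> - int K \<le> \<lfloor>real K * y\<rfloor>" if "\<bar>y\<bar> \<le> 1" for y :: real
    proof -
      have "real K * y \<le> real K * 1" "real K * (-1) \<le> real K * y" using that by (intro mult_left_mono; simp)+
      then show ?thesis by (simp add: floor_le_iff le_floor_iff) 
    qed
    have db: "\<bar>d y\<bar> \<le> 1" if "\<bar>y\<bar> \<le> 1" for y
    proof -
      have "\<bar>real_of_int \<lfloor>real K * y\<rfloor>\<bar> \<le> real K" using fl[OF that] by linarith
      then show ?thesis unfolding d_def using K by (simp add: field_simps)
    qed
    have dd: "\<bar>y - d y\<bar> \<le> 1 / real K" for y
    proof -
      have "\<bar>real K * y - real_of_int \<lfloor>real K * y\<rfloor>\<bar> \<le> 1" by linarith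
      then have "\<bar>(real K * y - real_of_int \<lfloor>real K * y\<rfloor>) / real K\<bar> \<le> 1 / real K"
        using K by (simp add: divide_right_mono)
      then show ?thesis unfolding d_def using K by (simp add: diff_divide_distrib)
    qed
    have rep: "d (h (path \<omega>)) = (\<Sum>a\<le>2*K. v a * indicator (A h a) \<omega>)" if "\<And>x. \<bar>h x\<bar> \<le> 1" "\<omega> \<in> space M" for h \<omega>
    proof -
      define a0 where "a0 = nat (\<lfloor>real K * h (path \<omega>)\<rfloor> + int K)"
      have a0: "int a0 = \<lfloor>real K * h (path \<omega>)\<rfloor> + int K" "a0 \<le> 2 * K"
        using fl[OF that(1)[of "path \<omega>"]] by (auto simp: a0_def)
      have "v a * indicator (A h a) \<omega> = (if a = a0 then v a0 else 0)" for a
        using a0(1) that(2) by (auto simp: A_def indicator_def)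
      then have "(\<Sum>a\<le>2*K. v a * indicator (A h a) \<omega>) = v a0" using a0(2) by simp
      moreover have "real a0 = real_of_int \<lfloor>real K * h (path \<omega>)\<rfloor> + real K" using a0(1) by linarith
      ultimately show ?thesis by (simp add: v_def d_def)
    qed
    have vb: "\<bar>v a\<bar> \<le> 1" if "a \<le> 2 * K" for a using that K by (auto simp: v_def field_simps abs_le_iff)
    have un: "(\<Union>a\<in>{..2*K}. A h a) = space M" if "\<And>x. \<bar>h x\<bar> \<le> 1" for h
    proof
      show "space M \<subseteq> (\<Union>a\<in>{..2*K}. A h a)"
      proof
        fix \<omega> assume "\<omega> \<in> space M"
        then have "\<omega> \<in> A h (nat (\<lfloor>real K * h (path \<omega>)\<rfloor> + int K))" "nat (\<lfloor>real K * h (path \<omega>)\<rfloor> + int K) \<in> {..2*K}"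
          using fl[OF that[of "path \<omega>"]] by (auto simp: A_def)
        then show "\<omega> \<in> (\<Union>a\<in>{..2*K}. A h a)" by blast
      qed
    qed (auto simp: A_def)
    have disj: "disjoint_family_on (A h) {..2*K}" for h by (auto simp: disjoint_family_on_def A_def)
    have Asa: "A h a \<in> sets (sa I)" if hm [measurable]: "h \<in> borel_measurable seqM" and "depends_on h I" for h I a
    proof -
      have [measurable]: "(\<lambda>\<omega>. h (path \<omega>)) \<in> borel_measurable (sa I)"
        using that by (rule depends_on_sa_measurable)
      have "{\<omega>\<in>space (sa I). \<lfloor>real K * h (path \<omega>)\<rfloor> = int a - int K} \<in> sets (sa I)" by measurable
      then show ?thesis by (simp add: A_def)
    qed
    have Af [measurable]: "A f a \<in> events" and Ag [measurable]: "A g a \<in> events" for a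
      using Asa[OF f df] Asa[OF g dg] sets_sa_subset by auto
    have I1: "(\<integral>\<omega>. d (h (path \<omega>)) \<partial>M) = (\<Sum>a\<le>2*K. v a * prob (A h a))"
      if "\<And>x. \<bar>h x\<bar> \<le> 1" "\<And>a. A h a \<in> events" for h
    proof -
      have "(\<integral>\<omega>. d (h (path \<omega>)) \<partial>M) = (\<integral>\<omega>. (\<Sum>a\<le>2*K. v a * indicator (A h a) \<omega>) \<partial>M)"
        using rep[of h] that by (intro Bochner_Integration.integral_cong) auto
      also have "\<dots> = (\<Sum>a\<le>2*K. v a * prob (A h a))"
        using that(2) sets.sets_into_space[OF that(2)] 
        by (subst Bochner_Integration.integral_sum) (auto simp: Int_absorb1 Int_absorb2 emeasure_eq_measure)
      finally show ?thesis .
    qed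
    have I2: "(\<integral>\<omega>. d (f (path \<omega>)) * d (g (path \<omega>)) \<partial>M) = (\<Sum>a\<le>2*K. \<Sum>b\<le>2*K. v a * v b * prob (A f a \<inter> A g b))"
    proof -
      have "(\<integral>\<omega>. d (f (path \<omega>)) * d (g (path \<omega>)) \<partial>M)
        = (\<integral>\<omega>. (\<Sum>a\<le>2*K. \<Sum>b\<le>2*K. v a * v b * indicator (A f a \<inter> A g b) \<omega>) \<partial>M)"
      proof (intro Bochner_Integration.integral_cong refl)
        fix \<omega> assume w: "\<omega> \<in> space M"
        show "d (f (path \<omega>)) * d (g (path \<omega>)) = (\<Sum>a\<le>2*K. \<Sum>b\<le>2*K. v a * v b * indicator (A f a \<inter> A g b) \<omega>)"
          unfolding rep[of f, OF bf w] rep[of g, OF bg w] sum_product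
          by (intro sum.cong refl) (auto simp: indicator_def)
      qed
      also have "\<dots> = (\<Sum>a\<le>2*K. \<Sum>b\<le>2*K. v a * v b * prob (A f a \<inter> A g b))"
      proof -
        have "A f a \<inter> A g b \<inter> space M = A f a \<inter> A g b" for a b by (auto simp: A_def)
        moreover have "integrable M (\<lambda>\<omega>. v a * v b * indicator (A f a \<inter> A g b) \<omega>)" for a b
          by (intro integrable_mult_right) (auto simp: emeasure_eq_measure)
        ultimately show ?thesis by (simp only: Bochner_Integration.integral_sum Bochner_Integration.integrable_sum
          integral_mult_right_zero Bochner_Integration.integral_indicator)
      qed
      finally show ?thesis .
    qed
    have "\<bar>(\<integral>\<omega>. d (f (path \<omega>)) * d (g (path \<omega>)) \<partial>M) - (\<integral>\<omega>. d (f (path \<omega>)) \<partial>M) * (\<integral>\<omega>. d (g (path \<omega>)) \<partial>M)\<bar>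
       = \<bar>\<Sum>a\<le>2*K. \<Sum>b\<le>2*K. v a * v b * (prob (A f a \<inter> A g b) - prob (A f a) * prob (A g b))\<bar>"
      unfolding I2 I1[of f, OF bf Af] I1[of g, OF bg Ag] sum_product sum_subtractf[symmetric]
      by (intro arg_cong[where f=abs] sum.cong refl) (simp add: algebra_simps)
    also have "\<dots> \<le> (\<Sum>a\<le>2*K. \<Sum>b\<le>2*K. \<bar>v a * v b * (prob (A f a \<inter> A g b) - prob (A f a) * prob (A g b))\<bar>)"
      by (intro order_trans[OF sum_abs] sum_mono) auto
    also have "\<dots> \<le> (\<Sum>a\<le>2*K. \<Sum>b\<le>2*K. \<bar>prob (A f a \<inter> A g b) - prob (A f a) * prob (A g b)\<bar>)"
    proof (intro sum_mono)
      fix a b assume "a \<in> {..2*K}" "b \<in> {..2*K}"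
      then have "\<bar>v a\<bar> * \<bar>v b\<bar> \<le> 1" using vb[of a] vb[of b] by (simp add: mult_le_one)
      then have "\<bar>v a\<bar> * \<bar>v b\<bar> * \<bar>prob (A f a \<inter> A g b) - prob (A f a) * prob (A g b)\<bar> \<le> 1 * \<bar>prob (A f a \<inter> A g b) - prob (A f a) * prob (A g b)\<bar>"
        by (intro mult_right_mono) auto
      then show "\<bar>v a * v b * (prob (A f a \<inter> A g b) - prob (A f a) * prob (A g b))\<bar> \<le> \<bar>prob (A f a \<inter> A g b) - prob (A f a) * prob (A g b)\<bar>"
        by (simp add: abs_mult)
    qed
    also have "\<dots> \<le> 2 * beta_mix M X l"
      using Asa[OF f df] Asa[OF g dg] un[of f, OF bf] un[of g, OF bg] disj
      by (intro beta_mix_ge_partition) (auto simp: past_sa_eq future_sa_eq)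
    finally have main: "\<bar>(\<integral>\<omega>. d (f (path \<omega>)) * d (g (path \<omega>)) \<partial>M) - (\<integral>\<omega>. d (f (path \<omega>)) \<partial>M) * (\<integral>\<omega>. d (g (path \<omega>)) \<partial>M)\<bar> \<le> 2 * beta_mix M X l" .
    have int: "integrable M (\<lambda>\<omega>. f (path \<omega>))" "integrable M (\<lambda>\<omega>. g (path \<omega>))"
      "integrable M (\<lambda>\<omega>. d (f (path \<omega>)))" "integrable M (\<lambda>\<omega>. d (g (path \<omega>)))"
      "integrable M (\<lambda>\<omega>. f (path \<omega>) * g (path \<omega>))" "integrable M (\<lambda>\<omega>. d (f (path \<omega>)) * d (g (path \<omega>)))"
      by (rule integrable_const_bound[where B=1]; auto simp: bf bg db abs_mult intro!: mult_le_one)+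
    have close: "\<bar>(\<integral>\<omega>. p \<omega> \<partial>M) - (\<integral>\<omega>. q \<omega> \<partial>M)\<bar> \<le> c" 
      if "integrable M p" "integrable M q" "\<And>\<omega>. \<bar>p \<omega> - q \<omega>\<bar> \<le> c" for p q :: "'w \<Rightarrow> real" and c
    proof -
      have "\<bar>(\<integral>\<omega>. p \<omega> \<partial>M) - (\<integral>\<omega>. q \<omega> \<partial>M)\<bar> = \<bar>\<integral>\<omega>. p \<omega> - q \<omega> \<partial>M\<bar>" using that by simp
      also have "\<dots> \<le> (\<integral>\<omega>. \<bar>p \<omega> - q \<omega>\<bar> \<partial>M)" by (rule integral_abs_bound)
      also have "\<dots> \<le> (\<integral>\<omega>. c \<partial>M)" using that by (intro integral_mono) auto
      finally show ?thesis by (simp add: prob_space)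
    qed
    have prodclose: "\<bar>x * y - x' * y'\<bar> \<le> 2 / real K" if "\<bar>x - x'\<bar> \<le> 1 / real K" "\<bar>y - y'\<bar> \<le> 1 / real K" "\<bar>y\<bar> \<le> 1" "\<bar>x'\<bar> \<le> 1"
      for x y x' y' :: real
    proof -
      have "\<bar>x * y - x' * y'\<bar> = \<bar>(x - x') * y + x' * (y - y')\<bar>" by (simp add: algebra_simps)
      also have "\<dots> \<le> \<bar>x - x'\<bar> * \<bar>y\<bar> + \<bar>x'\<bar> * \<bar>y - y'\<bar>" by (metis abs_mult abs_triangle_ineq)
      also have "\<dots> \<le> 1 / real K * 1 + 1 * (1 / real K)" using that by (intro add_mono mult_mono) auto
      finally show ?thesis by simp
    qed
    have absint: "\<bar>\<integral>\<omega>. p \<omega> \<partial>M\<bar> \<le> 1" if "integrable M p" "\<And>\<omega>. \<bar>p \<omega>\<bar> \<le> 1" for p :: "'w \<Rightarrow> real"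
      using close[of p "\<lambda>_. 0" 1] that by simp
    have "\<bar>(\<integral>\<omega>. f (path \<omega>) * g (path \<omega>) \<partial>M) - (\<integral>\<omega>. d (f (path \<omega>)) * d (g (path \<omega>)) \<partial>M)\<bar> \<le> 2 / real K"
      by (intro close int prodclose dd bg db bf)
    moreover have "\<bar>(\<integral>\<omega>. f (path \<omega>) \<partial>M) * (\<integral>\<omega>. g (path \<omega>) \<partial>M) - (\<integral>\<omega>. d (f (path \<omega>)) \<partial>M) * (\<integral>\<omega>. d (g (path \<omega>)) \<partial>M)\<bar> \<le> 2 / real K"
      by (intro prodclose close int dd absint bg db bf)
    ultimately show ?thesis using main by (simp add: field_simps)
  qed
  have "(\<lambda>K. 2 * beta_mix M X l + 4 / real K) \<longlonglongrightarrow> 2 * beta_mix M X l + 0"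
    by (intro tendsto_intros lim_const_over_n)
  moreover have "\<forall>\<^sub>F K in sequentially. \<bar>(\<integral>\<omega>. f (path \<omega>) * g (path \<omega>) \<partial>M) - (\<integral>\<omega>. f (path \<omega>) \<partial>M) * (\<integral>\<omega>. g (path \<omega>) \<partial>M)\<bar>
     \<le> 2 * beta_mix M X l + 4 / real K"
    using eventually_gt_at_top[of 0] by eventually_elim (rule step)
  ultimately show ?thesis
    by (intro tendsto_lowerbound[of _ "2 * beta_mix M X l" sequentially]) auto
qed

lemma covariance_le_beta_mix:
  fixes f g :: "(int \<Rightarrow> 'a) \<Rightarrow> real"
  assumes f [measurable]: "f \<in> borel_measurable seqM" and g [measurable]: "g \<in> borel_measurable seqM"
    and df: "depends_on f {..b}" and dg: "depends_on g {b + int l..}"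
    and bf: "\<And>x. \<bar>f x\<bar> \<le> 1" and bg: "\<And>x. \<bar>g x\<bar> \<le> 1"
  shows "\<bar>(\<integral>\<omega>. f (path \<omega>) * g (path \<omega>) \<partial>M) - (\<integral>\<omega>. f (path \<omega>) \<partial>M) * (\<integral>\<omega>. g (path \<omega>) \<partial>M)\<bar> \<le> 2 * beta_mix M X l"
proof -
  have "depends_on (\<lambda>x. f (shift (- b) x)) {..0}" "depends_on (\<lambda>x. g (shift (- b) x)) {int l..}"
    by (rule depends_on_shift[OF df] depends_on_shift[OF dg]; auto)+
  then have "\<bar>(\<integral>\<omega>. f (shift (- b) (path \<omega>)) * g (shift (- b) (path \<omega>)) \<partial>M)
    - (\<integral>\<omega>. f (shift (- b) (path \<omega>)) \<partial>M) * (\<integral>\<omega>. g (shift (- b) (path \<omega>)) \<partial>M)\<bar> \<le> 2 * beta_mix M X l"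
    by (intro covariance_le_beta_mix_0) (auto simp: bf bg)
  then show ?thesis
    using integral_shift[of "\<lambda>x. f x * g x" "- b"] integral_shift[of f "- b"] integral_shift[of g "- b"] by simp
qed

text \<open>Real and imaginary parts give four real covariances, each at most twice the mixing
  coefficient; hence the 8.\<close>

lemma complex_covariance_le_beta_mix:
  fixes f g :: "(int \<Rightarrow> 'a) \<Rightarrow> complex"
  assumes f [measurable]: "f \<in> borel_measurable seqM" and g [measurable]: "g \<in> borel_measurable seqM"
    and df: "depends_on f {..b}" and dg: "depends_on g {b + int l..}"
    and bf: "\<And>x. norm (f x) \<le> 1" and bg: "\<And>x. norm (g x) \<le> 1"
  shows "norm ((\<integral>\<omega>. f (path \<omega>) * g (path \<omega>) \<partial>M) - (\<integral>\<omega>. f (path \<omega>) \<partial>M) * (\<integral>\<omega>. g (path \<omega>) \<partial>M)) \<le> 8 * beta_mix M X l"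
proof -
  have if1: "integrable M (\<lambda>\<omega>. f (path \<omega>))" and ig1: "integrable M (\<lambda>\<omega>. g (path \<omega>))"
    and ifg: "integrable M (\<lambda>\<omega>. f (path \<omega>) * g (path \<omega>))"
    by (rule integrable_const_bound[where B=1]; auto simp: bf bg norm_mult intro!: mult_le_one)+
  have cov: "\<bar>(\<integral>\<omega>. p (f (path \<omega>)) * q (g (path \<omega>)) \<partial>M) - (\<integral>\<omega>. p (f (path \<omega>)) \<partial>M) * (\<integral>\<omega>. q (g (path \<omega>)) \<partial>M)\<bar> \<le> 2 * beta_mix M X l"
    if "p \<in> {Re, Im}" "q \<in> {Re, Im}" for p q
  proof (rule covariance_le_beta_mix[where b=b])
    show "depends_on (\<lambda>x. p (f x)) {..b}" using df unfolding depends_on_def by metis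
    show "depends_on (\<lambda>x. q (g x)) {b + int l..}" using dg unfolding depends_on_def by metis
    show "(\<lambda>x. p (f x)) \<in> borel_measurable seqM" "(\<lambda>x. q (g x)) \<in> borel_measurable seqM" using that by auto
    show "\<bar>p (f x)\<bar> \<le> 1" "\<bar>q (g x)\<bar> \<le> 1" for x
      using that bf[of x] bg[of x] abs_Re_le_cmod abs_Im_le_cmod order_trans by blast+
  qed
  have ii: "integrable M (\<lambda>\<omega>. p (f (path \<omega>)) * q (g (path \<omega>)))" if "p \<in> {Re, Im}" "q \<in> {Re, Im}" for p q
  proof (rule integrable_const_bound[where B=1])
    show "(\<lambda>\<omega>. p (f (path \<omega>)) * q (g (path \<omega>))) \<in> borel_measurable M" using that by auto
    have "\<bar>p (f x)\<bar> \<le> 1" "\<bar>q (g x)\<bar> \<le> 1" for x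
      using that bf[of x] bg[of x] abs_Re_le_cmod abs_Im_le_cmod order_trans by blast+
    then show "AE \<omega> in M. norm (p (f (path \<omega>)) * q (g (path \<omega>))) \<le> 1"
      by (auto simp: abs_mult intro!: mult_le_one)
  qed
  define z where "z = (\<integral>\<omega>. f (path \<omega>) * g (path \<omega>) \<partial>M) - (\<integral>\<omega>. f (path \<omega>) \<partial>M) * (\<integral>\<omega>. g (path \<omega>) \<partial>M)"
  have RE: "Re (integral\<^sup>L M h) = (\<integral>\<omega>. Re (h \<omega>) \<partial>M)" if "integrable M h" for h
    using integral_bounded_linear[OF bounded_linear_Re that] by simp
  have IM: "Im (integral\<^sup>L M h) = (\<integral>\<omega>. Im (h \<omega>) \<partial>M)" if "integrable M h" for h
    using integral_bounded_linear[OF bounded_linear_Im that] by simp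
  have "Re z = ((\<integral>\<omega>. Re (f (path \<omega>)) * Re (g (path \<omega>)) \<partial>M) - (\<integral>\<omega>. Re (f (path \<omega>)) \<partial>M) * (\<integral>\<omega>. Re (g (path \<omega>)) \<partial>M))
    - ((\<integral>\<omega>. Im (f (path \<omega>)) * Im (g (path \<omega>)) \<partial>M) - (\<integral>\<omega>. Im (f (path \<omega>)) \<partial>M) * (\<integral>\<omega>. Im (g (path \<omega>)) \<partial>M))"
    unfolding z_def minus_complex.sel times_complex.sel RE[OF ifg] RE[OF if1] RE[OF ig1] IM[OF if1] IM[OF ig1]
      Bochner_Integration.integral_diff[OF ii[of Re Re, simplified] ii[of Im Im, simplified]] by linarith
  moreover have "Im z = ((\<integral>\<omega>. Re (f (path \<omega>)) * Im (g (path \<omega>)) \<partial>M) - (\<integral>\<omega>. Re (f (path \<omega>)) \<partial>M) * (\<integral>\<omega>. Im (g (path \<omega>)) \<partial>M))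
    + ((\<integral>\<omega>. Im (f (path \<omega>)) * Re (g (path \<omega>)) \<partial>M) - (\<integral>\<omega>. Im (f (path \<omega>)) \<partial>M) * (\<integral>\<omega>. Re (g (path \<omega>)) \<partial>M))"
    unfolding z_def minus_complex.sel times_complex.sel IM[OF ifg] RE[OF if1] RE[OF ig1] IM[OF if1] IM[OF ig1]
      Bochner_Integration.integral_add[OF ii[of Re Im, simplified] ii[of Im Re, simplified]] by linarith
  ultimately have "\<bar>Re z\<bar> + \<bar>Im z\<bar> \<le> 8 * beta_mix M X l"
    using cov[of Re Re] cov[of Im Im] cov[of Re Im] cov[of Im Re] by simp
  then show ?thesis using cmod_le[of z] by (simp add: z_def)
qed

section \<open>Characteristic functions of sums of separated blocks\<close>

text \<open>The blocks \<open>{p + c j + 1 .. p + c j + c - l}\<close> are separated by gaps of length \<open>l\<close>; each gap costs one mixing coefficient.\<close>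

lemma char_sum_blocks_decouple:
  fixes V :: "(int \<Rightarrow> 'a) \<Rightarrow> real"
  assumes V [measurable]: "V \<in> borel_measurable seqM" and dep: "depends_on V {1..int c - int l}"
  shows "norm ((\<integral>\<omega>. iexp (\<Sum>j<m. V (shift (p + int c * int j) (path \<omega>))) \<partial>M) - (\<integral>\<omega>. iexp (V (path \<omega>)) \<partial>M) ^ m)
    \<le> 8 * real m * beta_mix M X l"
proof (induction m)
  case 0
  then show ?case by (simp add: prob_space)
next
  case (Suc m)
  define F where "F = (\<lambda>x. iexp (\<Sum>j<m. V (shift (p + int c * int j) x)))"
  define G where "G = (\<lambda>x. iexp (V (shift (p + int c * int m) x)))"
  define \<phi> where "\<phi> = (\<integral>\<omega>. iexp (V (path \<omega>)) \<partial>M)"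
  have [measurable]: "F \<in> borel_measurable seqM" "G \<in> borel_measurable seqM"
    unfolding F_def G_def by measurable
  have EG: "(\<integral>\<omega>. G (path \<omega>) \<partial>M) = \<phi>"
    unfolding G_def \<phi>_def by (rule integral_shift[of "\<lambda>x. iexp (V x)"]) measurable
  have norm\<phi>: "norm \<phi> \<le> 1"
  proof -
    have "norm \<phi> \<le> (\<integral>\<omega>. norm (iexp (V (path \<omega>))) \<partial>M)" unfolding \<phi>_def by (rule integral_norm_bound)
    then show ?thesis by (simp add: prob_space)
  qed
  \<comment> \<open>The last of the first \<open>m\<close> blocks ends \<open>l\<close> places
    before p + c m, and block \<open>m\<close> starts after p + c m.\<close>
  have dF: "depends_on F {..p + int c * int m - int l}"
    unfolding depends_on_def
  proof (intro allI impI)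
    fix x y :: "int \<Rightarrow> 'a" assume xy: "\<forall>k\<in>{..p + int c * int m - int l}. x k = y k"
    have "V (shift (p + int c * int j) x) = V (shift (p + int c * int j) y)" if "j < m" for j
    proof (rule depends_onD[OF dep])
      fix k assume "k \<in> {1..int c - int l}"
      moreover have "int c * int j + int c \<le> int c * int m"
      proof -
        have "int c * (int j + 1) \<le> int c * int m" using that by (intro mult_left_mono) auto
        then show ?thesis by (simp add: algebra_simps)
      qed
      ultimately show "shift (p + int c * int j) x k = shift (p + int c * int j) y k"
        using xy by (auto simp: shift_def)
    qed
    then show "F x = F y" unfolding F_def by simp
  qed
  have dG: "depends_on G {p + int c * int m - int l + int l..}"
  proof -
    have "depends_on (\<lambda>x. V (shift (p + int c * int m) x)) {p + int c * int m - int l + int l..}"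
      by (rule depends_on_shift[OF dep]) auto
    then show ?thesis unfolding G_def depends_on_def by metis
  qed
  have "norm ((\<integral>\<omega>. F (path \<omega>) * G (path \<omega>) \<partial>M) - (\<integral>\<omega>. F (path \<omega>) \<partial>M) * (\<integral>\<omega>. G (path \<omega>) \<partial>M)) \<le> 8 * beta_mix M X l"
    by (rule complex_covariance_le_beta_mix[OF _ _ dF dG]) (auto simp: F_def G_def)
  \<comment> \<open>A factor of modulus at most 1 does not amplify the error of the induction
    hypothesis, so the errors only add up.\<close>
  moreover have "norm ((\<integral>\<omega>. F (path \<omega>) \<partial>M) * \<phi> - \<phi> ^ m * \<phi>) \<le> 8 * real m * beta_mix M X l"
  proof -
    have "norm ((\<integral>\<omega>. F (path \<omega>) \<partial>M) * \<phi> - \<phi> ^ m * \<phi>) = norm ((\<integral>\<omega>. F (path \<omega>) \<partial>M) - \<phi> ^ m) * norm \<phi>"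
      by (simp add: norm_mult[symmetric] algebra_simps)
    also have "\<dots> \<le> norm ((\<integral>\<omega>. F (path \<omega>) \<partial>M) - \<phi> ^ m) * 1" using norm\<phi> by (intro mult_left_mono) auto
    also have "\<dots> \<le> 8 * real m * beta_mix M X l" using Suc.IH by (simp add: F_def \<phi>_def)
    finally show ?thesis .
  qed
  ultimately have "norm ((\<integral>\<omega>. F (path \<omega>) * G (path \<omega>) \<partial>M) - \<phi> ^ m * \<phi>) \<le> 8 * beta_mix M X l + 8 * real m * beta_mix M X l"
    unfolding EG by (rule norm_diff_triangle_le)
  moreover have "(\<integral>\<omega>. F (path \<omega>) * G (path \<omega>) \<partial>M) = (\<integral>\<omega>. iexp (\<Sum>j<Suc m. V (shift (p + int c * int j) (path \<omega>))) \<partial>M)"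
    unfolding F_def G_def by (simp add: exp_add[symmetric] ring_distribs)
  ultimately show ?case by (simp add: \<phi>_def algebra_simps)
qed

text \<open>After decoupling, the power of one characteristic function has to be compared with a
  Gaussian one; the uniform bound \<open>e n\<close> makes all errors small against the variance.
  The limit variance may be 0, which is how negligible sums are treated later.\<close>

lemma clt_blocks:
  fixes V :: "nat \<Rightarrow> (int \<Rightarrow> 'a) \<Rightarrow> real" and m c l :: "nat \<Rightarrow> nat"
  assumes V [measurable]: "\<And>n. V n \<in> borel_measurable seqM"
    and dep: "\<forall>\<^sub>F n in sequentially. depends_on (V n) {1..int (c n) - int (l n)}"
    and bd: "\<And>n x. \<bar>V n x\<bar> \<le> e n" and e0: "e \<longlonglongrightarrow> 0"
    and mean: "\<And>n. (\<integral>\<omega>. V n (path \<omega>) \<partial>M) = 0"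
    and var: "(\<lambda>n. real (m n) * (\<integral>\<omega>. (V n (path \<omega>))\<^sup>2 \<partial>M)) \<longlonglongrightarrow> v"
    and mix: "(\<lambda>n. real (m n) * beta_mix M X (l n)) \<longlonglongrightarrow> 0"
  shows "(\<lambda>n. \<integral>\<omega>. iexp (s * (\<Sum>j<m n. V n (shift (p n + int (c n) * int j) (path \<omega>)))) \<partial>M)
    \<longlonglongrightarrow> complex_of_real (exp (- (s\<^sup>2 * v) / 2))"
proof -
  define \<sigma> where "\<sigma> = (\<lambda>n. \<integral>\<omega>. (V n (path \<omega>))\<^sup>2 \<partial>M)"
  define \<phi> where "\<phi> = (\<lambda>n. \<integral>\<omega>. iexp (s * V n (path \<omega>)) \<partial>M)"
  have epos: "e n \<ge> 0" for n using bd[of n "\<lambda>_. 0"] by linarith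
  have sqb: "(V n x)\<^sup>2 \<le> (e n)\<^sup>2" for n x using bd[of n x] epos[of n] by (simp add: abs_le_square_iff[symmetric])
  have int1: "integrable M (\<lambda>\<omega>. V n (path \<omega>))" for n
    using bd by (intro integrable_const_bound[where B="e n"]) auto
  have int2: "integrable M (\<lambda>\<omega>. (V n (path \<omega>))\<^sup>2)" for n
    using sqb by (intro integrable_const_bound[where B="(e n)\<^sup>2"]) auto
  have \<sigma>0: "\<sigma> n \<ge> 0" for n unfolding \<sigma>_def by simp
  have \<sigma>e: "\<sigma> n \<le> (e n)\<^sup>2" for n
  proof -
    have "\<sigma> n \<le> (\<integral>\<omega>. (e n)\<^sup>2 \<partial>M)" unfolding \<sigma>_def using int2 sqb by (intro integral_mono) auto
    then show ?thesis by (simp add: prob_space)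
  qed
  \<comment> \<open>Third-order Taylor bound: the third absolute moment is at most
    \<open>e n\<close> times the second.\<close>
  have approx: "norm (\<phi> n - complex_of_real (1 - s\<^sup>2 * \<sigma> n / 2)) \<le> \<bar>s\<bar>^3 * e n * \<sigma> n" for n
  proof -
    have "cmod (char (distr M borel (\<lambda>\<omega>. V n (path \<omega>))) s - (1 - s^2 * \<sigma> n / 2)) \<le>
      (s^2 / 6) * expectation (\<lambda>\<omega>. min (6 * (V n (path \<omega>))^2) (\<bar>s\<bar> * \<bar>V n (path \<omega>)\<bar>^3))"
      using int1 int2 by (intro char_approx3') (auto simp: mean \<sigma>_def)
    also have "expectation (\<lambda>\<omega>. min (6 * (V n (path \<omega>))^2) (\<bar>s\<bar> * \<bar>V n (path \<omega>)\<bar>^3)) \<le> (\<integral>\<omega>. \<bar>s\<bar> * e n * (V n (path \<omega>))\<^sup>2 \<partial>M)"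
    proof (rule integral_mono)
      show "integrable M (\<lambda>\<omega>. min (6 * (V n (path \<omega>))^2) (\<bar>s\<bar> * \<bar>V n (path \<omega>)\<bar>^3))"
        using int2[of n] by (rule Bochner_Integration.integrable_bound[where f="\<lambda>\<omega>. 6 * (V n (path \<omega>))^2", OF integrable_mult_right]) auto
      show "integrable M (\<lambda>\<omega>. \<bar>s\<bar> * e n * (V n (path \<omega>))\<^sup>2)" using int2 by auto
      fix \<omega>
      have "\<bar>V n (path \<omega>)\<bar>^3 = \<bar>V n (path \<omega>)\<bar> * (V n (path \<omega>))\<^sup>2" by (simp add: power3_eq_cube power2_eq_square)
      also have "\<dots> \<le> e n * (V n (path \<omega>))\<^sup>2" using bd by (intro mult_right_mono) auto
      finally have "\<bar>s\<bar> * \<bar>V n (path \<omega>)\<bar>^3 \<le> \<bar>s\<bar> * (e n * (V n (path \<omega>))\<^sup>2)" by (intro mult_left_mono) auto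
      then show "min (6 * (V n (path \<omega>))^2) (\<bar>s\<bar> * \<bar>V n (path \<omega>)\<bar>^3) \<le> \<bar>s\<bar> * e n * (V n (path \<omega>))\<^sup>2" by (simp add: min_le_iff_disj mult.assoc)
    qed
    also have "(\<integral>\<omega>. \<bar>s\<bar> * e n * (V n (path \<omega>))\<^sup>2 \<partial>M) = \<bar>s\<bar> * e n * \<sigma> n" by (simp add: \<sigma>_def)
    finally have "cmod (char (distr M borel (\<lambda>\<omega>. V n (path \<omega>))) s - (1 - s^2 * \<sigma> n / 2)) \<le> (s^2 / 6) * (\<bar>s\<bar> * e n * \<sigma> n)"
      by (simp add: mult_left_mono)
    also have "\<dots> \<le> s^2 * (\<bar>s\<bar> * e n * \<sigma> n)"
      using epos[of n] \<sigma>0[of n] by (intro mult_right_mono mult_nonneg_nonneg) auto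
    also have "\<dots> = \<bar>s\<bar>^3 * e n * \<sigma> n" by (simp add: power3_eq_cube power2_eq_square)
    also have "char (distr M borel (\<lambda>\<omega>. V n (path \<omega>))) s = \<phi> n"
      unfolding char_def \<phi>_def by (subst integral_distr) auto
    finally show ?thesis by simp
  qed
  have norm\<phi>: "norm (\<phi> n) \<le> 1" for n
  proof -
    have "norm (\<phi> n) \<le> (\<integral>\<omega>. norm (iexp (s * V n (path \<omega>))) \<partial>M)" unfolding \<phi>_def by (rule integral_norm_bound)
    then show ?thesis by (simp add: prob_space)
  qed
  \<comment> \<open>The m-th power of this number is exactly exp(- s^2 m \<sigma> / 2), so its limit
    needs only convergence of the total variance.\<close>
  define \<psi> where "\<psi> = (\<lambda>n. exp (- (s\<^sup>2 * \<sigma> n / 2)))"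
  have \<phi>\<psi>: "norm (\<phi> n - complex_of_real (\<psi> n)) \<le> \<bar>s\<bar>^3 * e n * \<sigma> n + (s\<^sup>2 / 2)\<^sup>2 * (e n)\<^sup>2 * \<sigma> n" for n
  proof -
    have "norm (complex_of_real (1 - s\<^sup>2 * \<sigma> n / 2) - complex_of_real (\<psi> n)) = \<bar>\<psi> n - (1 - s\<^sup>2 * \<sigma> n / 2)\<bar>"
      by (simp only: of_real_diff[symmetric] norm_of_real abs_minus_commute)
    also have "\<dots> \<le> (s\<^sup>2 * \<sigma> n / 2)\<^sup>2"
      unfolding \<psi>_def using \<sigma>0[of n] by (intro abs_exp_minus_le) auto
    also have "\<dots> = (s\<^sup>2 / 2)\<^sup>2 * \<sigma> n * \<sigma> n" by (simp add: power2_eq_square)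
    also have "\<dots> \<le> (s\<^sup>2 / 2)\<^sup>2 * (e n)\<^sup>2 * \<sigma> n"
      using \<sigma>e[of n] \<sigma>0[of n] by (intro mult_right_mono mult_left_mono) auto
    finally show ?thesis using approx[of n] norm_diff_triangle_le by blast
  qed
  \<comment> \<open>Numbers of modulus at most 1 satisfy |x^m - y^m| \<le> m |x - y|. Each error
    keeps the factor m \<sigma>, which converges, next to a power of \<open>e n\<close>.\<close>
  have pow: "norm (\<phi> n ^ m n - complex_of_real (\<psi> n) ^ m n)
     \<le> \<bar>s\<bar>^3 * e n * (real (m n) * \<sigma> n) + (s\<^sup>2 / 2)\<^sup>2 * (e n)\<^sup>2 * (real (m n) * \<sigma> n)" for n
  proof -
    have "norm (\<phi> n ^ m n - complex_of_real (\<psi> n) ^ m n) \<le> real (m n) * norm (\<phi> n - complex_of_real (\<psi> n))"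
      using norm\<phi>[of n] \<sigma>0[of n] by (intro norm_power_diff) (auto simp: \<psi>_def)
    also have "\<dots> \<le> real (m n) * (\<bar>s\<bar>^3 * e n * \<sigma> n + (s\<^sup>2 / 2)\<^sup>2 * (e n)\<^sup>2 * \<sigma> n)"
      using \<phi>\<psi> by (intro mult_left_mono) auto
    finally show ?thesis by (simp add: algebra_simps)
  qed
  have var': "(\<lambda>n. real (m n) * \<sigma> n) \<longlonglongrightarrow> v" using var by (simp add: \<sigma>_def)
  have "(\<lambda>n. \<bar>s\<bar>^3 * e n * (real (m n) * \<sigma> n) + (s\<^sup>2 / 2)\<^sup>2 * (e n)\<^sup>2 * (real (m n) * \<sigma> n)) \<longlonglongrightarrow> \<bar>s\<bar>^3 * 0 * v + (s\<^sup>2 / 2)\<^sup>2 * 0\<^sup>2 * v"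
    by (intro tendsto_intros var' e0)
  then have lim1: "(\<lambda>n. \<phi> n ^ m n - complex_of_real (\<psi> n) ^ m n) \<longlonglongrightarrow> 0"
    by (intro Lim_null_comparison[OF always_eventually[OF allI[OF pow]]]) simp
  have "complex_of_real (\<psi> n) ^ m n = complex_of_real (exp (- (s\<^sup>2 * (real (m n) * \<sigma> n)) / 2))" for n
  proof -
    have "\<psi> n ^ m n = exp (real (m n) * (- (s\<^sup>2 * \<sigma> n / 2)))" unfolding \<psi>_def by (rule exp_of_nat_mult[symmetric])
    also have "real (m n) * (- (s\<^sup>2 * \<sigma> n / 2)) = - (s\<^sup>2 * (real (m n) * \<sigma> n)) / 2" by simp
    finally show ?thesis by (simp only: of_real_power[symmetric])
  qed
  moreover have "(\<lambda>n. complex_of_real (exp (- (s\<^sup>2 * (real (m n) * \<sigma> n)) / 2))) \<longlonglongrightarrow> complex_of_real (exp (- (s\<^sup>2 * v) / 2))"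
    by (intro tendsto_intros var') simp
  ultimately have lim2: "(\<lambda>n. complex_of_real (\<psi> n) ^ m n) \<longlonglongrightarrow> complex_of_real (exp (- (s\<^sup>2 * v) / 2))" by simp
  have lim3: "(\<lambda>n. (\<integral>\<omega>. iexp (s * (\<Sum>j<m n. V n (shift (p n + int (c n) * int j) (path \<omega>)))) \<partial>M) - \<phi> n ^ m n) \<longlonglongrightarrow> 0"
  proof (rule Lim_null_comparison)
    show "(\<lambda>n. 8 * (real (m n) * beta_mix M X (l n))) \<longlonglongrightarrow> 0"
      using tendsto_mult_left[OF mix, of 8] by simp
    show "\<forall>\<^sub>F n in sequentially. norm ((\<integral>\<omega>. iexp (s * (\<Sum>j<m n. V n (shift (p n + int (c n) * int j) (path \<omega>)))) \<partial>M) - \<phi> n ^ m n)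
       \<le> 8 * (real (m n) * beta_mix M X (l n))"
      using dep
    proof eventually_elim
      case (elim n)
      have "depends_on (\<lambda>x. s * V n x) {1..int (c n) - int (l n)}" using elim unfolding depends_on_def by metis
      moreover have "(\<lambda>x. s * V n x) \<in> borel_measurable seqM" by measurable
      ultimately show ?case
        using char_sum_blocks_decouple[of "\<lambda>x. s * V n x" "c n" "l n" "p n" "m n"]
        by (simp only: \<phi>_def sum_distrib_left mult.assoc)
    qed
  qed
  show ?thesis using tendsto_add[OF tendsto_add[OF lim3 lim1] lim2] by simp
qed

end

section \<open>The tail process\<close>

lemma is_norm_nonneg: "is_norm N \<Longrightarrow> 0 \<le> N x"
proof -
  assume "is_norm N"
  then have *: "N (x + (-1) *\<^sub>R x) \<le> N x + N ((-1) *\<^sub>R x)" "N ((-1) *\<^sub>R x) = \<bar>-1\<bar> * N x" "N 0 = 0"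
    unfolding is_norm_def by blast+
  have "x + (-1) *\<^sub>R x = 0" by simp
  with * show ?thesis by simp
qed

lemma is_norm_zero: "is_norm N \<Longrightarrow> N 0 = 0"
  by (simp add: is_norm_def)

lemma is_norm_scale: "is_norm N \<Longrightarrow> N (c *\<^sub>R x) = \<bar>c\<bar> * N x"
  by (simp add: is_norm_def)

lemma is_norm_minus_commute: "is_norm N \<Longrightarrow> N (x - y) = N (y - x)"
  using is_norm_scale[of N "-1" "x - y"] by simp

lemma is_norm_triangle: "is_norm N \<Longrightarrow> N (x + y) \<le> N x + N y"
  by (simp add: is_norm_def)

lemma is_norm_diff_triangle: "is_norm N \<Longrightarrow> \<bar>N x - N y\<bar> \<le> N (x - y)"
  using is_norm_triangle[of N "x - y" y] is_norm_triangle[of N "y - x" x] is_norm_minus_commute[of N x y]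
  by auto

lemma is_norm_upper:
  fixes N :: "'a::euclidean_space \<Rightarrow> real"
  assumes "is_norm N"
  shows "N x \<le> (\<Sum>b\<in>Basis. N b) * norm x"
proof -
  have sum_le: "N (\<Sum>b\<in>B. f b) \<le> (\<Sum>b\<in>B. N (f b))" if "finite B" for B :: "'a set" and f :: "'a \<Rightarrow> 'a"
    using that
  proof (induction B rule: finite_induct)
    case (insert b B)
    then show ?case using is_norm_triangle[OF assms, of "f b" "sum f B"] by simp
  qed (simp add: is_norm_zero[OF assms])
  have "N x = N (\<Sum>b\<in>Basis. (x \<bullet> b) *\<^sub>R b)" by (simp add: euclidean_representation)
  also have "\<dots> \<le> (\<Sum>b\<in>Basis. N ((x \<bullet> b) *\<^sub>R b))" by (rule sum_le) simp
  also have "\<dots> = (\<Sum>b\<in>Basis. \<bar>x \<bullet> b\<bar> * N b)" by (simp add: is_norm_scale[OF assms])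
  also have "\<dots> \<le> (\<Sum>b\<in>Basis. norm x * N b)"
    by (intro sum_mono mult_right_mono is_norm_nonneg[OF assms] Basis_le_norm)
  finally show ?thesis by (simp add: sum_distrib_left mult.commute)
qed

lemma is_norm_continuous:
  fixes N :: "'a::euclidean_space \<Rightarrow> real"
  assumes "is_norm N"
  shows "continuous_on UNIV N"
proof -
  define K where "K = (\<Sum>b\<in>(Basis::'a set). N b)"
  have K: "K \<ge> 0" unfolding K_def by (intro sum_nonneg is_norm_nonneg assms)
  have "K-lipschitz_on UNIV N"
  proof (rule lipschitz_onI)
    show "dist (N x) (N y) \<le> K * dist x y" for x y
      using is_norm_diff_triangle[OF assms, of x y] is_norm_upper[OF assms, of "x - y"]
      by (simp add: dist_norm K_def)
  qed (rule K)
  then show ?thesis by (rule lipschitz_on_continuous_on)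
qed

text \<open>The minimum of N on the compact unit sphere is positive. This direction of norm
  equivalence turns smallness in N into the convergence required by \<open>in_l0\<close>.\<close>

lemma is_norm_lower:
  fixes N :: "'a::euclidean_space \<Rightarrow> real"
  assumes "is_norm N"
  shows "\<exists>c>0. \<forall>x. c * norm x \<le> N x"
proof -
  have "compact (sphere (0::'a) 1)" "sphere (0::'a) 1 \<noteq> {}" by auto
  then obtain z where z: "z \<in> sphere 0 1" "\<And>x. x \<in> sphere 0 1 \<Longrightarrow> N z \<le> N x"
    using continuous_attains_inf[of "sphere (0::'a) 1" N] continuous_on_subset[OF is_norm_continuous[OF assms]] by auto
  have pos: "N z > 0"
    using z(1) is_norm_nonneg[OF assms, of z] assms unfolding is_norm_def by (metis less_eq_real_def norm_zero zero_neq_one mem_sphere_0)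
  moreover have "N z * norm x \<le> N x" for x
  proof (cases "x = 0")
    case False
    have "N z \<le> N ((1 / norm x) *\<^sub>R x)" using False by (intro z(2)) simp
    then show ?thesis using False by (simp add: is_norm_scale[OF assms] field_simps)
  qed (simp add: is_norm_zero[OF assms])
  ultimately show ?thesis by blast
qed

definition trunc :: "int set \<Rightarrow> (int \<Rightarrow> 'a::zero) \<Rightarrow> int \<Rightarrow> 'a" where
  "trunc I x = (\<lambda>k. if k \<in> I then x k else 0)"

definition scale_seq :: "real \<Rightarrow> (int \<Rightarrow> 'a::real_vector) \<Rightarrow> int \<Rightarrow> 'a" where
  "scale_seq c x = (\<lambda>k. c *\<^sub>R x k)"

lemma trunc_measurable [measurable]: "trunc I \<in> measurable seqM (seqM :: (int \<Rightarrow> 'a::real_normed_vector) measure)"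
  unfolding trunc_def
proof (rule measurable_PiM_single')
  fix k show "(\<lambda>x. if k \<in> I then x k else 0) \<in> measurable seqM borel" by (cases "k \<in> I") auto
qed auto

lemma scale_seq_measurable [measurable]:
  "scale_seq c \<in> measurable seqM (seqM :: (int \<Rightarrow> 'a::{real_normed_vector,second_countable_topology}) measure)"
  unfolding scale_seq_def by (rule measurable_PiM_single') auto

lemma in_l0_trunc:
  fixes x :: "int \<Rightarrow> 'a::real_normed_vector"
  assumes "finite I"
  shows "in_l0 (trunc I x)"
proof -
  obtain a b where ab: "\<And>k. k \<in> I \<Longrightarrow> a \<le> k \<and> k \<le> b"
    using bdd_above_finite[OF assms] bdd_below_finite[OF assms] unfolding bdd_above_def bdd_below_def by blast
  have "\<forall>\<^sub>F k in at_top. trunc I x k = 0" "\<forall>\<^sub>F k in at_bot. trunc I x k = 0"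
    unfolding eventually_at_top_linorder eventually_at_bot_linorder trunc_def
    using ab by (force intro: exI[of _ "b + 1"] exI[of _ "a - 1"])+
  then show ?thesis unfolding in_l0_def by (auto intro: tendsto_eventually)
qed

text \<open>Finiteness gives \<open>exc\<close>, \<open>Tmin\<close> and \<open>Tmax\<close> their
  intended meaning, since \<open>card\<close>, \<open>Min\<close> and \<open>Max\<close> are
  informative for finite sets only.\<close>

lemma in_l0_finite_exceed:
  fixes x :: "int \<Rightarrow> 'a::euclidean_space"
  assumes "is_norm N" "in_l0 x"
  shows "finite {j. N (x j) > 1}"
proof -
  have c: "isCont N 0" using is_norm_continuous[OF assms(1)] by (simp add: continuous_on_eq_continuous_at)
  have "((\<lambda>j. N (x j)) \<longlongrightarrow> 0) at_top" "((\<lambda>j. N (x j)) \<longlongrightarrow> 0) at_bot"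
    using assms(2) isCont_tendsto_compose[OF c] is_norm_zero[OF assms(1)] unfolding in_l0_def by auto
  then have "\<forall>\<^sub>F j in at_top. N (x j) < 1" "\<forall>\<^sub>F j in at_bot. N (x j) < 1"
    by (auto intro: order_tendstoD(2))
  then obtain a b where "\<And>j. j \<ge> b \<Longrightarrow> N (x j) < 1" "\<And>j. j \<le> a \<Longrightarrow> N (x j) < 1"
    unfolding eventually_at_top_linorder eventually_at_bot_linorder by auto
  then have "{j. N (x j) > 1} \<subseteq> {a..b}" by (auto simp: not_le[symmetric]) (meson linear not_less order_less_imp_le)+
  then show ?thesis by (rule finite_subset) simp
qed

section \<open>Conditional expectations given an exceedance and their tail process limits\<close>

locale tail_sequence = stationary_sequence M X
  for M :: "'w measure" and X :: "int \<Rightarrow> 'w \<Rightarrow> real^'d::finite" +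
  fixes N :: "real^'d \<Rightarrow> real" and MY :: "'e measure" and Y :: "int \<Rightarrow> 'e \<Rightarrow> real^'d"
    and u :: "nat \<Rightarrow> real" and r :: "nat \<Rightarrow> nat" and w :: "nat \<Rightarrow> real"
  assumes is_norm: "is_norm N"
    and tail_process: "reg_var_with_tail N M X MY Y"
    and u_pos: "\<And>n. u n > 0" and u_lim: "filterlim u at_top sequentially"
    and r_pos: "\<And>n. r n \<ge> 1" and r_lim: "filterlim r at_top sequentially"
    and w_eq: "\<And>n. w n = measure M {\<omega>\<in>space M. N (X 0 \<omega>) > u n}"
    and nw_lim: "filterlim (\<lambda>n. real n * w n) at_top sequentially"
    and rn_lim: "(\<lambda>n. real (r n) / real n) \<longlonglongrightarrow> 0"
    and rw_lim: "(\<lambda>n. real (r n) * w n) \<longlonglongrightarrow> 0"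
    and anticlust: "anticlust N M X u r"
begin

sublocale MY: prob_space MY
  using tail_process by (simp add: reg_var_with_tail_def)

lemma Y_measurable [measurable]: "Y j \<in> borel_measurable MY"
  using tail_process by (simp add: reg_var_with_tail_def)

lemma N_measurable [measurable]: "N \<in> borel_measurable borel"
  using is_norm_continuous[OF is_norm] by (rule borel_measurable_continuous_onI)

lemma N_continuous [continuous_intros]: "continuous_on A f \<Longrightarrow> continuous_on A (\<lambda>x. N (f x))"
  using continuous_on_compose2[OF is_norm_continuous[OF is_norm]] by blast

lemma N_nonneg [simp]: "0 \<le> N x" by (rule is_norm_nonneg[OF is_norm])

definition tailprob :: "real \<Rightarrow> real" where
  "tailprob x = prob {\<omega>\<in>space M. N (X 0 \<omega>) > x}"

text \<open>The expectation of f of the path divided by x, conditionally on an exceedance of x at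
  time 0. Its limit is an expectation under the tail process.\<close>

definition cE :: "((int \<Rightarrow> real^'d) \<Rightarrow> real) \<Rightarrow> real \<Rightarrow> real" where
  "cE f x = (\<integral>\<omega>. f (scale_seq (1 / x) (path \<omega>)) * indicator {\<omega>\<in>space M. N (X 0 \<omega>) > x} \<omega> \<partial>M) / tailprob x"

lemma tailprob_antimono: "x \<le> y \<Longrightarrow> tailprob y \<le> tailprob x"
  unfolding tailprob_def by (intro finite_measure_mono) auto

lemma w_tailprob: "w n = tailprob (u n)" by (simp add: w_eq tailprob_def)

text \<open>Because n w_n tends to infinity, exceedance probabilities are positive at arbitrarily
  high levels u_n, hence at all lower ones. The conditioning event in \<open>cE\<close> is therefore
  never null.\<close>

lemma tailprob_pos: "tailprob x > 0"
proof -
  have "\<forall>\<^sub>F n in sequentially. real n * w n > 0 \<and> u n \<ge> x"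
    using nw_lim u_lim unfolding filterlim_at_top_dense
    by (intro eventually_conj) (auto intro: eventually_mono[OF _ less_imp_le])
  then obtain n where "real n * w n > 0" "u n \<ge> x" by (auto simp: eventually_sequentially)
  then have "tailprob (u n) > 0" by (simp add: w_tailprob zero_less_mult_iff)
  then show ?thesis using tailprob_antimono[OF \<open>u n \<ge> x\<close>] by linarith
qed

lemma w_pos: "w n > 0" by (simp add: w_tailprob tailprob_pos)

lemma cE_tendsto:
  assumes "continuous_on UNIV f" "\<And>x. \<bar>f x\<bar> \<le> B" "depends_on f {i..j}"
  shows "(cE f \<longlongrightarrow> (\<integral>\<eta>. f (\<lambda>k. Y k \<eta>) \<partial>MY)) at_top"
proof -
  have b: "bounded (range f)" using assms(2) by (auto simp: bounded_iff)
  \<comment> \<open>The definition of the tail process asks for i \<le> j; an empty interval is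
    enlarged to a single point.\<close>
  have d: "depends_on f {i..max i j}" using assms(3) by (rule depends_on_mono) auto
  have "is_tail_process N M X MY Y" using tail_process by (simp add: reg_var_with_tail_def)
  from this[unfolded is_tail_process_def, rule_format, of i "max i j" f] show ?thesis
    using assms(1) b d unfolding cE_def[abs_def] depends_on_def scale_seq_def path_def tailprob_def by simp
qed

lemma cE_tendsto_u:
  assumes "continuous_on UNIV f" "\<And>x. \<bar>f x\<bar> \<le> B" "depends_on f {i..j}"
  shows "(\<lambda>n. cE f (u n)) \<longlonglongrightarrow> (\<integral>\<eta>. f (\<lambda>k. Y k \<eta>) \<partial>MY)"
  using filterlim_compose[OF cE_tendsto[OF assms] u_lim] .

lemma integrable_cE:
  fixes f :: "(int \<Rightarrow> real^'d) \<Rightarrow> real"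
  assumes [measurable]: "f \<in> borel_measurable seqM" and "\<And>x. \<bar>f x\<bar> \<le> B"
  shows "integrable M (\<lambda>\<omega>. f (scale_seq c (path \<omega>)) * indicator {\<omega>\<in>space M. N (X 0 \<omega>) > x} \<omega>)"
proof (rule integrable_const_bound[where B=B])
  show "AE \<omega> in M. norm (f (scale_seq c (path \<omega>)) * indicator {\<omega>\<in>space M. N (X 0 \<omega>) > x} \<omega>) \<le> B"
    using assms(2) order_trans[OF abs_ge_zero assms(2)] by (auto simp: indicator_def)
qed measurable

lemma cE_mono:
  assumes f: "f \<in> borel_measurable seqM" "\<And>x. \<bar>f x\<bar> \<le> B"
    and g: "g \<in> borel_measurable seqM" "\<And>x. \<bar>g x\<bar> \<le> B'"
    and le: "\<And>z. N (z 0) > 1 \<Longrightarrow> f z \<le> g z" and "x > 0"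
  shows "cE f x \<le> cE g x"
  unfolding cE_def
proof (intro divide_right_mono integral_mono integrable_cE[OF f] integrable_cE[OF g] less_imp_le[OF tailprob_pos])
  fix \<omega>
  have "N (scale_seq (1 / x) (path \<omega>) 0) > 1" if "N (X 0 \<omega>) > x"
    using that \<open>x > 0\<close> by (simp add: scale_seq_def path_def is_norm_scale[OF is_norm])
  then show "f (scale_seq (1 / x) (path \<omega>)) * indicator {\<omega>\<in>space M. N (X 0 \<omega>) > x} \<omega>
    \<le> g (scale_seq (1 / x) (path \<omega>)) * indicator {\<omega>\<in>space M. N (X 0 \<omega>) > x} \<omega>"
    using le by (auto simp: indicator_def)
qed

lemma continuous_measurable_seq:
  fixes f :: "(int \<Rightarrow> real^'d) \<Rightarrow> real"
  assumes "continuous_on UNIV f" shows "f \<in> borel_measurable seqM"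
proof -
  have "f \<in> borel_measurable borel" using assms by (rule borel_measurable_continuous_onI)
  then show ?thesis by (simp cong: measurable_cong_sets add: sets_PiM_equal_borel)
qed

lemma Y_path_measurable [measurable]: "(\<lambda>\<eta> k. Y k \<eta>) \<in> measurable MY seqM"
  by (rule measurable_PiM_single') auto

lemma continuous_on_coord [continuous_intros]: "continuous_on UNIV (\<lambda>x::int \<Rightarrow> real^'d. x k)"
  by (rule continuous_on_product_coordinates)

text \<open>The conditional probability in \<open>anticlust\<close> for t = 1, as \<open>w n\<close>
  is the probability of the conditioning event.\<close>

definition clust_prob :: "real \<Rightarrow> nat \<Rightarrow> nat \<Rightarrow> real" where
  "clust_prob s l n = prob {\<omega>\<in>space M. (\<exists>j::int. int l \<le> \<bar>j\<bar> \<and> \<bar>j\<bar> \<le> int (r n) \<and> N (X j \<omega>) > u n * s)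
                                  \<and> N (X 0 \<omega>) > u n} / w n"

text \<open>The usable form of the iterated limit: the threshold in \<open>n\<close> depends on
  \<open>l\<close>, so \<open>l\<close> has to be chosen first.\<close>

lemma clust_prob_small:
  assumes "s > 0" "\<epsilon> > 0"
  shows "\<exists>l0. \<forall>l\<ge>l0. \<forall>\<^sub>F n in sequentially. clust_prob s l n < \<epsilon>"
proof -
  have "((\<lambda>l::nat. limsup (\<lambda>n. ereal (clust_prob s l n))) \<longlongrightarrow> 0) sequentially"
    using anticlust[unfolded anticlust_def, rule_format, OF assms(1), of 1]
    by (simp add: clust_prob_def[abs_def] w_eq)
  then have "\<forall>\<^sub>F l in sequentially. limsup (\<lambda>n. ereal (clust_prob s l n)) < ereal \<epsilon>"
    using assms(2) by (intro order_tendstoD(2)) auto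
  then obtain l0 where l0: "\<And>l. l \<ge> l0 \<Longrightarrow> limsup (\<lambda>n. ereal (clust_prob s l n)) < ereal \<epsilon>"
    by (auto simp: eventually_sequentially)
  show ?thesis
  proof (intro exI[of _ l0] allI impI)
    fix l assume "l \<ge> l0"
    from Limsup_lessD[OF l0[OF this]] show "\<forall>\<^sub>F n in sequentially. clust_prob s l n < \<epsilon>" by simp
  qed
qed

text \<open>The tail process inherits anticlustering: a fixed finite range of indices lies inside
  the range of radius r_n for large n, so the bound for X passes to the limit, and the outer radius
  then grows by continuity from below.\<close>

lemma Y_exceed_far_small:
  assumes s: "s > 0" and "\<epsilon> > 0"
  shows "\<exists>l0. \<forall>l\<ge>l0. MY.prob {\<eta>\<in>space MY. \<exists>j::int. int l \<le> \<bar>j\<bar> \<and> N (Y j \<eta>) \<ge> s} \<le> \<epsilon>"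
proof -
  obtain l0 where l0: "\<And>l. l \<ge> l0 \<Longrightarrow> \<forall>\<^sub>F n in sequentially. clust_prob (s / 2) l n < \<epsilon>"
    using clust_prob_small[of "s / 2" \<epsilon>] assms by auto
  show ?thesis
  proof (intro exI[of _ l0] allI impI)
    fix l assume l: "l \<ge> l0"
    \<comment> \<open>Weak convergence needs a continuous majorant of the indicator of y \<ge> s.
      Since it vanishes up to s / 2, anticlustering is used at level s / 2.\<close>
    define ramp where "ramp = (\<lambda>y::real. min 1 (max 0 (2 * y / s - 1)))"
    have ramp: "0 \<le> ramp y" "ramp y \<le> 1" "y \<ge> s \<Longrightarrow> ramp y = 1" "y \<le> s / 2 \<Longrightarrow> ramp y = 0" for y
      using s by (auto simp: ramp_def field_simps)
    have fin: "MY.prob {\<eta>\<in>space MY. \<exists>j\<in>{j. int l \<le> \<bar>j\<bar> \<and> \<bar>j\<bar> \<le> int L}. N (Y j \<eta>) \<ge> s} \<le> \<epsilon>" for L :: nat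
    proof -
      define J where "J = {j. int l \<le> \<bar>j\<bar> \<and> \<bar>j\<bar> \<le> int L}"
      have finJ: "finite J" by (rule finite_subset[of _ "{- int L..int L}"]) (auto simp: J_def)
      define f where "f = (\<lambda>x::int \<Rightarrow> real^'d. min 1 (\<Sum>j\<in>J. ramp (N (x j))))"
      have f01: "0 \<le> f x" "f x \<le> 1" for x
        by (auto simp: f_def ramp intro!: sum_nonneg)
      have fc: "continuous_on UNIV f" unfolding f_def ramp_def using s by (intro continuous_intros) auto
      have fd: "depends_on f {- int L..int L}"
        unfolding depends_on_def f_def
      proof (intro allI impI arg_cong[where f="min 1"] sum.cong refl)
        fix x y :: "int \<Rightarrow> real^'d" and j assume "\<forall>k\<in>{- int L..int L}. x k = y k" "j \<in> J"
        then have "x j = y j" by (simp add: J_def abs_le_iff)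
        then show "ramp (N (x j)) = ramp (N (y j))" by simp
      qed
      have fm [measurable]: "f \<in> borel_measurable seqM" using fc by (rule continuous_measurable_seq)
      have "MY.prob {\<eta>\<in>space MY. \<exists>j\<in>J. N (Y j \<eta>) \<ge> s} \<le> (\<integral>\<eta>. f (\<lambda>k. Y k \<eta>) \<partial>MY)"
      proof -
        have [measurable]: "{\<eta>\<in>space MY. \<exists>j\<in>J. N (Y j \<eta>) \<ge> s} \<in> sets MY" using finJ by measurable
        have "MY.prob {\<eta>\<in>space MY. \<exists>j\<in>J. N (Y j \<eta>) \<ge> s} = (\<integral>\<eta>. indicator {\<eta>\<in>space MY. \<exists>j\<in>J. N (Y j \<eta>) \<ge> s} \<eta> \<partial>MY)"
          by (simp add: Int_absorb2 subset_eq)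
        also have "\<dots> \<le> (\<integral>\<eta>. f (\<lambda>k. Y k \<eta>) \<partial>MY)"
        proof (rule integral_mono)
          show "integrable MY (\<lambda>\<eta>. f (\<lambda>k. Y k \<eta>))"
            using f01 by (intro MY.integrable_const_bound[where B=1]) auto
          show "integrable MY (indicat_real {\<eta>\<in>space MY. \<exists>j\<in>J. N (Y j \<eta>) \<ge> s})"
            by (simp add: MY.emeasure_eq_measure)
          show "indicator {\<eta>\<in>space MY. \<exists>j\<in>J. N (Y j \<eta>) \<ge> s} \<eta> \<le> f (\<lambda>k. Y k \<eta>)" for \<eta>
          proof (cases "\<exists>j\<in>J. N (Y j \<eta>) \<ge> s")
            case True
            then obtain j where j: "j \<in> J" "N (Y j \<eta>) \<ge> s" by blast
            have "1 = ramp (N (Y j \<eta>))" using ramp(3)[OF j(2)] by simp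
            also have "\<dots> \<le> (\<Sum>j\<in>J. ramp (N (Y j \<eta>)))"
              using j(1) finJ ramp by (intro member_le_sum) auto
            finally have "f (\<lambda>k. Y k \<eta>) = 1" by (simp add: f_def)
            then show ?thesis by (simp add: indicator_def)
          next
            case False
            then show ?thesis using f01 by (auto simp: indicator_def)
          qed
        qed
        finally show ?thesis .
      qed
      also have "\<dots> \<le> \<epsilon>"
      proof (rule tendsto_upperbound)
        show "(\<lambda>n. cE f (u n)) \<longlonglongrightarrow> (\<integral>\<eta>. f (\<lambda>k. Y k \<eta>) \<partial>MY)"
          using f01 by (intro cE_tendsto_u[OF fc _ fd, of 1]) auto
        have "\<forall>\<^sub>F n in sequentially. L \<le> r n" using r_lim by (simp add: filterlim_at_top)
        with l0[OF l] show "\<forall>\<^sub>F n in sequentially. cE f (u n) \<le> \<epsilon>"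
        proof eventually_elim
          case (elim n)
          define E where "E = {\<omega>\<in>space M. (\<exists>j::int. int l \<le> \<bar>j\<bar> \<and> \<bar>j\<bar> \<le> int (r n) \<and> N (X j \<omega>) > u n * (s / 2))
                                  \<and> N (X 0 \<omega>) > u n}"
          have [measurable]: "E \<in> events" unfolding E_def by measurable
          have "(\<integral>\<omega>. f (scale_seq (1 / u n) (path \<omega>)) * indicator {\<omega>\<in>space M. N (X 0 \<omega>) > u n} \<omega> \<partial>M) \<le> (\<integral>\<omega>. indicator E \<omega> \<partial>M)"
          proof (rule integral_mono)
            show "integrable M (\<lambda>\<omega>. f (scale_seq (1 / u n) (path \<omega>)) * indicator {\<omega>\<in>space M. N (X 0 \<omega>) > u n} \<omega>)"
              using f01 by (intro integrable_cE[OF fm, of 1]) auto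
            show "integrable M (indicat_real E)" by (simp add: emeasure_eq_measure)
            fix \<omega> assume "\<omega> \<in> space M"
            show "f (scale_seq (1 / u n) (path \<omega>)) * indicator {\<omega>\<in>space M. N (X 0 \<omega>) > u n} \<omega> \<le> indicator E \<omega>"
            proof (cases "\<omega> \<in> E \<or> \<not> N (X 0 \<omega>) > u n")
              case True
              then show ?thesis using f01 by (auto simp: indicator_def)
            next
              case False
              then have "N (X j \<omega>) \<le> u n * (s / 2)" if "j \<in> J" for j
                using that \<open>\<omega> \<in> space M\<close> elim(2) unfolding E_def J_def by force
              then have "ramp (N (scale_seq (1 / u n) (path \<omega>) j)) = 0" if "j \<in> J" for j
                using that u_pos[of n]
                by (intro ramp(4)) (simp add: scale_seq_def path_def is_norm_scale[OF is_norm] field_simps)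
              then have "f (scale_seq (1 / u n) (path \<omega>)) = 0" by (simp add: f_def)
              then show ?thesis by simp
            qed
          qed
          also have "(\<integral>\<omega>. indicator E \<omega> \<partial>M) = prob E" by (simp add: Int_absorb2 E_def subset_eq)
          finally have "cE f (u n) \<le> prob E / tailprob (u n)"
            unfolding cE_def using tailprob_pos[of "u n"] by (intro divide_right_mono) auto
          then show ?case using elim(1) by (simp add: clust_prob_def E_def w_tailprob)
        qed
      qed simp
      finally show ?thesis by (simp add: J_def)
    qed
    have [measurable]: "{\<eta>\<in>space MY. \<exists>j\<in>{j::int. int l \<le> \<bar>j\<bar> \<and> \<bar>j\<bar> \<le> int L}. N (Y j \<eta>) \<ge> s} \<in> sets MY" for L
      by measurable
    \<comment> \<open>The bound is uniform in the outer radius, which may now tend to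
      infinity.\<close>
    have "(\<lambda>L. MY.prob {\<eta>\<in>space MY. \<exists>j\<in>{j. int l \<le> \<bar>j\<bar> \<and> \<bar>j\<bar> \<le> int L}. N (Y j \<eta>) \<ge> s})
       \<longlonglongrightarrow> MY.prob (\<Union>L. {\<eta>\<in>space MY. \<exists>j\<in>{j. int l \<le> \<bar>j\<bar> \<and> \<bar>j\<bar> \<le> int L}. N (Y j \<eta>) \<ge> s})"
    proof (rule MY.finite_Lim_measure_incseq)
      show "incseq (\<lambda>L. {\<eta>\<in>space MY. \<exists>j\<in>{j. int l \<le> \<bar>j\<bar> \<and> \<bar>j\<bar> \<le> int L}. N (Y j \<eta>) \<ge> s})"
        by (rule incseq_SucI) force
    qed auto
    then have "MY.prob (\<Union>L. {\<eta>\<in>space MY. \<exists>j\<in>{j. int l \<le> \<bar>j\<bar> \<and> \<bar>j\<bar> \<le> int L}. N (Y j \<eta>) \<ge> s}) \<le> \<epsilon>"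
      by (rule LIMSEQ_le_const2) (use fin in auto)
    also have "(\<Union>L. {\<eta>\<in>space MY. \<exists>j\<in>{j. int l \<le> \<bar>j\<bar> \<and> \<bar>j\<bar> \<le> int L}. N (Y j \<eta>) \<ge> s})
       = {\<eta>\<in>space MY. \<exists>j::int. int l \<le> \<bar>j\<bar> \<and> N (Y j \<eta>) \<ge> s}"
    proof safe
      fix \<eta> and j :: int assume "\<eta> \<in> space MY" "int l \<le> \<bar>j\<bar>" "N (Y j \<eta>) \<ge> s"
      then show "\<eta> \<in> (\<Union>L. {\<eta>\<in>space MY. \<exists>j\<in>{j. int l \<le> \<bar>j\<bar> \<and> \<bar>j\<bar> \<le> int L}. N (Y j \<eta>) \<ge> s})"
        by (intro UN_I[of "nat \<bar>j\<bar>"]) auto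
    qed auto
    finally show "MY.prob {\<eta>\<in>space MY. \<exists>j::int. int l \<le> \<bar>j\<bar> \<and> N (Y j \<eta>) \<ge> s} \<le> \<epsilon>" .
  qed
qed

text \<open>For each fixed level, the event of exceedances arbitrarily far out has probability below
  every \<epsilon>. Countably many levels 1 / (k + 1) suffice.\<close>

lemma AE_Y_in_l0: "AE \<eta> in MY. in_l0 (\<lambda>j. Y j \<eta>)"
proof -
  have "AE \<eta> in MY. \<exists>l. \<forall>j::int. int l \<le> \<bar>j\<bar> \<longrightarrow> N (Y j \<eta>) < s" if "s > 0" for s
  proof -
    define B where "B = {\<eta>\<in>space MY. \<forall>l::nat. \<exists>j::int. int l \<le> \<bar>j\<bar> \<and> N (Y j \<eta>) \<ge> s}"
    have [measurable]: "B \<in> sets MY" unfolding B_def by measurable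
    have "MY.prob B \<le> \<epsilon>" if "\<epsilon> > 0" for \<epsilon>
    proof -
      from Y_exceed_far_small[OF \<open>s > 0\<close> that] obtain l where l: "MY.prob {\<eta>\<in>space MY. \<exists>j::int. int l \<le> \<bar>j\<bar> \<and> N (Y j \<eta>) \<ge> s} \<le> \<epsilon>" by blast
      have "MY.prob B \<le> MY.prob {\<eta>\<in>space MY. \<exists>j::int. int l \<le> \<bar>j\<bar> \<and> N (Y j \<eta>) \<ge> s}"
        by (intro MY.finite_measure_mono) (auto simp: B_def)
      with l show ?thesis by simp
    qed
    then have "MY.prob B = 0" by (metis dense_ge measure_nonneg order_antisym)
    then have "AE \<eta> in MY. \<eta> \<notin> B" by (subst (asm) MY.prob_eq_0) auto
    then show ?thesis by (rule AE_mp) (intro AE_I2, auto simp: B_def not_le, metis not_le)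
  qed
  then have "AE \<eta> in MY. \<forall>k::nat. \<exists>l::nat. \<forall>j::int. int l \<le> \<bar>j\<bar> \<longrightarrow> N (Y j \<eta>) < 1 / real (Suc k)"
    by (subst AE_all_countable) auto
  then show ?thesis
  proof (rule AE_mp, intro AE_I2 impI)
    fix \<eta> assume H: "\<forall>k::nat. \<exists>l::nat. \<forall>j::int. int l \<le> \<bar>j\<bar> \<longrightarrow> N (Y j \<eta>) < 1 / real (Suc k)"
    obtain c where c: "c > 0" "\<And>x. c * norm x \<le> N x" using is_norm_lower[OF is_norm] by auto
    have ev: "\<exists>l::nat. \<forall>j. int l \<le> \<bar>j\<bar> \<longrightarrow> norm (Y j \<eta>) < e" if "e > 0" for e
    proof -
      have "c * e > 0" using that c(1) by simp
      then obtain k where k: "1 / real (Suc k) < c * e" by (rule nat_approx_posE)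
      obtain l where "\<And>j::int. int l \<le> \<bar>j\<bar> \<Longrightarrow> N (Y j \<eta>) < 1 / real (Suc k)" using H by blast
      then have "c * norm (Y j \<eta>) < c * e" if "int l \<le> \<bar>j\<bar>" for j using that c(2)[of "Y j \<eta>"] k by force
      then show ?thesis using c(1) by auto
    qed
    show "in_l0 (\<lambda>j. Y j \<eta>)"
      unfolding in_l0_def tendsto_iff eventually_at_top_linorder eventually_at_bot_linorder
    proof (intro conjI allI impI)
      fix e :: real assume "e > 0"
      then obtain l where "\<And>j. int l \<le> \<bar>j\<bar> \<Longrightarrow> norm (Y j \<eta>) < e" using ev by blast
      then show "\<exists>N. \<forall>n\<ge>N. dist (Y n \<eta>) 0 < e" "\<exists>N. \<forall>n\<le>N. dist (Y n \<eta>) 0 < e"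
        by (auto intro: exI[of _ "int l"] exI[of _ "- int l"])
    qed
  qed
qed


section \<open>The level 1 carries no mass of the tail process\<close>

lemma integrable_Y:
  fixes f :: "(int \<Rightarrow> real^'d) \<Rightarrow> real"
  assumes [measurable]: "f \<in> borel_measurable seqM" and "\<And>x. \<bar>f x\<bar> \<le> B"
  shows "integrable MY (\<lambda>\<eta>. f (\<lambda>k. Y k \<eta>))"
  using assms(2) by (intro MY.integrable_const_bound[where B=B]) auto

text \<open>By regular variation, an atom of \<open>N (Y j)\<close> at 1 would propagate to atoms of comparable mass
  at every \<open>t \<in> [1, 2]\<close>.\<close>

lemma prob_N_Y_eq_transfer:
  fixes j :: int and t :: real
  assumes t: "1 \<le> t" "t \<le> 2"
  shows "MY.prob {\<eta>\<in>space MY. N (Y j \<eta>) = 1} * MY.prob {\<eta>\<in>space MY. N (Y 0 \<eta>) > 3}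
    \<le> MY.prob {\<eta>\<in>space MY. N (Y j \<eta>) = t}"
proof -
  \<comment> \<open>Tent functions shrinking to the indicator of the point 1.\<close>
  define b where "b = (\<lambda>(k::nat) y::real. max 0 (1 - real (Suc k) * \<bar>y - 1\<bar>))"
  have b01: "0 \<le> b k y" "b k y \<le> 1" for k y by (auto simp: b_def)
  have b1: "b k 1 = 1" for k by (simp add: b_def)
  define f1 where "f1 = (\<lambda>k (x::int \<Rightarrow> real^'d). b k (N (x j)))"
  define f2 where "f2 = (\<lambda>k (x::int \<Rightarrow> real^'d). b k (N (x j) / t))"
  \<comment> \<open>A continuous minorant of the indicator of N (x 0) > t that equals 1 when N (x 0)
    > 3, because t \<le> 2.\<close>
  define g where "g = (\<lambda>x::int \<Rightarrow> real^'d. min 1 (max 0 (N (x 0) - t)))"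
  have cont: "continuous_on UNIV (f1 k)" "continuous_on UNIV (f2 k)" "continuous_on UNIV g" for k
    unfolding f1_def f2_def g_def b_def using t by (auto intro!: continuous_intros)
  note [measurable] = cont[THEN continuous_measurable_seq]
  have dep: "depends_on (f1 k) {j..j}" "depends_on (f2 k) {j..j}" "depends_on g {0..0}" for k
    unfolding depends_on_def f1_def f2_def g_def by auto
  have bd: "\<bar>f1 k x\<bar> \<le> 1" "\<bar>f2 k x\<bar> \<le> 1" "\<bar>g x\<bar> \<le> 1" for k x
    using b01 by (auto simp: f1_def f2_def g_def)
  \<comment> \<open>An exceedance of t x is also one of x, and a tent at 1 on the scale t x is a
    tent at t on the scale x. The ratio of the two tail probabilities is bounded below by
    \<open>cE g x\<close>.\<close>
  have key: "cE (f1 k) (t * x) * cE g x \<le> cE (f2 k) x" if x: "x > 0" for k x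
  proof -
    have "cE g x \<le> tailprob (t * x) / tailprob x"
    proof -
      have "(\<integral>\<omega>. g (scale_seq (1 / x) (path \<omega>)) * indicator {\<omega>\<in>space M. N (X 0 \<omega>) > x} \<omega> \<partial>M)
         \<le> (\<integral>\<omega>. indicator {\<omega>\<in>space M. N (X 0 \<omega>) > t * x} \<omega> \<partial>M)"
      proof (rule integral_mono)
        show "integrable M (\<lambda>\<omega>. g (scale_seq (1 / x) (path \<omega>)) * indicator {\<omega>\<in>space M. N (X 0 \<omega>) > x} \<omega>)"
          by (rule integrable_cE[OF _ bd(3)]) measurable
        show "integrable M (indicat_real {\<omega>\<in>space M. N (X 0 \<omega>) > t * x})"
          by (simp add: emeasure_eq_measure)
        fix \<omega> assume "\<omega> \<in> space M"
        then show "g (scale_seq (1 / x) (path \<omega>)) * indicator {\<omega>\<in>space M. N (X 0 \<omega>) > x} \<omega> \<le> indicator {\<omega>\<in>space M. N (X 0 \<omega>) > t * x} \<omega>"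
          using x t by (auto simp: g_def indicator_def scale_seq_def path_def is_norm_scale[OF is_norm] field_simps)
      qed
      also have "(\<integral>\<omega>. indicator {\<omega>\<in>space M. N (X 0 \<omega>) > t * x} \<omega> \<partial>M) = tailprob (t * x)"
        by (simp add: tailprob_def Int_absorb2 subset_eq)
      finally show ?thesis unfolding cE_def using tailprob_pos[of x] by (intro divide_right_mono) auto
    qed
    moreover have "0 \<le> cE (f1 k) (t * x)"
      unfolding cE_def using b01 tailprob_pos[of "t * x"] by (intro divide_nonneg_pos integral_nonneg_AE) (auto simp: f1_def)
    ultimately have "cE (f1 k) (t * x) * cE g x \<le> cE (f1 k) (t * x) * (tailprob (t * x) / tailprob x)"
      by (intro mult_left_mono)
    also have "\<dots> = (\<integral>\<omega>. f1 k (scale_seq (1 / (t * x)) (path \<omega>)) * indicator {\<omega>\<in>space M. N (X 0 \<omega>) > t * x} \<omega> \<partial>M) / tailprob x"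
      unfolding cE_def using tailprob_pos[of "t * x"] by simp
    also have "\<dots> \<le> cE (f2 k) x"
      unfolding cE_def
    proof (intro divide_right_mono integral_mono integrable_cE[OF _ bd(1)] integrable_cE[OF _ bd(2)] less_imp_le[OF tailprob_pos])
      fix \<omega>
      have "f1 k (scale_seq (1 / (t * x)) (path \<omega>)) = f2 k (scale_seq (1 / x) (path \<omega>))"
        using x t by (simp add: f1_def f2_def scale_seq_def is_norm_scale[OF is_norm] mult.commute)
      moreover have "x \<le> t * x" using x t by simp
      ultimately show "f1 k (scale_seq (1 / (t * x)) (path \<omega>)) * indicator {\<omega>\<in>space M. N (X 0 \<omega>) > t * x} \<omega>
        \<le> f2 k (scale_seq (1 / x) (path \<omega>)) * indicator {\<omega>\<in>space M. N (X 0 \<omega>) > x} \<omega>"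
        using b01 by (auto simp: indicator_def f2_def)
    qed measurable
    finally show ?thesis .
  qed
  have tx: "filterlim (\<lambda>x::real. t * x) at_top at_top"
    using t by (intro filterlim_tendsto_pos_mult_at_top[OF tendsto_const]) (auto intro: filterlim_ident)
  have lim: "(\<integral>\<eta>. f1 k (\<lambda>i. Y i \<eta>) \<partial>MY) * (\<integral>\<eta>. g (\<lambda>i. Y i \<eta>) \<partial>MY) \<le> (\<integral>\<eta>. f2 k (\<lambda>i. Y i \<eta>) \<partial>MY)" for k
  proof (rule tendsto_le)
    show "(cE (f2 k) \<longlongrightarrow> (\<integral>\<eta>. f2 k (\<lambda>i. Y i \<eta>) \<partial>MY)) at_top"
      by (rule cE_tendsto[OF cont(2) bd(2) dep(2)])
    show "((\<lambda>x. cE (f1 k) (t * x) * cE g x) \<longlongrightarrow> (\<integral>\<eta>. f1 k (\<lambda>i. Y i \<eta>) \<partial>MY) * (\<integral>\<eta>. g (\<lambda>i. Y i \<eta>) \<partial>MY)) at_top"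
      by (intro tendsto_mult filterlim_compose[OF cE_tendsto[OF cont(1) bd(1) dep(1)] tx] cE_tendsto[OF cont(3) bd(3) dep(3)])
    show "\<forall>\<^sub>F x in at_top. cE (f1 k) (t * x) * cE g x \<le> cE (f2 k) x"
      using eventually_gt_at_top[of 0] by eventually_elim (rule key)
  qed simp
  have ind_le: "MY.prob {\<eta>\<in>space MY. Q \<eta>} \<le> (\<integral>\<eta>. h (\<lambda>i. Y i \<eta>) \<partial>MY)"
    if [measurable]: "Measurable.pred MY Q" "h \<in> borel_measurable seqM" and "\<And>x. \<bar>h x\<bar> \<le> 1"
      and "\<And>\<eta>. 0 \<le> h (\<lambda>i. Y i \<eta>)" "\<And>\<eta>. Q \<eta> \<Longrightarrow> 1 \<le> h (\<lambda>i. Y i \<eta>)" for h Q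
  proof -
    have "MY.prob {\<eta>\<in>space MY. Q \<eta>} = (\<integral>\<eta>. indicator {\<eta>\<in>space MY. Q \<eta>} \<eta> \<partial>MY)"
      by (simp add: Int_absorb2 subset_eq)
    also have "\<dots> \<le> (\<integral>\<eta>. h (\<lambda>i. Y i \<eta>) \<partial>MY)"
    proof (rule integral_mono)
      show "integrable MY (\<lambda>\<eta>. h (\<lambda>i. Y i \<eta>))" using that by (intro integrable_Y)
      show "integrable MY (indicat_real {\<eta>\<in>space MY. Q \<eta>})" by (simp add: MY.emeasure_eq_measure)
    qed (use that in \<open>auto simp: indicator_def\<close>)
    finally show ?thesis .
  qed
  have f2lim: "(\<lambda>k. \<integral>\<eta>. f2 k (\<lambda>i. Y i \<eta>) \<partial>MY) \<longlonglongrightarrow> (\<integral>\<eta>. indicator {\<eta>\<in>space MY. N (Y j \<eta>) = t} \<eta> \<partial>MY)"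
  proof (rule integral_dominated_convergence[where w="\<lambda>_. 1"])
    show "AE \<eta> in MY. (\<lambda>k. f2 k (\<lambda>i. Y i \<eta>)) \<longlonglongrightarrow> indicator {\<eta>\<in>space MY. N (Y j \<eta>) = t} \<eta>"
    proof (intro AE_I2)
      fix \<eta> assume \<eta>: "\<eta> \<in> space MY"
      show "(\<lambda>k. f2 k (\<lambda>i. Y i \<eta>)) \<longlonglongrightarrow> indicator {\<eta>\<in>space MY. N (Y j \<eta>) = t} \<eta>"
      proof (cases "N (Y j \<eta>) = t")
        case True
        then show ?thesis using t \<eta> by (simp add: f2_def b1)
      next
        case False
        define d where "d = \<bar>N (Y j \<eta>) / t - 1\<bar>"
        have d: "d > 0" using False t by (auto simp: d_def field_simps)
        have "\<forall>\<^sub>F k in sequentially. f2 k (\<lambda>i. Y i \<eta>) = 0"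
          using eventually_ge_at_top[of "nat \<lceil>1 / d\<rceil>"]
        proof eventually_elim
          case (elim k)
          then have "1 / d \<le> real (Suc k)" by linarith
          then have "1 \<le> real (Suc k) * d" using d by (simp add: field_simps)
          then show ?case unfolding f2_def b_def d_def by simp
        qed
        then show ?thesis using False by (simp add: tendsto_eventually)
      qed
    qed
  qed (use bd in auto)
  have "MY.prob {\<eta>\<in>space MY. N (Y j \<eta>) = 1} * MY.prob {\<eta>\<in>space MY. N (Y 0 \<eta>) > 3} \<le> (\<integral>\<eta>. f2 k (\<lambda>i. Y i \<eta>) \<partial>MY)" for k
  proof -
    have "MY.prob {\<eta>\<in>space MY. N (Y j \<eta>) = 1} \<le> (\<integral>\<eta>. f1 k (\<lambda>i. Y i \<eta>) \<partial>MY)"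
    proof (rule ind_le[OF _ _ bd(1)])
      show "0 \<le> f1 k (\<lambda>i. Y i \<eta>)" "N (Y j \<eta>) = 1 \<Longrightarrow> 1 \<le> f1 k (\<lambda>i. Y i \<eta>)" for \<eta>
        by (simp_all add: f1_def b01 b1)
    qed measurable
    moreover have "MY.prob {\<eta>\<in>space MY. N (Y 0 \<eta>) > 3} \<le> (\<integral>\<eta>. g (\<lambda>i. Y i \<eta>) \<partial>MY)"
    proof (rule ind_le[OF _ _ bd(3)])
      show "0 \<le> g (\<lambda>i. Y i \<eta>)" "N (Y 0 \<eta>) > 3 \<Longrightarrow> 1 \<le> g (\<lambda>i. Y i \<eta>)" for \<eta>
        using t by (simp_all add: g_def)
    qed measurable
    ultimately show ?thesis
      by (intro order_trans[OF mult_mono lim[of k]]) (auto intro!: integral_nonneg_AE simp: f1_def b01)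
  qed
  then have "MY.prob {\<eta>\<in>space MY. N (Y j \<eta>) = 1} * MY.prob {\<eta>\<in>space MY. N (Y 0 \<eta>) > 3} \<le> (\<integral>\<eta>. indicator {\<eta>\<in>space MY. N (Y j \<eta>) = t} \<eta> \<partial>MY)"
    by (intro LIMSEQ_le_const[OF f2lim]) auto
  then show ?thesis by (simp add: Int_absorb2 subset_eq)
qed

text \<open>Otherwise infinitely many distinct levels in [1, 2] would carry at least the same
  positive mass; that the factor in the transferred mass is positive comes from the Pareto law of N
  (Y 0).\<close>

lemma AE_N_Y_neq_1: "AE \<eta> in MY. N (Y j \<eta>) \<noteq> 1"
proof -
  define p where "p = MY.prob {\<eta>\<in>space MY. N (Y j \<eta>) = 1} * MY.prob {\<eta>\<in>space MY. N (Y 0 \<eta>) > 3}"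
  obtain \<alpha> where "\<alpha> > 0" "\<forall>y\<ge>1. MY.prob {\<eta>\<in>space MY. N (Y 0 \<eta>) > y} = y powr (-\<alpha>)"
    using tail_process unfolding reg_var_with_tail_def by blast
  then have pos: "MY.prob {\<eta>\<in>space MY. N (Y 0 \<eta>) > 3} > 0" by simp
  define A where "A = (\<lambda>i::nat. {\<eta>\<in>space MY. N (Y j \<eta>) = 1 + 1 / real (Suc i)})"
  have [measurable]: "A i \<in> sets MY" for i unfolding A_def by measurable
  have "real n * p \<le> 1" for n
  proof -
    have "real n * p = (\<Sum>i<n. p)" by simp
    also have "\<dots> \<le> (\<Sum>i<n. MY.prob (A i))"
      unfolding p_def A_def by (intro sum_mono prob_N_Y_eq_transfer) auto
    also have "\<dots> = MY.prob (\<Union>i<n. A i)"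
      by (intro MY.finite_measure_finite_Union[symmetric]) (auto simp: disjoint_family_on_def A_def)
    also have "\<dots> \<le> 1" by simp
    finally show ?thesis .
  qed
  then have "p \<le> 0"
    by (metis linorder_not_le reals_Archimedean3)
  then have "MY.prob {\<eta>\<in>space MY. N (Y j \<eta>) = 1} = 0"
    using pos unfolding p_def by (smt (verit) measure_nonneg mult_pos_pos)
  then show ?thesis by (subst (asm) MY.prob_eq_0) auto
qed

end

section \<open>Cluster functionals\<close>

lemma powr_increment_bounds:
  fixes x \<gamma> :: real
  assumes "x \<ge> 1" "\<gamma> > 0"
  shows "(1 + \<gamma>) * x powr \<gamma> \<le> (x + 1) powr (1 + \<gamma>) - x powr (1 + \<gamma>)"
    and "(x + 1) powr (1 + \<gamma>) - x powr (1 + \<gamma>) \<le> (1 + \<gamma>) * (x + 1) powr \<gamma>"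
proof -
  have "\<exists>z. x < z \<and> z < x + 1 \<and> (x + 1) powr (1 + \<gamma>) - x powr (1 + \<gamma>) = (x + 1 - x) * ((1 + \<gamma>) * z powr \<gamma>)"
  proof (rule MVT2)
    fix y assume "x \<le> y" "y \<le> x + 1"
    then show "((\<lambda>z. z powr (1 + \<gamma>)) has_real_derivative (1 + \<gamma>) * y powr \<gamma>) (at y)"
      using has_real_derivative_powr[of y "1 + \<gamma>"] assms by simp
  qed simp
  then obtain z where z: "x < z" "z < x + 1" "(x + 1) powr (1 + \<gamma>) - x powr (1 + \<gamma>) = (1 + \<gamma>) * z powr \<gamma>" by auto
  have "x powr \<gamma> \<le> z powr \<gamma>" "z powr \<gamma> \<le> (x + 1) powr \<gamma>"
    using z assms by (auto intro!: powr_mono2)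
  then show "(1 + \<gamma>) * x powr \<gamma> \<le> (x + 1) powr (1 + \<gamma>) - x powr (1 + \<gamma>)"
    "(x + 1) powr (1 + \<gamma>) - x powr (1 + \<gamma>) \<le> (1 + \<gamma>) * (x + 1) powr \<gamma>"
    unfolding z(3) using assms by (auto intro!: mult_left_mono)
qed

text \<open>Each term i^\<gamma> lies within one increment of x^(1 + \<gamma>) / (1 + \<gamma>), by
  the mean value theorem, so the bounds telescope.\<close>

lemma sum_powr_bounds:
  fixes \<gamma> :: real
  assumes "\<gamma> > 0" "n \<ge> 1"
  shows "real n powr (1 + \<gamma>) / (1 + \<gamma>) \<le> (\<Sum>i=1..n. real i powr \<gamma>)
    \<and> (\<Sum>i=1..n. real i powr \<gamma>) \<le> real n powr (1 + \<gamma>) / (1 + \<gamma>) + real n powr \<gamma>"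
  using assms(2)
proof (induction n rule: dec_induct)
  case base
  then show ?case using assms(1) by simp
next
  case (step n)
  have n: "real n \<ge> 1" using step.hyps by simp
  note b = powr_increment_bounds[OF n assms(1)]
  have "real n powr \<gamma> \<le> ((real n + 1) powr (1 + \<gamma>) - real n powr (1 + \<gamma>)) / (1 + \<gamma>)"
    "((real n + 1) powr (1 + \<gamma>) - real n powr (1 + \<gamma>)) / (1 + \<gamma>) \<le> (real n + 1) powr \<gamma>"
    using b assms(1) by (simp_all add: field_simps)
  then show ?case using step.IH by (simp add: diff_divide_distrib add.commute)
qed

lemma mean_powr_tendsto:
  fixes \<gamma> :: real
  assumes "\<gamma> > 0"
  shows "(\<lambda>n. (\<Sum>i=1..n. real i powr \<gamma>) / real n powr (1 + \<gamma>)) \<longlonglongrightarrow> 1 / (1 + \<gamma>)"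
proof (rule tendsto_sandwich[of "\<lambda>_. 1 / (1 + \<gamma>)" _ _ "\<lambda>n. 1 / (1 + \<gamma>) + 1 / real n"])
  have *: "1 / (1 + \<gamma>) \<le> (\<Sum>i=1..n. real i powr \<gamma>) / real n powr (1 + \<gamma>)
    \<and> (\<Sum>i=1..n. real i powr \<gamma>) / real n powr (1 + \<gamma>) \<le> 1 / (1 + \<gamma>) + 1 / real n" if "n \<ge> 1" for n
  proof -
    have p: "real n powr (1 + \<gamma>) > 0" "real n powr \<gamma> > 0" using that by auto
    have "1 / (1 + \<gamma>) = (real n powr (1 + \<gamma>) / (1 + \<gamma>)) / real n powr (1 + \<gamma>)" using p by simp
    also have "\<dots> \<le> (\<Sum>i=1..n. real i powr \<gamma>) / real n powr (1 + \<gamma>)"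
      using sum_powr_bounds[OF assms that] by (intro divide_right_mono) auto
    finally have 1: "1 / (1 + \<gamma>) \<le> (\<Sum>i=1..n. real i powr \<gamma>) / real n powr (1 + \<gamma>)" .
    have "(\<Sum>i=1..n. real i powr \<gamma>) / real n powr (1 + \<gamma>) \<le> (real n powr (1 + \<gamma>) / (1 + \<gamma>) + real n powr \<gamma>) / real n powr (1 + \<gamma>)"
      using sum_powr_bounds[OF assms that] by (intro divide_right_mono) auto
    also have "\<dots> = 1 / (1 + \<gamma>) + real n powr \<gamma> / (real n powr 1 * real n powr \<gamma>)"
      using p by (simp add: add_divide_distrib powr_add)
    also have "real n powr \<gamma> / (real n powr 1 * real n powr \<gamma>) = 1 / real n"
      using p that by simp
    finally show ?thesis using 1 by simp
  qed
  show "\<forall>\<^sub>F n in sequentially. 1 / (1 + \<gamma>) \<le> (\<Sum>i=1..n. real i powr \<gamma>) / real n powr (1 + \<gamma>)"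
    "\<forall>\<^sub>F n in sequentially. (\<Sum>i=1..n. real i powr \<gamma>) / real n powr (1 + \<gamma>) \<le> 1 / (1 + \<gamma>) + 1 / real n"
    using eventually_ge_at_top[of 1] by (eventually_elim, use * in blast)+
  show "(\<lambda>n. 1 / (1 + \<gamma>) + 1 / real n) \<longlonglongrightarrow> 1 / (1 + \<gamma>)"
    using tendsto_add[OF tendsto_const[of "1 / (1 + \<gamma>)"] lim_1_over_n] by simp
qed simp

text \<open>For replacing \<open>Tmax\<close> by the position i of the first exceedance when the
  cluster has length at most L. The cost is of order n^\<gamma>, one power below the main
  sum.\<close>

lemma sum_powr_shift_le:
  fixes \<gamma> :: real
  assumes "\<gamma> > 0"
  shows "(\<Sum>i=1..n. real (i + L) powr \<gamma>) \<le> (\<Sum>i=1..n. real i powr \<gamma>) + real L * real (n + L) powr \<gamma>"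
proof (induction L)
  case (Suc L)
  \<comment> \<open>Moving the summation range by one exchanges its first term for a new last
    one.\<close>
  have tel: "(\<Sum>i=1..n. real (i + Suc L) powr \<gamma>) + real (Suc L) powr \<gamma> = (\<Sum>i=1..n. real (i + L) powr \<gamma>) + real (n + Suc L) powr \<gamma>"
    by (induction n) (auto simp: add_ac)
  have "(\<Sum>i=1..n. real (i + Suc L) powr \<gamma>) \<le> (\<Sum>i=1..n. real (i + L) powr \<gamma>) + real (n + Suc L) powr \<gamma>"
    using tel powr_ge_zero[of "real (Suc L)" \<gamma>] by linarith
  also have "\<dots> \<le> (\<Sum>i=1..n. real i powr \<gamma>) + real L * real (n + L) powr \<gamma> + real (n + Suc L) powr \<gamma>"
    using Suc.IH by simp
  also have "real L * real (n + L) powr \<gamma> \<le> real L * real (n + Suc L) powr \<gamma>"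
    using assms by (intro mult_left_mono powr_mono2) auto
  finally show ?case by (simp add: algebra_simps)
qed simp

section \<open>Cluster functionals and operations on them\<close>

lemma in_l0_cong:
  fixes x :: "int \<Rightarrow> 'a::real_normed_vector"
  assumes "in_l0 y" "\<And>k. \<bar>k\<bar> > L \<Longrightarrow> x k = y k"
  shows "in_l0 x"
proof -
  have "\<forall>\<^sub>F k in at_top. y k = x k" "\<forall>\<^sub>F k in at_bot. y k = x k"
    unfolding eventually_at_top_linorder eventually_at_bot_linorder
    using assms(2) by (intro exI[of _ "\<bar>L\<bar> + 1"] exI[of _ "- \<bar>L\<bar> - 1"], force)+
  then show ?thesis using assms(1) unfolding in_l0_def by (auto intro: Lim_transform_eventually)
qed

text \<open>The signed variant of \<open>\<H>(0)\<close>, which is closed under linear combinations and products.\<close>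

definition cluster_functional :: "('a::{real_normed_vector,second_countable_topology} \<Rightarrow> real) \<Rightarrow> 'e measure
     \<Rightarrow> (int \<Rightarrow> 'e \<Rightarrow> 'a) \<Rightarrow> ((int \<Rightarrow> 'a) \<Rightarrow> real) \<Rightarrow> real \<Rightarrow> bool" where
  "cluster_functional N MY Y G C \<longleftrightarrow>
     G \<in> borel_measurable seqM
     \<and> (AE \<eta> in MY. cont_l0 N G (\<lambda>j. Y j \<eta>))
     \<and> (\<forall>x. in_l0 x \<and> exc N x = 0 \<longrightarrow> G x = 0)
     \<and> (\<forall>x. in_l0 x \<and> exc N x > 0 \<longrightarrow> G x = G (seg x (Tmin N x) (Tmax N x)))
     \<and> (\<forall>x. in_l0 x \<longrightarrow> \<bar>G x\<bar> \<le> C)"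

text \<open>A cluster functional sees only the segment from the first to the last exceedance,
  re-indexed to start at 0. It is thus invariant under shifts and under changes outside this segment
  that create no exceedance; all comparisons of windows and blocks rest on this.\<close>

lemma cluster_functional_eq_shift:
  fixes x y :: "int \<Rightarrow> 'a::euclidean_space"
  assumes N: "is_norm N" and G: "cluster_functional N MY Y G C" and l0: "in_l0 x" "in_l0 y"
    and exc_iff: "\<And>j. N (y (j + h)) > 1 \<longleftrightarrow> N (x j) > 1"
    and eq: "\<And>j a b. N (x a) > 1 \<Longrightarrow> N (x b) > 1 \<Longrightarrow> a \<le> j \<Longrightarrow> j \<le> b \<Longrightarrow> y (j + h) = x j"
  shows "G y = G x"
proof -
  define E where "E = {j. N (x j) > 1}"
  have fin: "finite E" unfolding E_def by (rule in_l0_finite_exceed[OF N l0(1)])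
  have E': "{j. N (y j) > 1} = (\<lambda>j. j + h) ` E"
  proof (intro set_eqI iffI)
    fix j assume "j \<in> {j. N (y j) > 1}"
    then have "j - h \<in> E" using exc_iff[of "j - h"] by (simp add: E_def)
    then show "j \<in> (\<lambda>j. j + h) ` E" by (rule rev_image_eqI) simp
  qed (auto simp: E_def exc_iff)
  show ?thesis
  proof (cases "E = {}")
    case True
    then have "exc N x = 0" "exc N y = 0" using E' by (simp_all add: exc_def E_def[symmetric])
    then show ?thesis using G l0 by (simp add: cluster_functional_def)
  next
    case False
    then have pos: "exc N x > 0" "exc N y > 0" using fin E' by (simp_all add: exc_def E_def[symmetric] card_gt_0_iff)
    have mono: "mono (\<lambda>j::int. j + h)" by (simp add: mono_def)
    have Tx: "Tmin N x = Min E" "Tmax N x = Max E" by (simp_all add: Tmin_def Tmax_def E_def)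
    have Ty: "Tmin N y = Min E + h" "Tmax N y = Max E + h"
      using mono_Min_commute[OF mono fin False] mono_Max_commute[OF mono fin False]
      by (simp_all add: Tmin_def Tmax_def E')
    have mm: "N (x (Min E)) > 1" "N (x (Max E)) > 1"
      using Min_in[OF fin False] Max_in[OF fin False] by (auto simp: E_def)
    have "seg y (Tmin N y) (Tmax N y) = seg x (Tmin N x) (Tmax N x)"
    proof
      fix k show "seg y (Tmin N y) (Tmax N y) k = seg x (Tmin N x) (Tmax N x) k"
        using eq[OF mm, of "Min E + k"] by (auto simp: seg_def Tx Ty add_ac)
    qed
    then show ?thesis using G l0 pos by (simp add: cluster_functional_def)
  qed
qed

lemma cluster_functional_cmult:
  assumes "cluster_functional N MY Y G C"
  shows "cluster_functional N MY Y (\<lambda>x. c * G x) (\<bar>c\<bar> * C)"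
  unfolding cluster_functional_def
proof (intro conjI allI impI)
  note G = assms[unfolded cluster_functional_def]
  show "(\<lambda>x. c * G x) \<in> borel_measurable seqM" using G by auto
  have "AE \<eta> in MY. cont_l0 N G (\<lambda>j. Y j \<eta>)" using G by blast
  then show "AE \<eta> in MY. cont_l0 N (\<lambda>x. c * G x) (\<lambda>j. Y j \<eta>)"
  proof (rule AE_mp, intro AE_I2 impI)
    fix \<eta> assume c: "cont_l0 N G (\<lambda>j. Y j \<eta>)"
    show "cont_l0 N (\<lambda>x. c * G x) (\<lambda>j. Y j \<eta>)"
      unfolding cont_l0_def
    proof (intro allI impI)
      fix \<epsilon> :: real assume "\<epsilon> > 0"
      \<comment> \<open>The added 1 keeps the quotient meaningful for c = 0.\<close>
      then have "\<epsilon> / (\<bar>c\<bar> + 1) > 0" by simp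
      then obtain \<delta> where \<delta>: "\<delta> > 0" "\<And>y. in_l0 y \<and> (\<forall>j. N (y j - Y j \<eta>) < \<delta>) \<Longrightarrow> \<bar>G y - G (\<lambda>j. Y j \<eta>)\<bar> < \<epsilon> / (\<bar>c\<bar> + 1)"
        using c unfolding cont_l0_def by blast
      have "\<bar>c * G y - c * G (\<lambda>j. Y j \<eta>)\<bar> < \<epsilon>" if "in_l0 y \<and> (\<forall>j. N (y j - Y j \<eta>) < \<delta>)" for y
      proof -
        have "\<bar>c * G y - c * G (\<lambda>j. Y j \<eta>)\<bar> = \<bar>c\<bar> * \<bar>G y - G (\<lambda>j. Y j \<eta>)\<bar>" by (simp add: abs_mult[symmetric] algebra_simps)
        also have "\<dots> \<le> \<bar>c\<bar> * (\<epsilon> / (\<bar>c\<bar> + 1))" using \<delta>(2)[OF that] by (intro mult_left_mono) auto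
        also have "\<dots> < \<epsilon>" using \<open>\<epsilon> > 0\<close> by (simp add: field_simps)
        finally show ?thesis .
      qed
      then show "\<exists>\<delta>>0. \<forall>y. in_l0 y \<and> (\<forall>j. N (y j - Y j \<eta>) < \<delta>) \<longrightarrow> \<bar>c * G y - c * G (\<lambda>j. Y j \<eta>)\<bar> < \<epsilon>"
        using \<delta>(1) by blast
    qed
  qed
  fix x :: "int \<Rightarrow> 'a"
  show "c * G x = 0" if "in_l0 x \<and> exc N x = 0" using G that by simp
  show "c * G x = c * G (seg x (Tmin N x) (Tmax N x))" if "in_l0 x \<and> exc N x > 0" using G that by metis
  show "\<bar>c * G x\<bar> \<le> \<bar>c\<bar> * C" if "in_l0 x" using G that by (simp add: abs_mult mult_left_mono)
qed

lemma cluster_functional_add: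
  assumes "cluster_functional N MY Y G C" "cluster_functional N MY Y G' C'"
  shows "cluster_functional N MY Y (\<lambda>x. G x + G' x) (C + C')"
  unfolding cluster_functional_def
proof (intro conjI allI impI)
  note G = assms[unfolded cluster_functional_def]
  show "(\<lambda>x. G x + G' x) \<in> borel_measurable seqM" using G by auto
  have "AE \<eta> in MY. cont_l0 N G (\<lambda>j. Y j \<eta>)" "AE \<eta> in MY. cont_l0 N G' (\<lambda>j. Y j \<eta>)" using G by blast+
  then show "AE \<eta> in MY. cont_l0 N (\<lambda>x. G x + G' x) (\<lambda>j. Y j \<eta>)"
  proof eventually_elim
    case (elim \<eta>)
    show ?case unfolding cont_l0_def
    proof (intro allI impI)
      fix \<epsilon> :: real assume "\<epsilon> > 0"
      then have e: "\<epsilon> / 2 > 0" by simp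
      obtain \<delta> where \<delta>: "\<delta> > 0" "\<And>y. in_l0 y \<and> (\<forall>j. N (y j - Y j \<eta>) < \<delta>) \<Longrightarrow> \<bar>G y - G (\<lambda>j. Y j \<eta>)\<bar> < \<epsilon> / 2"
        using elim(1) e unfolding cont_l0_def by blast
      obtain \<delta>' where \<delta>': "\<delta>' > 0" "\<And>y. in_l0 y \<and> (\<forall>j. N (y j - Y j \<eta>) < \<delta>') \<Longrightarrow> \<bar>G' y - G' (\<lambda>j. Y j \<eta>)\<bar> < \<epsilon> / 2"
        using elim(2) e unfolding cont_l0_def by blast
      have "\<bar>G y + G' y - (G (\<lambda>j. Y j \<eta>) + G' (\<lambda>j. Y j \<eta>))\<bar> < \<epsilon>" if "in_l0 y \<and> (\<forall>j. N (y j - Y j \<eta>) < min \<delta> \<delta>')" for y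
      proof -
        have "\<bar>G y - G (\<lambda>j. Y j \<eta>)\<bar> < \<epsilon> / 2" "\<bar>G' y - G' (\<lambda>j. Y j \<eta>)\<bar> < \<epsilon> / 2"
          using that by (intro \<delta>(2) \<delta>'(2); simp)+
        then show ?thesis by linarith
      qed
      then show "\<exists>\<delta>>0. \<forall>y. in_l0 y \<and> (\<forall>j. N (y j - Y j \<eta>) < \<delta>) \<longrightarrow> \<bar>G y + G' y - (G (\<lambda>j. Y j \<eta>) + G' (\<lambda>j. Y j \<eta>))\<bar> < \<epsilon>"
        using \<delta>(1) \<delta>'(1) by (intro exI[of _ "min \<delta> \<delta>'"]) auto
    qed
  qed
  fix x :: "int \<Rightarrow> 'a"
  show "G x + G' x = 0" if "in_l0 x \<and> exc N x = 0" using G that by simp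
  show "G x + G' x = G (seg x (Tmin N x) (Tmax N x)) + G' (seg x (Tmin N x) (Tmax N x))" if "in_l0 x \<and> exc N x > 0" using G that by metis
  show "\<bar>G x + G' x\<bar> \<le> C + C'" if "in_l0 x" using G that by (intro order_trans[OF abs_triangle_ineq] add_mono) auto
qed

text \<open>The variance of the block sums is a first moment for the squared functional, which must
  therefore stay in the class.\<close>

lemma cluster_functional_square:
  assumes "cluster_functional N MY Y G C"
  shows "cluster_functional N MY Y (\<lambda>x. (G x)\<^sup>2) (C\<^sup>2)"
  unfolding cluster_functional_def
proof (intro conjI allI impI)
  note G = assms[unfolded cluster_functional_def]
  show "(\<lambda>x. (G x)\<^sup>2) \<in> borel_measurable seqM" using G by auto
  have "AE \<eta> in MY. cont_l0 N G (\<lambda>j. Y j \<eta>)" using G by blast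
  then show "AE \<eta> in MY. cont_l0 N (\<lambda>x. (G x)\<^sup>2) (\<lambda>j. Y j \<eta>)"
  proof eventually_elim
    case (elim \<eta>)
    define a where "a = G (\<lambda>j. Y j \<eta>)"
    show ?case unfolding cont_l0_def a_def[symmetric]
    proof (intro allI impI)
      fix \<epsilon> :: real assume "\<epsilon> > 0"
      \<comment> \<open>With e \<le> 1 the factor |G y + a| is at most 2 |a| + 1; the denominator is
        one larger to make the final bound strict.\<close>
      define e where "e = min 1 (\<epsilon> / (2 * \<bar>a\<bar> + 2))"
      have e: "e > 0" "e \<le> 1" "e * (2 * \<bar>a\<bar> + 2) \<le> \<epsilon>"
      proof -
        show "e > 0" "e \<le> 1" using \<open>\<epsilon> > 0\<close> by (auto simp: e_def)
        have "e * (2 * \<bar>a\<bar> + 2) \<le> \<epsilon> / (2 * \<bar>a\<bar> + 2) * (2 * \<bar>a\<bar> + 2)"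
          by (intro mult_right_mono) (auto simp: e_def)
        also have "\<dots> = \<epsilon>" by (simp add: add_nonneg_eq_0_iff)
        finally show "e * (2 * \<bar>a\<bar> + 2) \<le> \<epsilon>" .
      qed
      obtain \<delta> where \<delta>: "\<delta> > 0" "\<And>y. in_l0 y \<and> (\<forall>j. N (y j - Y j \<eta>) < \<delta>) \<Longrightarrow> \<bar>G y - a\<bar> < e"
        using elim e(1) unfolding cont_l0_def a_def by blast
      have "\<bar>(G y)\<^sup>2 - a\<^sup>2\<bar> < \<epsilon>" if "in_l0 y \<and> (\<forall>j. N (y j - Y j \<eta>) < \<delta>)" for y
      proof -
        have d: "\<bar>G y - a\<bar> < e" by (rule \<delta>(2)[OF that])
        have "\<bar>(G y)\<^sup>2 - a\<^sup>2\<bar> = \<bar>G y - a\<bar> * \<bar>G y + a\<bar>" by (simp add: abs_mult[symmetric] power2_eq_square algebra_simps)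
        also have "\<dots> \<le> e * (2 * \<bar>a\<bar> + 1)" using d e by (intro mult_mono) auto
        also have "\<dots> < e * (2 * \<bar>a\<bar> + 2)" using e(1) by simp
        finally show ?thesis using e(3) by simp
      qed
      then show "\<exists>\<delta>>0. \<forall>y. in_l0 y \<and> (\<forall>j. N (y j - Y j \<eta>) < \<delta>) \<longrightarrow> \<bar>(G y)\<^sup>2 - a\<^sup>2\<bar> < \<epsilon>"
        using \<delta>(1) by blast
    qed
  qed
  fix x :: "int \<Rightarrow> 'a"
  show "(G x)\<^sup>2 = 0" if "in_l0 x \<and> exc N x = 0" using G that by simp
  show "(G x)\<^sup>2 = (G (seg x (Tmin N x) (Tmax N x)))\<^sup>2" if "in_l0 x \<and> exc N x > 0" using G that by metis
  show "\<bar>(G x)\<^sup>2\<bar> \<le> C\<^sup>2" if "in_l0 x"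
  proof -
    have "\<bar>G x\<bar> \<le> C" using G that by blast
    then have "\<bar>G x\<bar>^2 \<le> C^2" by (intro power_mono) auto
    then show ?thesis by simp
  qed
qed

text \<open>Where G x = 0 the product vanishes whatever \<open>Tmax\<close> is, even for an empty
  set of exceedances, whose \<open>Max\<close> is unspecified.\<close>

lemma TmaxG_eq: "TmaxG N \<gamma> G x = real_of_int (Tmax N x) powr \<gamma> * G x"
  by (simp add: TmaxG_def)

lemma exceed_trunc:
  fixes x :: "int \<Rightarrow> 'a::real_normed_vector"
  shows "is_norm N \<Longrightarrow> {j. N (trunc I x j) > 1} = {j\<in>I. N (x j) > 1}"
  by (auto simp: trunc_def is_norm_zero split: if_splits)

section \<open>Weak convergence for almost everywhere continuous functions of a window\<close>

context tail_sequence
begin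

text \<open>A pseudometric that sees only the window from -L to L. Lipschitz functions for it are
  continuous in the product topology and depend on the window only, as \<open>cE_tendsto\<close>
  requires.\<close>

definition seq_dist :: "nat \<Rightarrow> (int \<Rightarrow> real^'d) \<Rightarrow> (int \<Rightarrow> real^'d) \<Rightarrow> real" where
  "seq_dist L x y = (\<Sum>k\<in>{- int L..int L}. N (x k - y k))"

lemma seq_dist_nonneg: "0 \<le> seq_dist L x y"
  unfolding seq_dist_def by (intro sum_nonneg) simp

lemma seq_dist_self: "seq_dist L x x = 0"
  unfolding seq_dist_def by (simp add: is_norm_zero[OF is_norm])

lemma seq_dist_commute: "seq_dist L x y = seq_dist L y x"
  unfolding seq_dist_def by (intro sum.cong refl is_norm_minus_commute[OF is_norm])

lemma seq_dist_triangle: "seq_dist L x z \<le> seq_dist L x y + seq_dist L y z"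
proof -
  have "N (x k - z k) \<le> N (x k - y k) + N (y k - z k)" for k
    using is_norm_triangle[OF is_norm, of "x k - y k" "y k - z k"] by simp
  then show ?thesis unfolding seq_dist_def sum.distrib[symmetric] by (intro sum_mono)
qed

lemma N_le_seq_dist: "k \<in> {- int L..int L} \<Longrightarrow> N (x k - y k) \<le> seq_dist L x y"
  unfolding seq_dist_def by (rule member_le_sum) auto

lemma lipschitz_seq_continuous:
  fixes f :: "(int \<Rightarrow> real^'d) \<Rightarrow> real"
  assumes "\<And>x y. \<bar>f x - f y\<bar> \<le> K * seq_dist L x y"
  shows "continuous_on UNIV f"
proof -
  have "isCont f x0" for x0
  proof -
    have "continuous_on UNIV (\<lambda>x. K * seq_dist L x x0)"
      unfolding seq_dist_def by (intro continuous_intros)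
    then have "isCont (\<lambda>x. K * seq_dist L x x0) x0" by (simp add: continuous_on_eq_continuous_at)
    then have "((\<lambda>x. K * seq_dist L x x0) \<longlongrightarrow> 0) (at x0)" by (simp add: isCont_def seq_dist_self)
    then have "((\<lambda>x. f x - f x0) \<longlongrightarrow> 0) (at x0)"
      by (rule Lim_null_comparison[rotated]) (use assms in auto)
    then show ?thesis unfolding isCont_def by (rule LIM_zero_cancel)
  qed
  then show ?thesis by (simp add: continuous_at_imp_continuous_on)
qed

text \<open>The Lipschitz upper envelopes \<open>sup\<^sub>y (f y - k d(x, y))\<close> decrease to \<open>f\<close> at every continuity point,
  so weak convergence yields an upper bound up to the mass of the remaining points.\<close>

lemma cE_eventually_le:
  fixes f :: "(int \<Rightarrow> real^'d) \<Rightarrow> real"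
  assumes f [measurable]: "f \<in> borel_measurable seqM" and C: "\<And>x. \<bar>f x\<bar> \<le> C" and dep: "depends_on f {- int L..int L}"
    and \<Omega> [measurable]: "\<Omega> \<in> sets MY"
    and cont: "AE \<eta> in MY. \<eta> \<in> \<Omega> \<longrightarrow> (\<forall>\<epsilon>>0. \<exists>\<delta>>0. \<forall>x. seq_dist L x (\<lambda>k. Y k \<eta>) < \<delta> \<longrightarrow> \<bar>f x - f (\<lambda>k. Y k \<eta>)\<bar> < \<epsilon>)"
    and "\<epsilon> > 0"
  shows "\<forall>\<^sub>F x in at_top. cE f x \<le> (\<integral>\<eta>. f (\<lambda>k. Y k \<eta>) \<partial>MY) + 2 * C * MY.prob (space MY - \<Omega>) + \<epsilon>"
proof -
  define F where "F = (\<lambda>(k::nat) x. SUP y. f y - real k * seq_dist L x y)"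
  have bdd: "bdd_above (range (\<lambda>y. f y - real k * seq_dist L x y))" for k x
  proof (rule bdd_aboveI[of _ C], safe)
    fix y show "f y - real k * seq_dist L x y \<le> C"
      using C[of y] mult_nonneg_nonneg[OF of_nat_0_le_iff[of k] seq_dist_nonneg[of L x y]] by linarith
  qed
  have Fge: "f y - real k * seq_dist L x y \<le> F k x" for k x y
    unfolding F_def by (rule cSUP_upper[OF _ bdd]) simp
  have fF: "f x \<le> F k x" for k x using Fge[of x k x] by (simp add: seq_dist_self)
  have Fle: "F k x \<le> c" if "\<And>y. f y - real k * seq_dist L x y \<le> c" for k x c
    unfolding F_def using that by (intro cSUP_least) auto
  have FC: "F k x \<le> C" for k x
    using C mult_nonneg_nonneg[OF of_nat_0_le_iff seq_dist_nonneg] by (intro Fle) (smt (verit))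
  have Fb: "\<bar>F k x\<bar> \<le> C" for k x using FC[of k x] fF[of x k] C[of x] by linarith
  have Flip: "\<bar>F k x - F k y\<bar> \<le> real k * seq_dist L x y" for k x y
  proof -
    have *: "F k x \<le> F k y + real k * seq_dist L x y" for x y
    proof (rule Fle)
      fix z
      have "real k * seq_dist L y z \<le> real k * (seq_dist L y x + seq_dist L x z)"
        by (intro mult_left_mono seq_dist_triangle) auto
      then show "f z - real k * seq_dist L x z \<le> F k y + real k * seq_dist L x y"
        using Fge[of z k y] seq_dist_commute[of L y x] by (simp add: algebra_simps)
    qed
    from *[of x y] *[of y x] show ?thesis by (simp add: seq_dist_commute[of L y x])
  qed
  have Fc: "continuous_on UNIV (F k)" for k by (rule lipschitz_seq_continuous[OF Flip])
  have Fm [measurable]: "F k \<in> borel_measurable seqM" for k by (rule continuous_measurable_seq[OF Fc])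
  have Fd: "depends_on (F k) {- int L..int L}" for k
    unfolding depends_on_def
  proof (intro allI impI)
    fix x y :: "int \<Rightarrow> real^'d" assume "\<forall>k\<in>{- int L..int L}. x k = y k"
    then have "seq_dist L x y = 0" unfolding seq_dist_def by (simp add: is_norm_zero[OF is_norm])
    then show "F k x = F k y" using Flip[of k x y] by simp
  qed
  \<comment> \<open>Continuity is available on \<Omega> only, so convergence of the envelopes is
    claimed for the integrals over \<Omega>.\<close>
  have lim: "(\<lambda>k. \<integral>\<eta>. F k (\<lambda>i. Y i \<eta>) * indicator \<Omega> \<eta> \<partial>MY) \<longlonglongrightarrow> (\<integral>\<eta>. f (\<lambda>i. Y i \<eta>) * indicator \<Omega> \<eta> \<partial>MY)"
  proof (rule integral_dominated_convergence[where w="\<lambda>_. C"])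
    show "AE \<eta> in MY. (\<lambda>k. F k (\<lambda>i. Y i \<eta>) * indicator \<Omega> \<eta>) \<longlonglongrightarrow> f (\<lambda>i. Y i \<eta>) * indicator \<Omega> \<eta>"
      using cont
    proof eventually_elim
      case (elim \<eta>)
      define y0 where "y0 = (\<lambda>i. Y i \<eta>)"
      show ?case
      proof (cases "\<eta> \<in> \<Omega>")
        case True
        have "(\<lambda>k. F k y0) \<longlonglongrightarrow> f y0"
        proof (rule LIMSEQ_I)
          fix e :: real assume "e > 0"
          then obtain \<delta> where \<delta>: "\<delta> > 0" "\<And>x. seq_dist L x y0 < \<delta> \<Longrightarrow> \<bar>f x - f y0\<bar> < e / 2"
            using elim True half_gt_zero[OF \<open>e > 0\<close>] unfolding y0_def by blast
          \<comment> \<open>From this k on, the penalty at distance \<delta> or more outweighs the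
            oscillation 2 C of f, so only points closer than \<delta> matter for the
            supremum.\<close>
          have "norm (F k y0 - f y0) < e" if k: "k \<ge> nat \<lceil>2 * C / \<delta>\<rceil>" for k
          proof -
            have "F k y0 \<le> f y0 + e / 2"
            proof (rule Fle)
              fix y
              show "f y - real k * seq_dist L y0 y \<le> f y0 + e / 2"
              proof (cases "seq_dist L y y0 < \<delta>")
                case True
                then have "f y < f y0 + e / 2" using \<delta>(2)[of y] by linarith
                moreover have "0 \<le> real k * seq_dist L y0 y" by (intro mult_nonneg_nonneg seq_dist_nonneg) simp
                ultimately show ?thesis by linarith
              next
                case False
                have "2 * C / \<delta> \<le> real k" using k by linarith
                then have "2 * C \<le> real k * \<delta>" using \<delta>(1) by (simp add: field_simps)
                also have "\<dots> \<le> real k * seq_dist L y0 y"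
                  using False by (intro mult_left_mono) (auto simp: seq_dist_commute)
                finally show ?thesis using C[of y] C[of y0] \<open>e > 0\<close> by (simp add: abs_le_iff)
              qed
            qed
            then show ?thesis using fF[of y0 k] \<open>e > 0\<close> by simp
          qed
          then show "\<exists>k0. \<forall>k\<ge>k0. norm (F k y0 - f y0) < e" by blast
        qed
        then show ?thesis using True by (simp add: y0_def)
      qed simp
    qed
    show "AE \<eta> in MY. norm (F k (\<lambda>i. Y i \<eta>) * indicator \<Omega> \<eta>) \<le> C" for k
      using Fb order_trans[OF abs_ge_zero Fb] by (auto simp: indicator_def)
  qed auto
  \<comment> \<open>Restricting to \<Omega> costs C times the mass outside. It is paid once for the
    envelope and once for f, which gives the factor 2 C.\<close>
  have out: "(\<integral>\<eta>. h (\<lambda>i. Y i \<eta>) \<partial>MY) \<le> (\<integral>\<eta>. h (\<lambda>i. Y i \<eta>) * indicator \<Omega> \<eta> \<partial>MY) + C * MY.prob (space MY - \<Omega>)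
      \<and> (\<integral>\<eta>. h (\<lambda>i. Y i \<eta>) * indicator \<Omega> \<eta> \<partial>MY) \<le> (\<integral>\<eta>. h (\<lambda>i. Y i \<eta>) \<partial>MY) + C * MY.prob (space MY - \<Omega>)"
    if [measurable]: "h \<in> borel_measurable seqM" and hb: "\<And>x. \<bar>h x\<bar> \<le> C" for h
  proof -
    have i1: "integrable MY (\<lambda>\<eta>. h (\<lambda>i. Y i \<eta>))" using hb by (intro integrable_Y) auto
    have i2: "integrable MY (\<lambda>\<eta>. h (\<lambda>i. Y i \<eta>) * indicator \<Omega> \<eta>)"
      using i1 by (intro integrable_real_mult_indicator) auto
    have i3: "integrable MY (\<lambda>\<eta>. C * indicator (space MY - \<Omega>) \<eta>)"
      by (intro integrable_mult_right) (auto simp: MY.emeasure_eq_measure)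
    have eq: "(\<integral>\<eta>. C * indicator (space MY - \<Omega>) \<eta> \<partial>MY) = C * MY.prob (space MY - \<Omega>)"
      by (simp add: Int_absorb2)
    have "(\<integral>\<eta>. h (\<lambda>i. Y i \<eta>) \<partial>MY) \<le> (\<integral>\<eta>. h (\<lambda>i. Y i \<eta>) * indicator \<Omega> \<eta> + C * indicator (space MY - \<Omega>) \<eta> \<partial>MY)"
    proof (intro integral_mono i1 Bochner_Integration.integrable_add i2 i3)
      fix \<eta> assume "\<eta> \<in> space MY"
      then show "h (\<lambda>i. Y i \<eta>) \<le> h (\<lambda>i. Y i \<eta>) * indicator \<Omega> \<eta> + C * indicator (space MY - \<Omega>) \<eta>"
        using hb[of "\<lambda>i. Y i \<eta>"] by (auto simp: indicator_def abs_le_iff)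
    qed
    moreover have "(\<integral>\<eta>. h (\<lambda>i. Y i \<eta>) * indicator \<Omega> \<eta> \<partial>MY) \<le> (\<integral>\<eta>. h (\<lambda>i. Y i \<eta>) + C * indicator (space MY - \<Omega>) \<eta> \<partial>MY)"
    proof (intro integral_mono i1 Bochner_Integration.integrable_add i2 i3)
      fix \<eta> assume "\<eta> \<in> space MY"
      then show "h (\<lambda>i. Y i \<eta>) * indicator \<Omega> \<eta> \<le> h (\<lambda>i. Y i \<eta>) + C * indicator (space MY - \<Omega>) \<eta>"
        using hb[of "\<lambda>i. Y i \<eta>"] by (auto simp: indicator_def abs_le_iff)
    qed
    ultimately show ?thesis
      unfolding Bochner_Integration.integral_add[OF i1 i3] Bochner_Integration.integral_add[OF i2 i3] eq by blast
  qed
  have "\<forall>\<^sub>F k in sequentially. (\<integral>\<eta>. F k (\<lambda>i. Y i \<eta>) * indicator \<Omega> \<eta> \<partial>MY) < (\<integral>\<eta>. f (\<lambda>i. Y i \<eta>) * indicator \<Omega> \<eta> \<partial>MY) + \<epsilon> / 2"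
    using lim \<open>\<epsilon> > 0\<close> by (intro order_tendstoD(2)) auto
  then obtain k where "(\<integral>\<eta>. F k (\<lambda>i. Y i \<eta>) * indicator \<Omega> \<eta> \<partial>MY) < (\<integral>\<eta>. f (\<lambda>i. Y i \<eta>) * indicator \<Omega> \<eta> \<partial>MY) + \<epsilon> / 2"
    by (auto simp: eventually_sequentially)
  then have k: "(\<integral>\<eta>. F k (\<lambda>i. Y i \<eta>) \<partial>MY) < (\<integral>\<eta>. f (\<lambda>i. Y i \<eta>) \<partial>MY) + 2 * C * MY.prob (space MY - \<Omega>) + \<epsilon> / 2"
    using out[of "F k", OF Fm Fb] out[of f, OF f C] by linarith
  have "\<forall>\<^sub>F x in at_top. cE (F k) x < (\<integral>\<eta>. F k (\<lambda>i. Y i \<eta>) \<partial>MY) + \<epsilon> / 2"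
    using cE_tendsto[OF Fc Fb Fd, of k] \<open>\<epsilon> > 0\<close> by (intro order_tendstoD(2)) auto
  then show ?thesis using eventually_gt_at_top[of 0]
  proof eventually_elim
    case (elim x)
    have "cE f x \<le> cE (F k) x" using elim(2) by (intro cE_mono[OF f C Fm Fb] fF)
    then show ?case using elim(1) k by linarith
  qed
qed

end

section \<open>Anchoring at the first exceedance\<close>

lemma cluster_functional_bound_nonneg: "cluster_functional N MY Y G C \<Longrightarrow> 0 \<le> C"
  unfolding cluster_functional_def by (metis abs_ge_zero finite.emptyI in_l0_trunc order_trans)

lemma shift_scale_seq: "shift h (scale_seq c x) = scale_seq c (shift h x)"
  by (simp add: shift_def scale_seq_def)

context tail_sequence
begin

lemma cE_abs_diff_le:
  assumes f: "f \<in> borel_measurable seqM" "\<And>x. \<bar>f x\<bar> \<le> B1"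
    and g: "g \<in> borel_measurable seqM" "\<And>x. \<bar>g x\<bar> \<le> B2"
    and h: "h \<in> borel_measurable seqM" "\<And>x. \<bar>h x\<bar> \<le> B3"
    and le: "\<And>z. N (z 0) > 1 \<Longrightarrow> \<bar>f z - g z\<bar> \<le> h z" and "x > 0"
  shows "\<bar>cE f x - cE g x\<bar> \<le> cE h x"
proof -
  have add: "cE (\<lambda>z. p z + h z) x = cE p x + cE h x" if p: "p \<in> borel_measurable seqM" "\<And>x. \<bar>p x\<bar> \<le> B" for p B
    unfolding cE_def ring_distribs Bochner_Integration.integral_add[OF integrable_cE[OF p] integrable_cE[OF h]]
    by (rule add_divide_distrib)
  have "cE f x \<le> cE (\<lambda>z. g z + h z) x"
  proof (rule cE_mono[OF f])
    show "\<bar>g z + h z\<bar> \<le> B2 + B3" for z by (rule order_trans[OF abs_triangle_ineq add_mono[OF g(2) h(2)]])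
    show "f z \<le> g z + h z" if "N (z 0) > 1" for z using le[of z, OF that] by linarith
  qed (use g h \<open>x > 0\<close> in auto)
  moreover have "cE g x \<le> cE (\<lambda>z. f z + h z) x"
  proof (rule cE_mono[OF g])
    show "\<bar>f z + h z\<bar> \<le> B1 + B3" for z by (rule order_trans[OF abs_triangle_ineq add_mono[OF f(2) h(2)]])
    show "g z \<le> f z + h z" if "N (z 0) > 1" for z using le[of z, OF that] by linarith
  qed (use f h \<open>x > 0\<close> in auto)
  ultimately show ?thesis using add[OF f] add[OF g] by linarith
qed

lemma cE_cmult: "cE (\<lambda>z. c * f z) x = c * cE f x"
  unfolding cE_def by (simp add: mult.assoc)

lemma cE_affine:
  assumes "f \<in> borel_measurable seqM" "\<And>x. \<bar>f x\<bar> \<le> B"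
  shows "cE (\<lambda>z. a + b * f z) x = a + b * cE f x"
proof -
  have i: "integrable M (\<lambda>\<omega>. a * indicator {\<omega>\<in>space M. N (X 0 \<omega>) > x} \<omega>)"
    by (intro integrable_mult_right) (auto simp: emeasure_eq_measure)
  have j: "integrable M (\<lambda>\<omega>. b * (f (scale_seq (1 / x) (path \<omega>)) * indicator {\<omega>\<in>space M. N (X 0 \<omega>) > x} \<omega>))"
    by (intro integrable_mult_right integrable_cE[OF assms])
  have "{\<omega>\<in>space M. N (X 0 \<omega>) > x} \<inter> space M = {\<omega>\<in>space M. N (X 0 \<omega>) > x}" by auto
  then show ?thesis
    unfolding cE_def ring_distribs mult.assoc Bochner_Integration.integral_add[OF i j]
    using tailprob_pos[of x] by (simp add: tailprob_def add_divide_distrib)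
qed

text \<open>The window version of the integrand of \<open>nu_star\<close>: given an exceedance at 0,
  position 0 is the first one inside the window.\<close>

definition anchored :: "((int \<Rightarrow> real^'d) \<Rightarrow> real) \<Rightarrow> nat \<Rightarrow> (int \<Rightarrow> real^'d) \<Rightarrow> real" where
  "anchored G L x = (if \<forall>k\<in>{- int L..-1}. N (x k) \<le> 1 then G (trunc {- int L..int L} x) else 0)"

text \<open>The functional of one block, with its length as a parameter so that it also covers
  blocks whose last entries are dropped.\<close>

definition block_fun :: "real \<Rightarrow> ((int \<Rightarrow> real^'d) \<Rightarrow> real) \<Rightarrow> nat \<Rightarrow> (int \<Rightarrow> real^'d) \<Rightarrow> real" where
  "block_fun \<gamma> G R x = TmaxG N \<gamma> G (trunc {1..int R} x)"

text \<open>The part of the block functional whose first exceedance is at position i, read in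
  coordinates in which i has become 0. Conditioning on an exceedance at time 0 can then be
  applied.\<close>

definition first_exc_at_0 :: "real \<Rightarrow> ((int \<Rightarrow> real^'d) \<Rightarrow> real) \<Rightarrow> nat \<Rightarrow> nat \<Rightarrow> (int \<Rightarrow> real^'d) \<Rightarrow> real" where
  "first_exc_at_0 \<gamma> G R i z =
    (if N (z 0) > 1 \<and> (\<forall>k\<in>{1..<int i}. N (z (k - int i)) \<le> 1) then block_fun \<gamma> G R (shift (- int i) z) else 0)"

context
  fixes G :: "(int \<Rightarrow> real^'d) \<Rightarrow> real" and C :: real
  assumes G: "cluster_functional N MY Y G C"
begin

lemma G_measurable [measurable]: "G \<in> borel_measurable seqM"
  using G by (simp add: cluster_functional_def)

lemma G_bound: "in_l0 x \<Longrightarrow> \<bar>G x\<bar> \<le> C"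
  using G by (simp add: cluster_functional_def)

lemma C_nonneg: "0 \<le> C" using G by (rule cluster_functional_bound_nonneg)

lemma G_trunc_bound: "finite I \<Longrightarrow> \<bar>G (trunc I x)\<bar> \<le> C"
  by (rule G_bound[OF in_l0_trunc])

lemma G_no_exceed: "finite I \<Longrightarrow> (\<And>j. j \<in> I \<Longrightarrow> N (x j) \<le> 1) \<Longrightarrow> G (trunc I x) = 0"
proof -
  assume I: "finite I" and le: "\<And>j. j \<in> I \<Longrightarrow> N (x j) \<le> 1"
  have "{j. N (trunc I x j) > 1} = {}" unfolding exceed_trunc[OF is_norm] using le by force
  then have "exc N (trunc I x) = 0" by (simp add: exc_def)
  then show ?thesis using G in_l0_trunc[OF I, of x] by (simp add: cluster_functional_def)
qed

lemma anchored_measurable [measurable]: "anchored G L \<in> borel_measurable seqM"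
  unfolding anchored_def by measurable

lemma anchored_bound: "\<bar>anchored G L x\<bar> \<le> C"
  unfolding anchored_def using G_trunc_bound C_nonneg by simp

lemma anchored_depends_on: "depends_on (anchored G L) {- int L..int L}"
  unfolding depends_on_def
proof (intro allI impI)
  fix x y :: "int \<Rightarrow> real^'d" assume xy: "\<forall>k\<in>{- int L..int L}. x k = y k"
  then have "trunc {- int L..int L} x = trunc {- int L..int L} y" by (auto simp: trunc_def)
  moreover have "(\<forall>k\<in>{- int L..-1}. N (x k) \<le> 1) \<longleftrightarrow> (\<forall>k\<in>{- int L..-1}. N (y k) \<le> 1)"
    using xy by (intro ball_cong refl) auto
  ultimately show "anchored G L x = anchored G L y" unfolding anchored_def by simp
qed

lemma G_eq_trunc:
  assumes "in_l0 y" "\<And>j. \<bar>j\<bar> > int L \<Longrightarrow> N (y j) \<le> 1"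
  shows "G y = G (trunc {- int L..int L} y)"
proof (rule cluster_functional_eq_shift[OF is_norm G in_l0_trunc assms(1), where h=0])
  show "N (y (j + 0)) > 1 \<longleftrightarrow> N (trunc {- int L..int L} y j) > 1" for j
    using assms(2)[of j] by (auto simp: trunc_def is_norm_zero[OF is_norm])
  show "y (j + 0) = trunc {- int L..int L} y j"
    if "N (trunc {- int L..int L} y a) > 1" "N (trunc {- int L..int L} y b) > 1" "a \<le> j" "j \<le> b" for j a b
    using that by (auto simp: trunc_def is_norm_zero[OF is_norm] split: if_splits)
qed simp

text \<open>If no entry of y has norm exactly 1, the indicator in \<open>anchored\<close> is locally
  constant. For the factor G, a point x near y on the window is extended by y outside; the extension
  is uniformly close to y, and its G-value is determined by the window.\<close>

lemma anchored_continuous_at: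
  assumes y: "in_l0 y" "cont_l0 N G y" "\<And>j. \<bar>j\<bar> > int L \<Longrightarrow> N (y j) \<le> 1" "\<And>j. N (y j) \<noteq> 1" and "\<epsilon> > 0"
  shows "\<exists>\<delta>>0. \<forall>x. seq_dist L x y < \<delta> \<longrightarrow> \<bar>anchored G L x - anchored G L y\<bar> < \<epsilon>"
proof -
  obtain \<delta>1 where \<delta>1: "\<delta>1 > 0" "\<And>x. in_l0 x \<and> (\<forall>j. N (x j - y j) < \<delta>1) \<Longrightarrow> \<bar>G x - G y\<bar> < \<epsilon>"
    using y(2) \<open>\<epsilon> > 0\<close> unfolding cont_l0_def by blast
  \<comment> \<open>Perturbations below this size move no entry of the window across level
    1.\<close>
  define \<delta>2 where "\<delta>2 = Min ((\<lambda>k. \<bar>N (y k) - 1\<bar>) ` {- int L..int L})"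
  have \<delta>2: "\<delta>2 > 0" unfolding \<delta>2_def using y(4) by (subst Min_gr_iff) auto
  have \<delta>2': "\<delta>2 \<le> \<bar>N (y k) - 1\<bar>" if "k \<in> {- int L..int L}" for k
    unfolding \<delta>2_def using that by (intro Min_le) auto
  show ?thesis
  proof (intro exI[of _ "min \<delta>1 \<delta>2"] conjI allI impI)
    show "min \<delta>1 \<delta>2 > 0" using \<delta>1(1) \<delta>2 by simp
    fix x assume d: "seq_dist L x y < min \<delta>1 \<delta>2"
    have near: "N (x k - y k) < min \<delta>1 \<delta>2" if "k \<in> {- int L..int L}" for k
      using N_le_seq_dist[OF that, of x y] d by linarith
    have iff: "N (x k) \<le> 1 \<longleftrightarrow> N (y k) \<le> 1" if "k \<in> {- int L..int L}" for k
      using near[OF that] \<delta>2'[OF that] is_norm_diff_triangle[OF is_norm, of "x k" "y k"] y(4)[of k] by linarith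
    \<comment> \<open>\<open>cont_l0\<close> compares with sequences close to y in every coordinate,
      whereas x is controlled on the window only.\<close>
    define z where "z = (\<lambda>k. if \<bar>k\<bar> \<le> int L then x k else y k)"
    have zl0: "in_l0 z" by (rule in_l0_cong[OF y(1), of "int L"]) (simp add: z_def)
    have "\<bar>G z - G y\<bar> < \<epsilon>"
    proof (intro \<delta>1(2) conjI allI zl0)
      fix j show "N (z j - y j) < \<delta>1"
      proof (cases "\<bar>j\<bar> \<le> int L")
        case True
        then have "j \<in> {- int L..int L}" by (simp add: abs_le_iff)
        from near[OF this] True show ?thesis by (simp add: z_def)
      qed (simp add: z_def is_norm_zero[OF is_norm] \<delta>1(1))
    qed
    moreover have "G z = G (trunc {- int L..int L} x)"
    proof -
      have "trunc {- int L..int L} z = trunc {- int L..int L} x" by (auto simp: trunc_def z_def abs_le_iff)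
      then show ?thesis using G_eq_trunc[OF zl0, of L] y(3) by (simp add: z_def)
    qed
    moreover have "G y = G (trunc {- int L..int L} y)" by (rule G_eq_trunc[OF y(1,3)])
    moreover have "(\<forall>k\<in>{- int L..-1}. N (x k) \<le> 1) \<longleftrightarrow> (\<forall>k\<in>{- int L..-1}. N (y k) \<le> 1)"
      using iff by (intro ball_cong refl) auto
    ultimately show "\<bar>anchored G L x - anchored G L y\<bar> < \<epsilon>"
      using \<open>\<epsilon> > 0\<close> unfolding anchored_def by simp
  qed
qed

lemma integrable_G_Y:
  "integrable MY (\<lambda>\<eta>. G (\<lambda>j. Y j \<eta>) * indicator {\<eta>\<in>space MY. \<forall>j<0. N (Y j \<eta>) \<le> 1} \<eta>)"
proof (rule MY.integrable_const_bound[where B=C])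
  show "AE \<eta> in MY. norm (G (\<lambda>j. Y j \<eta>) * indicator {\<eta>\<in>space MY. \<forall>j<0. N (Y j \<eta>) \<le> 1} \<eta>) \<le> C"
    using AE_Y_in_l0 by eventually_elim (use G_bound C_nonneg in \<open>auto simp: indicator_def\<close>)
qed measurable

text \<open>For large L the tail process has, with high probability, no exceedance outside the
  window. On that event \<open>anchored\<close> agrees with the integrand of \<open>nu_star\<close>
  and is continuous at the tail process.\<close>

lemma anchored_limit:
  assumes "\<epsilon> > 0"
  shows "\<exists>L0. \<forall>L\<ge>L0. \<forall>\<^sub>F n in sequentially. \<bar>cE (anchored G L) (u n) - nu_star N MY Y G\<bar> \<le> \<epsilon>"
proof -
  \<comment> \<open>The mass outside \<Omega> costs 2 C in the weak limit and 2 C in the comparison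
    with \<open>nu_star\<close>, together 4 C p \<le> \<epsilon> / 2.\<close>
  define p where "p = \<epsilon> / (8 * (C + 1))"
  have p: "p > 0" "4 * C * p \<le> \<epsilon> / 2"
    using assms C_nonneg by (auto simp: p_def field_simps)
  obtain L0 where L0: "\<And>L. L \<ge> L0 \<Longrightarrow> MY.prob {\<eta>\<in>space MY. \<exists>j::int. int L \<le> \<bar>j\<bar> \<and> N (Y j \<eta>) \<ge> 1} \<le> p"
    using Y_exceed_far_small[of 1 p] p by auto
  show ?thesis
  proof (intro exI[of _ L0] allI impI)
    fix L assume L: "L \<ge> L0"
    define \<Omega> where "\<Omega> = {\<eta>\<in>space MY. \<forall>j::int. int L < \<bar>j\<bar> \<longrightarrow> N (Y j \<eta>) \<le> 1}"
    have \<Omega> [measurable]: "\<Omega> \<in> sets MY" unfolding \<Omega>_def by measurable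
    have "MY.prob (space MY - \<Omega>) \<le> MY.prob {\<eta>\<in>space MY. \<exists>j::int. int L \<le> \<bar>j\<bar> \<and> N (Y j \<eta>) \<ge> 1}"
    proof (rule MY.finite_measure_mono)
      show "space MY - \<Omega> \<subseteq> {\<eta>\<in>space MY. \<exists>j::int. int L \<le> \<bar>j\<bar> \<and> N (Y j \<eta>) \<ge> 1}"
        by (auto simp: \<Omega>_def not_le intro: less_imp_le)
    qed measurable
    with L0[OF L] have p\<Omega>: "MY.prob (space MY - \<Omega>) \<le> p" by simp
    have AEgood: "AE \<eta> in MY. in_l0 (\<lambda>j. Y j \<eta>) \<and> cont_l0 N G (\<lambda>j. Y j \<eta>) \<and> (\<forall>j. N (Y j \<eta>) \<noteq> 1)"
    proof -
      have "AE \<eta> in MY. cont_l0 N G (\<lambda>j. Y j \<eta>)" using G by (simp add: cluster_functional_def)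
      moreover have "AE \<eta> in MY. \<forall>j. N (Y j \<eta>) \<noteq> 1" by (subst AE_all_countable) (simp add: AE_N_Y_neq_1)
      ultimately show ?thesis using AE_Y_in_l0 by eventually_elim blast
    qed
    have cont: "AE \<eta> in MY. \<eta> \<in> \<Omega> \<longrightarrow> (\<forall>\<epsilon>>0. \<exists>\<delta>>0. \<forall>x. seq_dist L x (\<lambda>k. Y k \<eta>) < \<delta> \<longrightarrow> \<bar>anchored G L x - anchored G L (\<lambda>k. Y k \<eta>)\<bar> < \<epsilon>)"
      using AEgood
    proof eventually_elim
      case (elim \<eta>)
      then show ?case by (intro impI allI anchored_continuous_at) (auto simp: \<Omega>_def)
    qed
    \<comment> \<open>\<open>cE_eventually_le\<close> bounds from above only; applied to the
      negative it gives the lower bound.\<close>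
    have cont': "AE \<eta> in MY. \<eta> \<in> \<Omega> \<longrightarrow> (\<forall>\<epsilon>>0. \<exists>\<delta>>0. \<forall>x. seq_dist L x (\<lambda>k. Y k \<eta>) < \<delta> \<longrightarrow> \<bar>(- 1) * anchored G L x - (- 1) * anchored G L (\<lambda>k. Y k \<eta>)\<bar> < \<epsilon>)"
      using cont by (simp add: abs_minus_commute)
    have i1: "integrable MY (\<lambda>\<eta>. anchored G L (\<lambda>k. Y k \<eta>))"
      by (rule integrable_Y[OF anchored_measurable anchored_bound])
    have "\<bar>(\<integral>\<eta>. anchored G L (\<lambda>k. Y k \<eta>) \<partial>MY) - nu_star N MY Y G\<bar> \<le> 2 * C * MY.prob (space MY - \<Omega>)"
    proof -
      have "\<bar>(\<integral>\<eta>. anchored G L (\<lambda>k. Y k \<eta>) \<partial>MY) - nu_star N MY Y G\<bar>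
        = \<bar>\<integral>\<eta>. anchored G L (\<lambda>k. Y k \<eta>) - G (\<lambda>j. Y j \<eta>) * indicator {\<eta>\<in>space MY. \<forall>j<0. N (Y j \<eta>) \<le> 1} \<eta> \<partial>MY\<bar>"
        unfolding nu_star_def Bochner_Integration.integral_diff[OF i1 integrable_G_Y] ..
      also have "\<dots> \<le> (\<integral>\<eta>. \<bar>anchored G L (\<lambda>k. Y k \<eta>) - G (\<lambda>j. Y j \<eta>) * indicator {\<eta>\<in>space MY. \<forall>j<0. N (Y j \<eta>) \<le> 1} \<eta>\<bar> \<partial>MY)"
        by (rule integral_abs_bound)
      also have "\<dots> \<le> (\<integral>\<eta>. 2 * C * indicator (space MY - \<Omega>) \<eta> \<partial>MY)"
      proof (rule integral_mono_AE)
        show "integrable MY (\<lambda>\<eta>. \<bar>anchored G L (\<lambda>k. Y k \<eta>) - G (\<lambda>j. Y j \<eta>) * indicator {\<eta>\<in>space MY. \<forall>j<0. N (Y j \<eta>) \<le> 1} \<eta>\<bar>)"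
          using i1 integrable_G_Y by (intro integrable_abs Bochner_Integration.integrable_diff)
        show "integrable MY (\<lambda>\<eta>. 2 * C * indicator (space MY - \<Omega>) \<eta>)"
          by (intro integrable_mult_right) (auto simp: MY.emeasure_eq_measure)
        show "AE \<eta> in MY. \<bar>anchored G L (\<lambda>k. Y k \<eta>) - G (\<lambda>j. Y j \<eta>) * indicator {\<eta>\<in>space MY. \<forall>j<0. N (Y j \<eta>) \<le> 1} \<eta>\<bar>
          \<le> 2 * C * indicator (space MY - \<Omega>) \<eta>"
          using AEgood AE_space
        proof eventually_elim
          case (elim \<eta>)
          show ?case
          proof (cases "\<eta> \<in> \<Omega>")
            case True
            then have far: "\<And>j. \<bar>j\<bar> > int L \<Longrightarrow> N (Y j \<eta>) \<le> 1" by (auto simp: \<Omega>_def)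
            have "G (\<lambda>j. Y j \<eta>) = G (trunc {- int L..int L} (\<lambda>j. Y j \<eta>))"
              using elim far by (intro G_eq_trunc) auto
            moreover have "(\<forall>j<0. N (Y j \<eta>) \<le> 1) \<longleftrightarrow> (\<forall>k\<in>{- int L..-1}. N (Y k \<eta>) \<le> 1)"
            proof
              assume *: "\<forall>k\<in>{- int L..-1}. N (Y k \<eta>) \<le> 1"
              show "\<forall>j<0. N (Y j \<eta>) \<le> 1"
              proof (intro allI impI)
                fix j :: int assume "j < 0"
                then show "N (Y j \<eta>) \<le> 1" using far[of j] * by (cases "\<bar>j\<bar> > int L") auto
              qed
            qed auto
            ultimately show ?thesis using True elim C_nonneg by (simp add: anchored_def indicator_def)
          next
            case False
            have "\<bar>G (\<lambda>j. Y j \<eta>) * indicator {\<eta>\<in>space MY. \<forall>j<0. N (Y j \<eta>) \<le> 1} \<eta>\<bar> \<le> C"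
              using G_bound[of "\<lambda>j. Y j \<eta>"] elim C_nonneg by (auto simp: indicator_def)
            then show ?thesis using False elim(2) anchored_bound[of L "\<lambda>k. Y k \<eta>"] by (simp add: indicator_def)
          qed
        qed
      qed
      also have "\<dots> = 2 * C * MY.prob (space MY - \<Omega>)" by (simp add: Int_absorb2)
      finally show ?thesis .
    qed
    moreover have "2 * C * MY.prob (space MY - \<Omega>) \<le> 2 * C * p"
      using p\<Omega> C_nonneg by (intro mult_left_mono) auto
    ultimately have ab: "\<bar>(\<integral>\<eta>. anchored G L (\<lambda>k. Y k \<eta>) \<partial>MY) - nu_star N MY Y G\<bar> \<le> 2 * C * MY.prob (space MY - \<Omega>)"
      "2 * C * MY.prob (space MY - \<Omega>) \<le> 2 * C * p" by blast+
    have "\<forall>\<^sub>F n in sequentially. cE (anchored G L) (u n) \<le> (\<integral>\<eta>. anchored G L (\<lambda>k. Y k \<eta>) \<partial>MY) + 2 * C * MY.prob (space MY - \<Omega>) + \<epsilon> / 2"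
      using assms by (intro eventually_compose_filterlim[OF _ u_lim] cE_eventually_le[OF anchored_measurable anchored_bound anchored_depends_on \<Omega> cont]) auto
    moreover have "\<forall>\<^sub>F n in sequentially. cE (\<lambda>x. (- 1) * anchored G L x) (u n)
        \<le> (\<integral>\<eta>. (- 1) * anchored G L (\<lambda>k. Y k \<eta>) \<partial>MY) + 2 * C * MY.prob (space MY - \<Omega>) + \<epsilon> / 2"
      using assms anchored_bound anchored_depends_on[of L]
      by (intro eventually_compose_filterlim[OF _ u_lim] cE_eventually_le[OF _ _ _ \<Omega> cont']) (auto simp: depends_on_def)
    ultimately show "\<forall>\<^sub>F n in sequentially. \<bar>cE (anchored G L) (u n) - nu_star N MY Y G\<bar> \<le> \<epsilon>"
    proof eventually_elim
      case (elim n)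
      then show ?case
        using ab elim(2)[unfolded cE_cmult integral_mult_right_zero] p(2) by linarith
    qed
  qed
qed

section \<open>The block functional: size, measurability and first exceedance\<close>

lemma finite_exceed_interval: "finite {j\<in>{a..b::int}. N (x j) > 1}"
  by (rule finite_subset[of _ "{a..b}"]) auto

lemma Tmax_trunc:
  "{j\<in>{1..int R}. N (x j) > 1} \<noteq> {} \<Longrightarrow> Tmax N (trunc {1..int R} x) = Max {j\<in>{1..int R}. N (x j) > 1}"
  unfolding Tmax_def exceed_trunc[OF is_norm] ..

lemma block_fun_no_exceed:
  "(\<And>j. j \<in> {1..int R} \<Longrightarrow> N (x j) \<le> 1) \<Longrightarrow> block_fun \<gamma> G R x = 0"
  unfolding block_fun_def TmaxG_eq by (subst G_no_exceed) auto

text \<open>A nonzero value requires an exceedance, and then \<open>Tmax\<close> lies between 1 and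
  R.\<close>

lemma block_fun_bound:
  assumes "\<gamma> > 0"
  shows "\<bar>block_fun \<gamma> G R x\<bar> \<le> C * real R powr \<gamma>"
proof (cases "{j\<in>{1..int R}. N (x j) > 1} = {}")
  case True
  then have "block_fun \<gamma> G R x = 0" by (intro block_fun_no_exceed) force
  then show ?thesis using C_nonneg by simp
next
  case False
  have "Max {j\<in>{1..int R}. N (x j) > 1} \<in> {j\<in>{1..int R}. N (x j) > 1}"
    by (rule Max_in[OF finite_exceed_interval False])
  then have "1 \<le> Tmax N (trunc {1..int R} x)" "Tmax N (trunc {1..int R} x) \<le> int R"
    using Tmax_trunc[OF False] by auto
  then have "real_of_int (Tmax N (trunc {1..int R} x)) powr \<gamma> \<le> real R powr \<gamma>"
    using assms by (intro powr_mono2) auto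
  then have "real_of_int (Tmax N (trunc {1..int R} x)) powr \<gamma> * \<bar>G (trunc {1..int R} x)\<bar> \<le> real R powr \<gamma> * C"
    using G_trunc_bound[of "{1..int R}" x] by (intro mult_mono) auto
  then show ?thesis unfolding block_fun_def TmaxG_eq by (simp add: abs_mult mult.commute)
qed

text \<open>\<open>Tmax\<close> is the maximum of a set that depends on the path. Splitting by the
  position of the last exceedance turns its power into a finite sum of deterministic weights times
  measurable indicators.\<close>

lemma block_fun_measurable [measurable]: "block_fun \<gamma> G R \<in> borel_measurable seqM"
proof -
  define lst where "lst = (\<lambda>(j::int) x. N (x j) > 1 \<and> (\<forall>k\<in>{j + 1..int R}. N (x k) \<le> 1))"
  have "block_fun \<gamma> G R x = (\<Sum>j\<in>{1..int R}. (if lst j x then real_of_int j powr \<gamma> else 0)) * G (trunc {1..int R} x)" for x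
  proof (cases "{j\<in>{1..int R}. N (x j) > 1} = {}")
    case True
    then have "G (trunc {1..int R} x) = 0" by (intro G_no_exceed) force+
    then show ?thesis by (simp add: block_fun_def TmaxG_eq)
  next
    case False
    define m where "m = Max {j\<in>{1..int R}. N (x j) > 1}"
    have m: "m \<in> {j\<in>{1..int R}. N (x j) > 1}" unfolding m_def by (rule Max_in[OF finite_exceed_interval False])
    have m_ge: "j \<le> m" if "j \<in> {1..int R}" "N (x j) > 1" for j unfolding m_def using that by (intro Max_ge finite_exceed_interval) auto
    have iff: "lst j x \<longleftrightarrow> j = m" if "j \<in> {1..int R}" for j
    proof
      assume l: "lst j x"
      then have "j \<le> m" using m_ge[OF that] by (simp add: lst_def)
      moreover have "\<not> j < m"
      proof
        assume "j < m"
        then have "N (x m) \<le> 1" using l m by (simp add: lst_def)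
        then show False using m by simp
      qed
      ultimately show "j = m" by simp
    next
      assume "j = m"
      moreover have "N (x k) \<le> 1" if "k \<in> {m + 1..int R}" for k
        using m_ge[of k] that m by (force simp: not_le[symmetric])
      ultimately show "lst j x" using m by (auto simp: lst_def)
    qed
    have "(\<Sum>j\<in>{1..int R}. (if lst j x then real_of_int j powr \<gamma> else 0)) = (\<Sum>j\<in>{1..int R}. (if j = m then real_of_int j powr \<gamma> else 0))"
      using iff by (intro sum.cong) auto
    also have "\<dots> = real_of_int m powr \<gamma>" using m by simp
    finally show ?thesis using Tmax_trunc[OF False] by (simp add: block_fun_def TmaxG_eq m_def)
  qed
  then have eq: "block_fun \<gamma> G R = (\<lambda>x. (\<Sum>j\<in>{1..int R}. (if lst j x then real_of_int j powr \<gamma> else 0)) * G (trunc {1..int R} x))"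
    by (rule ext)
  show ?thesis unfolding eq lst_def by measurable
qed

text \<open>The conditions on the summands are mutually exclusive, and one of them holds unless the
  block has no exceedance and the functional is 0.\<close>

lemma block_fun_first_exceed:
  "block_fun \<gamma> G R x = (\<Sum>i\<in>{1..R}. if N (x (int i)) > 1 \<and> (\<forall>k\<in>{1..<int i}. N (x k) \<le> 1) then block_fun \<gamma> G R x else 0)"
proof (cases "{i\<in>{1..R}. N (x (int i)) > 1} = {}")
  case True
  have "block_fun \<gamma> G R x = 0"
  proof (rule block_fun_no_exceed)
    fix j assume "j \<in> {1..int R}"
    then have "nat j \<in> {1..R}" "int (nat j) = j" by auto
    then show "N (x j) \<le> 1" using True by (metis (mono_tags, lifting) Collect_empty_eq not_le)
  qed
  then show ?thesis by (simp only: if_cancel sum.neutral_const)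
next
  case False
  define m where "m = Min {i\<in>{1..R}. N (x (int i)) > 1}"
  have m: "m \<in> {i\<in>{1..R}. N (x (int i)) > 1}" unfolding m_def using False by (intro Min_in) auto
  have m_le: "m \<le> i" if "i \<in> {1..R}" "N (x (int i)) > 1" for i unfolding m_def using that by (intro Min_le) auto
  have iff: "N (x (int i)) > 1 \<and> (\<forall>k\<in>{1..<int i}. N (x k) \<le> 1) \<longleftrightarrow> i = m" if "i \<in> {1..R}" for i
  proof
    assume l: "N (x (int i)) > 1 \<and> (\<forall>k\<in>{1..<int i}. N (x k) \<le> 1)"
    then have "m \<le> i" using m_le[OF that] by simp
    moreover have "\<not> m < i"
    proof
      assume "m < i"
      then have "N (x (int m)) \<le> 1" using l m by simp
      then show False using m by simp
    qed
    ultimately show "i = m" by simp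
  next
    assume "i = m"
    moreover have "N (x k) \<le> 1" if k: "k \<in> {1..<int m}" for k
    proof (rule ccontr)
      assume "\<not> N (x k) \<le> 1"
      then have "m \<le> nat k" using k m by (intro m_le) auto
      then show False using k by auto
    qed
    ultimately show "N (x (int i)) > 1 \<and> (\<forall>k\<in>{1..<int i}. N (x k) \<le> 1)" using m by auto
  qed
  have "(\<Sum>i\<in>{1..R}. if N (x (int i)) > 1 \<and> (\<forall>k\<in>{1..<int i}. N (x k) \<le> 1) then block_fun \<gamma> G R x else 0)
    = (\<Sum>i\<in>{1..R}. if i = m then block_fun \<gamma> G R x else 0)"
    using iff by (intro sum.cong) auto
  then show ?thesis using m by simp
qed

lemma first_exc_at_0_measurable [measurable]: "first_exc_at_0 \<gamma> G R i \<in> borel_measurable seqM"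
  unfolding first_exc_at_0_def by measurable

lemma first_exc_at_0_bound: "\<gamma> > 0 \<Longrightarrow> \<bar>first_exc_at_0 \<gamma> G R i z\<bar> \<le> C * real R powr \<gamma>"
  unfolding first_exc_at_0_def using block_fun_bound C_nonneg by simp

text \<open>If i is away from both ends of the block and nothing exceeds farther than L from it, the
  cluster lies within distance L of i: G sees the same segment in block and window, and
  \<open>Tmax\<close> lies between i and i + L. In all other cases each term is bounded by C
  R^\<gamma>.\<close>

lemma first_exc_at_0_approx:
  assumes "\<gamma> > 0" and i: "1 \<le> i" "i \<le> R" and z0: "N (z 0) > 1"
  shows "\<bar>first_exc_at_0 \<gamma> G R i z - real i powr \<gamma> * anchored G L z\<bar>
    \<le> C * (real (i + L) powr \<gamma> - real i powr \<gamma>)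
      + 2 * C * real R powr \<gamma> * (if i \<le> L \<or> i + L > R then 1 else 0)
      + 2 * C * real R powr \<gamma> * (if \<exists>k. int (Suc L) \<le> \<bar>k\<bar> \<and> \<bar>k\<bar> \<le> int R \<and> N (z k) > 1 then 1 else 0)"
proof -
  have mono: "real i powr \<gamma> \<le> real (i + L) powr \<gamma>" using assms by (intro powr_mono2) auto
  have nn: "0 \<le> C * (real (i + L) powr \<gamma> - real i powr \<gamma>)" using mono C_nonneg by simp
  have nn2: "0 \<le> 2 * C * real R powr \<gamma>" using C_nonneg by simp
  show ?thesis
  proof (cases "(i \<le> L \<or> i + L > R) \<or> (\<exists>k. int (Suc L) \<le> \<bar>k\<bar> \<and> \<bar>k\<bar> \<le> int R \<and> N (z k) > 1)")
    case True
    have "\<bar>real i powr \<gamma> * anchored G L z\<bar> = real i powr \<gamma> * \<bar>anchored G L z\<bar>" by (simp add: abs_mult)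
    also have "\<dots> \<le> real R powr \<gamma> * C" using assms anchored_bound by (intro mult_mono powr_mono2) auto
    finally have "\<bar>first_exc_at_0 \<gamma> G R i z - real i powr \<gamma> * anchored G L z\<bar> \<le> 2 * C * real R powr \<gamma>"
      using first_exc_at_0_bound[OF \<open>\<gamma> > 0\<close>, of R i z] by (simp only: mult.commute[of "real R powr \<gamma>" C])
    then show ?thesis using True nn nn2 by (auto split: if_splits)
  next
    case False
    then have iL: "L < i" "i + L \<le> R" and far: "\<And>k. int L < \<bar>k\<bar> \<Longrightarrow> \<bar>k\<bar> \<le> int R \<Longrightarrow> N (z k) \<le> 1" by force+
    define x where "x = trunc {1..int R} (shift (- int i) z)"
    have x_at: "x (j + int i) = (if 1 \<le> j + int i \<and> j + int i \<le> int R then z j else 0)" for j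
      by (auto simp: x_def trunc_def shift_def)
    have Gx: "G x = G (trunc {- int L..int L} z)"
    proof (rule cluster_functional_eq_shift[OF is_norm G in_l0_trunc, where h="int i"])
      show "in_l0 x" unfolding x_def by (rule in_l0_trunc) simp
      show "N (x (j + int i)) > 1 \<longleftrightarrow> N (trunc {- int L..int L} z j) > 1" for j
      proof (cases "\<bar>j\<bar> \<le> int L")
        case True
        then show ?thesis using iL by (simp add: x_at trunc_def abs_le_iff)
      next
        case F: False
        have "\<not> N (x (j + int i)) > 1"
          using far[of j] F i by (auto simp: x_at is_norm_zero[OF is_norm] not_less)
        then show ?thesis using F by (auto simp: trunc_def is_norm_zero[OF is_norm])
      qed
      show "x (j + int i) = trunc {- int L..int L} z j"
        if "N (trunc {- int L..int L} z a) > 1" "N (trunc {- int L..int L} z b) > 1" "a \<le> j" "j \<le> b" for j a b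
        using that iL by (auto simp: trunc_def x_at is_norm_zero[OF is_norm] split: if_splits)
    qed simp
    \<comment> \<open>The two ranges of past positions differ only at distances larger than L, where
      nothing exceeds, since i > L.\<close>
    have past: "(\<forall>k\<in>{1..<int i}. N (z (k - int i)) \<le> 1) \<longleftrightarrow> (\<forall>k\<in>{- int L..-1}. N (z k) \<le> 1)"
    proof
      assume *: "\<forall>k\<in>{1..<int i}. N (z (k - int i)) \<le> 1"
      show "\<forall>k\<in>{- int L..-1}. N (z k) \<le> 1"
      proof
        fix k assume "k \<in> {- int L..-1}"
        then have "k + int i \<in> {1..<int i}" using iL by auto
        from bspec[OF * this] show "N (z k) \<le> 1" by simp
      qed
    next
      assume *: "\<forall>k\<in>{- int L..-1}. N (z k) \<le> 1"
      show "\<forall>k\<in>{1..<int i}. N (z (k - int i)) \<le> 1"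
      proof
        fix k assume k: "k \<in> {1..<int i}"
        show "N (z (k - int i)) \<le> 1"
          using bspec[OF *, of "k - int i"] far[of "k - int i"] k i by force
      qed
    qed
    have iE: "int i \<in> {j\<in>{1..int R}. N (shift (- int i) z j) > 1}"
      using i z0 by (simp add: shift_def)
    have Ele: "j \<le> int i + int L" if "j \<in> {j\<in>{1..int R}. N (shift (- int i) z j) > 1}" for j
      using that far[of "j - int i"] i by (force simp: shift_def)
    have T: "Tmax N x = Max {j\<in>{1..int R}. N (shift (- int i) z j) > 1}"
      unfolding x_def using iE by (intro Tmax_trunc) blast
    have Tge: "int i \<le> Tmax N x" unfolding T by (rule Max_ge[OF finite_exceed_interval iE])
    have Tle: "Tmax N x \<le> int i + int L"
      unfolding T using Ele iE by (intro Max.boundedI finite_exceed_interval) blast+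
    have pw: "real i powr \<gamma> \<le> real_of_int (Tmax N x) powr \<gamma>" "real_of_int (Tmax N x) powr \<gamma> \<le> real (i + L) powr \<gamma>"
      using Tge Tle \<open>\<gamma> > 0\<close> by (auto intro!: powr_mono2)
    have "\<bar>real_of_int (Tmax N x) powr \<gamma> * G x - real i powr \<gamma> * G x\<bar> \<le> C * (real (i + L) powr \<gamma> - real i powr \<gamma>)"
    proof -
      have "\<bar>real_of_int (Tmax N x) powr \<gamma> * G x - real i powr \<gamma> * G x\<bar> = \<bar>G x\<bar> * (real_of_int (Tmax N x) powr \<gamma> - real i powr \<gamma>)"
        unfolding left_diff_distrib[symmetric] abs_mult using pw by (simp add: mult.commute)
      also have "\<dots> \<le> C * (real (i + L) powr \<gamma> - real i powr \<gamma>)"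
        using pw G_trunc_bound[of "{1..int R}" "shift (- int i) z"] C_nonneg by (intro mult_mono) (auto simp: x_def)
      finally show ?thesis .
    qed
    then have "\<bar>first_exc_at_0 \<gamma> G R i z - real i powr \<gamma> * anchored G L z\<bar> \<le> C * (real (i + L) powr \<gamma> - real i powr \<gamma>)"
      using nn z0 unfolding first_exc_at_0_def anchored_def past block_fun_def TmaxG_eq x_def[symmetric] Gx[symmetric] by auto
    then show ?thesis using nn2 by auto
  qed
qed

end

end

section \<open>Block moments\<close>

context tail_sequence
begin

lemma N_scale_exceed: "N (scale_seq (1 / u n) (path \<omega>) j) > 1 \<longleftrightarrow> N (X j \<omega>) > u n"
  using u_pos[of n] by (simp add: scale_seq_def path_def is_norm_scale[OF is_norm] field_simps)

lemma prob_exceed: "prob {\<omega>\<in>space M. N (X j \<omega>) > u n} = w n"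
proof -
  have "prob {\<omega>\<in>space M. N (shift j (path \<omega>) 0) > u n} = prob {\<omega>\<in>space M. N (path \<omega> 0) > u n}"
    by (rule prob_shift[of "\<lambda>x. N (x 0) > u n"]) measurable
  then show ?thesis by (simp add: shift_def path_def w_eq)
qed

lemma prob_exceed_interval: "prob {\<omega>\<in>space M. \<exists>j\<in>{a..b}. N (X j \<omega>) > u n} \<le> real (nat (b - a + 1)) * w n"
proof -
  have "prob {\<omega>\<in>space M. \<exists>j\<in>{a..b}. N (X j \<omega>) > u n} = prob (\<Union>j\<in>{a..b}. {\<omega>\<in>space M. N (X j \<omega>) > u n})"
    by (intro arg_cong[where f=prob]) auto
  also have "\<dots> \<le> (\<Sum>j\<in>{a..b}. prob {\<omega>\<in>space M. N (X j \<omega>) > u n})"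
    by (intro finite_measure_subadditive_finite) auto
  also have "\<dots> = real (nat (b - a + 1)) * w n" by (simp add: prob_exceed)
  finally show ?thesis .
qed

context
  fixes G :: "(int \<Rightarrow> real^'d) \<Rightarrow> real" and C \<gamma> :: real
  assumes G: "cluster_functional N MY Y G C" and \<gamma>: "\<gamma> > 0"
begin

lemmas [measurable] = G_measurable[OF G] block_fun_measurable[OF G] anchored_measurable[OF G] first_exc_at_0_measurable[OF G]

lemma integrable_block_fun: "integrable M (\<lambda>\<omega>. block_fun \<gamma> G R (scale_seq c (shift h (path \<omega>))))"
  by (rule integrable_const_bound[where B="C * real R powr \<gamma>"]) (auto simp: block_fun_bound[OF G \<gamma>])

lemma integral_first_exc_at_0:
  "(\<integral>\<omega>. first_exc_at_0 \<gamma> G R i (scale_seq (1 / u n) (path \<omega>)) \<partial>M) = cE (first_exc_at_0 \<gamma> G R i) (u n) * w n"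
proof -
  have "first_exc_at_0 \<gamma> G R i (scale_seq (1 / u n) (path \<omega>))
      = first_exc_at_0 \<gamma> G R i (scale_seq (1 / u n) (path \<omega>)) * indicator {\<omega>\<in>space M. N (X 0 \<omega>) > u n} \<omega>"
    if "\<omega> \<in> space M" for \<omega>
    using that N_scale_exceed[of n \<omega> 0] by (auto simp: first_exc_at_0_def indicator_def)
  then have "(\<integral>\<omega>. first_exc_at_0 \<gamma> G R i (scale_seq (1 / u n) (path \<omega>)) \<partial>M)
     = (\<integral>\<omega>. first_exc_at_0 \<gamma> G R i (scale_seq (1 / u n) (path \<omega>)) * indicator {\<omega>\<in>space M. N (X 0 \<omega>) > u n} \<omega> \<partial>M)"
    by (intro Bochner_Integration.integral_cong refl)
  then show ?thesis unfolding cE_def w_tailprob using tailprob_pos[of "u n"] by simp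
qed

text \<open>By stationarity the summand for a first exceedance at i has the same integral with i
  moved to time 0, where it is a conditional expectation times w_n.\<close>

lemma integral_block_fun:
  "(\<integral>\<omega>. block_fun \<gamma> G R (scale_seq (1 / u n) (path \<omega>)) \<partial>M) = (\<Sum>i\<in>{1..R}. cE (first_exc_at_0 \<gamma> G R i) (u n)) * w n"
proof -
  have unshift: "shift (- int i) (shift (int i) x) = x" for i and x :: "int \<Rightarrow> real^'d" by (simp add: shift_def)
  have eq: "block_fun \<gamma> G R x = (\<Sum>i\<in>{1..R}. first_exc_at_0 \<gamma> G R i (shift (int i) x))" for x
    by (rule trans[OF block_fun_first_exceed[OF G]], intro sum.cong refl)
       (simp only: first_exc_at_0_def unshift, simp add: shift_def)
  have "(\<integral>\<omega>. block_fun \<gamma> G R (scale_seq (1 / u n) (path \<omega>)) \<partial>M)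
     = (\<integral>\<omega>. (\<Sum>i\<in>{1..R}. first_exc_at_0 \<gamma> G R i (shift (int i) (scale_seq (1 / u n) (path \<omega>)))) \<partial>M)"
    by (simp only: eq[symmetric])
  also have "\<dots> = (\<Sum>i\<in>{1..R}. \<integral>\<omega>. first_exc_at_0 \<gamma> G R i (shift (int i) (scale_seq (1 / u n) (path \<omega>))) \<partial>M)"
    by (intro Bochner_Integration.integral_sum integrable_const_bound[where B="C * real R powr \<gamma>"])
       (auto simp: first_exc_at_0_bound[OF G \<gamma>])
  also have "\<dots> = (\<Sum>i\<in>{1..R}. \<integral>\<omega>. first_exc_at_0 \<gamma> G R i (scale_seq (1 / u n) (path \<omega>)) \<partial>M)"
    unfolding shift_scale_seq
    by (intro sum.cong refl integral_shift[of "\<lambda>x. first_exc_at_0 \<gamma> G R _ (scale_seq (1 / u n) x)"]) measurable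
  finally show ?thesis by (simp add: integral_first_exc_at_0 sum_distrib_right)
qed

text \<open>The three errors come from replacing \<open>Tmax\<close> by i, from positions near the
  ends, and from exceedances far from i. After division by r^(1 + \<gamma>) the first two vanish as
  n grows; the third is governed by anticlustering and becomes small through L.\<close>

lemma block_moment_approx:
  "\<bar>(\<integral>\<omega>. block_fun \<gamma> G (r n) (scale_seq (1 / u n) (path \<omega>)) \<partial>M) / w n - (\<Sum>i\<in>{1..r n}. real i powr \<gamma>) * cE (anchored G L) (u n)\<bar>
    \<le> C * (real L * real (r n + L) powr \<gamma>) + 2 * C * real (r n) powr \<gamma> * (2 * real L)
      + 2 * C * real (r n) powr \<gamma> * (real (r n) * clust_prob 1 (Suc L) n)"
proof -
  define R where "R = r n"
  define q where "q = clust_prob 1 (Suc L) n"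
  define ind where "ind = (\<lambda>z::int \<Rightarrow> real^'d. if \<exists>k. int (Suc L) \<le> \<bar>k\<bar> \<and> \<bar>k\<bar> \<le> int R \<and> N (z k) > 1 then 1 else 0::real)"
  define edge where "edge = (\<lambda>i. if i \<le> L \<or> i + L > R then 1 else 0::real)"
  have [measurable]: "ind \<in> borel_measurable seqM" unfolding ind_def by measurable
  have ind_b: "\<bar>ind z\<bar> \<le> 1" for z by (simp add: ind_def)
  have C0: "C \<ge> 0" by (rule C_nonneg[OF G])
  have cE_ind: "cE ind (u n) = q"
  proof -
    have "(\<integral>\<omega>. ind (scale_seq (1 / u n) (path \<omega>)) * indicator {\<omega>\<in>space M. N (X 0 \<omega>) > u n} \<omega> \<partial>M)
      = (\<integral>\<omega>. indicator {\<omega>\<in>space M. (\<exists>j::int. int (Suc L) \<le> \<bar>j\<bar> \<and> \<bar>j\<bar> \<le> int R \<and> N (X j \<omega>) > u n) \<and> N (X 0 \<omega>) > u n} \<omega> \<partial>M)"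
      unfolding ind_def N_scale_exceed by (intro Bochner_Integration.integral_cong) (auto simp: indicator_def)
    also have "\<dots> = prob {\<omega>\<in>space M. (\<exists>j::int. int (Suc L) \<le> \<bar>j\<bar> \<and> \<bar>j\<bar> \<le> int R \<and> N (X j \<omega>) > u n) \<and> N (X 0 \<omega>) > u n}"
      by (simp add: Int_absorb2 subset_eq)
    finally show ?thesis unfolding cE_def q_def clust_prob_def w_tailprob R_def by simp
  qed
  have one: "\<bar>cE (first_exc_at_0 \<gamma> G R i) (u n) - real i powr \<gamma> * cE (anchored G L) (u n)\<bar>
     \<le> C * (real (i + L) powr \<gamma> - real i powr \<gamma>) + 2 * C * real R powr \<gamma> * edge i + 2 * C * real R powr \<gamma> * q"
    if i: "i \<in> {1..R}" for i
  proof -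
    define a where "a = C * (real (i + L) powr \<gamma> - real i powr \<gamma>) + 2 * C * real R powr \<gamma> * edge i"
    define b where "b = 2 * C * real R powr \<gamma>"
    have "\<bar>cE (first_exc_at_0 \<gamma> G R i) (u n) - cE (\<lambda>z. real i powr \<gamma> * anchored G L z) (u n)\<bar> \<le> cE (\<lambda>z. a + b * ind z) (u n)"
    proof (rule cE_abs_diff_le)
      show "\<bar>first_exc_at_0 \<gamma> G R i x\<bar> \<le> C * real R powr \<gamma>" for x by (rule first_exc_at_0_bound[OF G \<gamma>])
      show "\<bar>real i powr \<gamma> * anchored G L x\<bar> \<le> real i powr \<gamma> * C" for x
        using anchored_bound[OF G, of L x] by (simp add: abs_mult mult_left_mono)
      show "\<bar>a + b * ind x\<bar> \<le> \<bar>a\<bar> + \<bar>b\<bar>" for x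
        by (auto simp: ind_def)
      show "\<bar>first_exc_at_0 \<gamma> G R i z - real i powr \<gamma> * anchored G L z\<bar> \<le> a + b * ind z" if "N (z 0) > 1" for z
        using first_exc_at_0_approx[OF G \<gamma>, of i R z L] i that unfolding a_def b_def edge_def ind_def by simp
    qed (use u_pos in measurable)
    then show ?thesis unfolding cE_cmult cE_affine[OF \<open>ind \<in> borel_measurable seqM\<close> ind_b] cE_ind a_def b_def .
  qed
  \<comment> \<open>At most L positions at either end of the block.\<close>
  have edge_sum: "(\<Sum>i\<in>{1..R}. edge i) \<le> 2 * real L"
  proof -
    have "(\<Sum>i\<in>{1..R}. edge i) = real (card {i\<in>{1..R}. i \<le> L \<or> i + L > R})"
      unfolding edge_def by (simp add: sum.If_cases Int_def)
    also have "card {i\<in>{1..R}. i \<le> L \<or> i + L > R} \<le> card ({1..L} \<union> {R + 1 - L..R})"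
      by (intro card_mono) auto
    also have "\<dots> \<le> card {1..L} + card {R + 1 - L..R}" by (rule card_Un_le)
    also have "\<dots> \<le> 2 * L" by auto
    finally show ?thesis by simp
  qed
  have "\<bar>(\<integral>\<omega>. block_fun \<gamma> G R (scale_seq (1 / u n) (path \<omega>)) \<partial>M) / w n - (\<Sum>i\<in>{1..R}. real i powr \<gamma>) * cE (anchored G L) (u n)\<bar>
    = \<bar>\<Sum>i\<in>{1..R}. cE (first_exc_at_0 \<gamma> G R i) (u n) - real i powr \<gamma> * cE (anchored G L) (u n)\<bar>"
    unfolding integral_block_fun sum_subtractf sum_distrib_right[of "\<lambda>i. real i powr \<gamma>"] using w_pos[of n] by simp
  also have "\<dots> \<le> (\<Sum>i\<in>{1..R}. C * (real (i + L) powr \<gamma> - real i powr \<gamma>) + 2 * C * real R powr \<gamma> * edge i + 2 * C * real R powr \<gamma> * q)"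
    by (intro order_trans[OF sum_abs] sum_mono one)
  also have "\<dots> = C * ((\<Sum>i\<in>{1..R}. real (i + L) powr \<gamma>) - (\<Sum>i\<in>{1..R}. real i powr \<gamma>))
      + 2 * C * real R powr \<gamma> * (\<Sum>i\<in>{1..R}. edge i) + 2 * C * real R powr \<gamma> * (real R * q)"
    by (simp add: sum.distrib sum_subtractf sum_distrib_left[symmetric] right_diff_distrib)
  also have "\<dots> \<le> C * (real L * real (R + L) powr \<gamma>) + 2 * C * real R powr \<gamma> * (2 * real L) + 2 * C * real R powr \<gamma> * (real R * q)"
    using sum_powr_shift_le[OF \<gamma>, where n=R and L=L] edge_sum C0 by (intro add_mono mult_left_mono order_refl) auto
  finally show ?thesis unfolding R_def q_def .
qed

text \<open>The factor 1 / (1 + \<gamma>) is the limit of the averages of (i / r)^\<gamma>, the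
  position of the first exceedance being asymptotically uniform over the block.\<close>

lemma block_moment_limit:
  "(\<lambda>n. (\<integral>\<omega>. block_fun \<gamma> G (r n) (scale_seq (1 / u n) (path \<omega>)) \<partial>M) / (real (r n) powr (1 + \<gamma>) * w n))
    \<longlonglongrightarrow> nu_star N MY Y G / (1 + \<gamma>)"
proof -
  define a where "a = (\<lambda>n. (\<integral>\<omega>. block_fun \<gamma> G (r n) (scale_seq (1 / u n) (path \<omega>)) \<partial>M) / (real (r n) powr (1 + \<gamma>) * w n))"
  define s where "s = (\<lambda>n. (\<Sum>i=1..r n. real i powr \<gamma>) / real (r n) powr (1 + \<gamma>))"
  define \<nu> where "\<nu> = nu_star N MY Y G"
  have C0: "C \<ge> 0" by (rule C_nonneg[OF G])
  have s_lim: "s \<longlonglongrightarrow> 1 / (1 + \<gamma>)"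
    unfolding s_def by (rule filterlim_compose[OF mean_powr_tendsto[OF \<gamma>] r_lim])
  have s0: "s n \<ge> 0" for n unfolding s_def by (intro divide_nonneg_nonneg sum_nonneg) auto
  have r_real: "filterlim (\<lambda>n. real (r n)) at_top sequentially"
    by (rule filterlim_compose[OF filterlim_real_sequentially r_lim])
  have err: "\<bar>a n - s n * cE (anchored G L) (u n)\<bar>
     \<le> C * (real L / real (r n)) * (1 + real L / real (r n)) powr \<gamma> + 4 * C * (real L / real (r n)) + 2 * C * clust_prob 1 (Suc L) n" for n L
  proof -
    define R where "R = real (r n)"
    have R: "R > 0" using r_pos[of n] by (simp add: R_def)
    have Rp: "R powr (1 + \<gamma>) = R * R powr \<gamma>" using R by (simp add: powr_add)
    have pw: "real (r n + L) powr \<gamma> = R powr \<gamma> * (1 + real L / R) powr \<gamma>"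
    proof -
      have "real (r n + L) = R * (1 + real L / R)" using R by (simp add: R_def field_simps)
      then show ?thesis using R by (simp add: powr_mult)
    qed
    have "a n - s n * cE (anchored G L) (u n)
      = ((\<integral>\<omega>. block_fun \<gamma> G (r n) (scale_seq (1 / u n) (path \<omega>)) \<partial>M) / w n - (\<Sum>i\<in>{1..r n}. real i powr \<gamma>) * cE (anchored G L) (u n)) / R powr (1 + \<gamma>)"
      unfolding a_def s_def R_def by (simp add: diff_divide_distrib mult.commute)
    then have "\<bar>a n - s n * cE (anchored G L) (u n)\<bar>
      = \<bar>(\<integral>\<omega>. block_fun \<gamma> G (r n) (scale_seq (1 / u n) (path \<omega>)) \<partial>M) / w n - (\<Sum>i\<in>{1..r n}. real i powr \<gamma>) * cE (anchored G L) (u n)\<bar> / R powr (1 + \<gamma>)"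
      by (simp add: abs_divide)
    also have "\<dots> \<le> (C * (real L * real (r n + L) powr \<gamma>) + 2 * C * R powr \<gamma> * (2 * real L) + 2 * C * R powr \<gamma> * (R * clust_prob 1 (Suc L) n)) / R powr (1 + \<gamma>)"
      using block_moment_approx[of n L] unfolding R_def by (intro divide_right_mono) auto
    also have "\<dots> = C * (real L / R) * (1 + real L / R) powr \<gamma> + 4 * C * (real L / R) + 2 * C * clust_prob 1 (Suc L) n"
      unfolding pw Rp using R by (simp add: field_simps)
    finally show ?thesis unfolding R_def .
  qed
  have "(\<lambda>n. a n - s n * \<nu>) \<longlonglongrightarrow> 0"
  proof (rule LIMSEQ_I)
    fix e0 :: real assume "e0 > 0"
    \<comment> \<open>The errors add up to at most (2 C + 3) e: one e for the ends, 2 C e for far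
      exceedances, and 2 e for the window, since \<open>s n\<close> < 2 eventually.\<close>
    define e where "e = e0 / (2 * C + 4)"
    have e: "e > 0" "(2 * C + 4) * e = e0" using \<open>e0 > 0\<close> C0 by (auto simp: e_def)
    obtain L1 where L1: "\<And>L. L \<ge> L1 \<Longrightarrow> \<forall>\<^sub>F n in sequentially. clust_prob 1 L n < e"
      using clust_prob_small[of 1 e] e by auto
    obtain L2 where L2: "\<And>L. L \<ge> L2 \<Longrightarrow> \<forall>\<^sub>F n in sequentially. \<bar>cE (anchored G L) (u n) - \<nu>\<bar> \<le> e"
      using anchored_limit[OF G e(1)] unfolding \<nu>_def by auto
    \<comment> \<open>L is frozen here, before n tends to infinity.\<close>
    define L where "L = max L1 L2"
    have Lr: "(\<lambda>n. real L / real (r n)) \<longlonglongrightarrow> 0"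
      by (rule tendsto_divide_0[OF tendsto_const filterlim_at_top_imp_at_infinity[OF r_real]])
    have "(\<lambda>n. C * (real L / real (r n)) * (1 + real L / real (r n)) powr \<gamma> + 4 * C * (real L / real (r n))) \<longlonglongrightarrow> C * 0 * (1 + 0) powr \<gamma> + 4 * C * 0"
      by (intro tendsto_intros Lr) auto
    then have "\<forall>\<^sub>F n in sequentially. C * (real L / real (r n)) * (1 + real L / real (r n)) powr \<gamma> + 4 * C * (real L / real (r n)) < e"
      using e(1) by (intro order_tendstoD(2)) auto
    moreover have "\<forall>\<^sub>F n in sequentially. clust_prob 1 (Suc L) n < e" by (rule L1) (simp add: L_def)
    moreover have "\<forall>\<^sub>F n in sequentially. \<bar>cE (anchored G L) (u n) - \<nu>\<bar> \<le> e" by (rule L2) (simp add: L_def)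
    moreover have "\<forall>\<^sub>F n in sequentially. s n < 2"
      using s_lim \<gamma> by (intro order_tendstoD(2)) (auto simp: field_simps)
    ultimately have "\<forall>\<^sub>F n in sequentially. norm (a n - s n * \<nu> - 0) < e0"
    proof eventually_elim
      case (elim n)
      have "\<bar>s n * cE (anchored G L) (u n) - s n * \<nu>\<bar> = s n * \<bar>cE (anchored G L) (u n) - \<nu>\<bar>"
        using s0[of n] by (simp add: abs_mult flip: right_diff_distrib)
      also have "\<dots> \<le> 2 * e" using elim s0[of n] by (intro mult_mono) auto
      finally have 1: "\<bar>s n * cE (anchored G L) (u n) - s n * \<nu>\<bar> \<le> 2 * e" .
      have 2: "2 * C * clust_prob 1 (Suc L) n \<le> 2 * C * e" using elim C0 by (intro mult_left_mono) auto
      have "\<bar>a n - s n * \<nu>\<bar> < e + 2 * C * e + 2 * e" using err[of n L] elim(1) 1 2 by linarith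
      also have "\<dots> \<le> e0" using e by (simp add: algebra_simps)
      finally show ?case by simp
    qed
    then show "\<exists>no. \<forall>n\<ge>no. norm (a n - s n * \<nu> - 0) < e0" by (auto simp: eventually_sequentially)
  qed
  moreover have "(\<lambda>n. s n * \<nu>) \<longlonglongrightarrow> 1 / (1 + \<gamma>) * \<nu>" by (intro tendsto_intros s_lim)
  ultimately have "(\<lambda>n. (a n - s n * \<nu>) + s n * \<nu>) \<longlonglongrightarrow> 0 + 1 / (1 + \<gamma>) * \<nu>" by (rule tendsto_add)
  then show ?thesis by (simp add: a_def \<nu>_def)
qed

text \<open>Entries without exceedance at the end of a block influence neither the cluster segment
  nor \<open>Tmax\<close>. Shortening a block therefore matters only on the rare event of an
  exceedance in the removed part.\<close>

lemma block_fun_truncate: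
  assumes "R' \<le> R" "\<And>j. int R' < j \<Longrightarrow> j \<le> int R \<Longrightarrow> N (x j) \<le> 1"
  shows "block_fun \<gamma> G R' x = block_fun \<gamma> G R x"
proof -
  have iff: "N (trunc {1..int R} x j) > 1 \<longleftrightarrow> N (trunc {1..int R'} x j) > 1" for j
    using assms(1) assms(2)[of j] by (auto simp: trunc_def is_norm_zero[OF is_norm])
  have "G (trunc {1..int R} x) = G (trunc {1..int R'} x)"
  proof (rule cluster_functional_eq_shift[OF is_norm G in_l0_trunc in_l0_trunc, where h=0])
    show "N (trunc {1..int R} x (j + 0)) > 1 \<longleftrightarrow> N (trunc {1..int R'} x j) > 1" for j using iff by simp
    show "trunc {1..int R} x (j + 0) = trunc {1..int R'} x j"
      if "N (trunc {1..int R'} x a) > 1" "N (trunc {1..int R'} x b) > 1" "a \<le> j" "j \<le> b" for j a b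
      using that assms(1) by (auto simp: trunc_def is_norm_zero[OF is_norm] split: if_splits)
  qed auto
  then show ?thesis unfolding block_fun_def TmaxG_eq Tmax_def by (simp add: iff)
qed

lemma block_fun_depends_on: "depends_on (\<lambda>x. block_fun \<gamma> G R (scale_seq c x)) {1..int R}"
  unfolding depends_on_def block_fun_def
proof (intro allI impI arg_cong[where f="TmaxG N \<gamma> G"] ext)
  fix x y :: "int \<Rightarrow> real^'d" and k assume "\<forall>k\<in>{1..int R}. x k = y k"
  then show "trunc {1..int R} (scale_seq c x) k = trunc {1..int R} (scale_seq c y) k"
    by (simp add: trunc_def scale_seq_def)
qed

end

end

section \<open>Characteristic functions of the block sums\<close>

lemma norm_iexp_minus_1_power2: "(norm (iexp y - 1))\<^sup>2 = 2 - 2 * Re (iexp y)"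
proof -
  have "(norm (iexp y - 1))\<^sup>2 = (cos y - 1)\<^sup>2 + (sin y)\<^sup>2"
    unfolding cis_conv_exp[symmetric] by (simp add: cmod_power2)
  also have "\<dots> = 2 - 2 * cos y"
    using sin_cos_squared_add[of y] by (simp add: power2_diff)
  finally show ?thesis unfolding cis_conv_exp[symmetric] by simp
qed

text \<open>The mean of |exp(iB) - 1| is controlled by the square root of 2 (1 - Re E exp(iB)).
  Adding B to the exponent is thus harmless as soon as its characteristic function tends to 1, with
  no assumption on the dependence between A and B.\<close>

lemma (in prob_space) char_add_negligible:
  fixes A B :: "nat \<Rightarrow> 'a \<Rightarrow> real"
  assumes [measurable]: "\<And>n. A n \<in> borel_measurable M" "\<And>n. B n \<in> borel_measurable M"
    and A: "(\<lambda>n. \<integral>x. iexp (A n x) \<partial>M) \<longlonglongrightarrow> a" and B: "(\<lambda>n. \<integral>x. iexp (B n x) \<partial>M) \<longlonglongrightarrow> 1"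
  shows "(\<lambda>n. \<integral>x. iexp (A n x + B n x) \<partial>M) \<longlonglongrightarrow> a"
proof -
  define d where "d = (\<lambda>n. \<integral>x. norm (iexp (B n x) - 1) \<partial>M)"
  have int: "integrable M (\<lambda>x. iexp (f x))" if [measurable]: "f \<in> borel_measurable M" for f :: "'a \<Rightarrow> real"
    by (intro integrable_const_bound[where B=1]) auto
  have bnd: "norm (iexp y - 1) \<le> 2" for y
    using norm_triangle_ineq4[of "iexp y" 1] by simp
  have d_sq: "(d n)\<^sup>2 \<le> 2 * (1 - Re (\<integral>x. iexp (B n x) \<partial>M))" for n
  proof -
    have i1: "integrable M (\<lambda>x. norm (iexp (B n x) - 1))"
      using bnd by (intro integrable_const_bound[where B=2]) auto
    have i2: "integrable M (\<lambda>x. (norm (iexp (B n x) - 1))\<^sup>2)"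
      using power_mono[OF bnd norm_ge_zero, of _ 2] by (intro integrable_const_bound[where B="2\<^sup>2"]) auto
    \<comment> \<open>The Cauchy-Schwarz inequality, as nonnegativity of a variance.\<close>
    have "0 \<le> (\<integral>x. (norm (iexp (B n x) - 1))\<^sup>2 \<partial>M) - (d n)\<^sup>2"
      unfolding d_def using variance_positive variance_eq[OF i1 i2] by metis
    also have "(\<integral>x. (norm (iexp (B n x) - 1))\<^sup>2 \<partial>M) = (\<integral>x. 2 - 2 * Re (iexp (B n x)) \<partial>M)"
      by (simp only: norm_iexp_minus_1_power2)
    also have "\<dots> = 2 - 2 * Re (\<integral>x. iexp (B n x) \<partial>M)"
    proof -
      have "integrable M (\<lambda>x. 2 * Re (iexp (B n x)))"
        by (intro integrable_mult_right integrable_Re int) simp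
      then have "(\<integral>x. 2 - 2 * Re (iexp (B n x)) \<partial>M) = 2 - 2 * (\<integral>x. Re (iexp (B n x)) \<partial>M)"
        by (subst Bochner_Integration.integral_diff) (auto simp: prob_space)
      then show ?thesis using integral_bounded_linear[OF bounded_linear_Re int[of "B n"]] by simp
    qed
    finally show ?thesis by simp
  qed
  have "(\<lambda>n. 2 * (1 - Re (\<integral>x. iexp (B n x) \<partial>M))) \<longlonglongrightarrow> 2 * (1 - Re 1)"
    by (intro tendsto_intros B)
  then have "(\<lambda>n. sqrt (2 * (1 - Re (\<integral>x. iexp (B n x) \<partial>M)))) \<longlonglongrightarrow> sqrt 0"
    by (intro tendsto_real_sqrt) simp
  moreover have "norm (d n) \<le> sqrt (2 * (1 - Re (\<integral>x. iexp (B n x) \<partial>M)))" for n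
    using d_sq[of n] by (intro real_le_rsqrt) simp
  ultimately have d0: "d \<longlonglongrightarrow> 0"
    by (intro Lim_null_comparison[of d]) auto
  have "norm ((\<integral>x. iexp (A n x + B n x) \<partial>M) - (\<integral>x. iexp (A n x) \<partial>M)) \<le> d n" for n
  proof -
    have "(\<integral>x. iexp (A n x + B n x) \<partial>M) - (\<integral>x. iexp (A n x) \<partial>M) = (\<integral>x. iexp (A n x + B n x) - iexp (A n x) \<partial>M)"
      by (rule Bochner_Integration.integral_diff[OF int int, symmetric]) measurable
    also have "norm \<dots> \<le> (\<integral>x. norm (iexp (A n x + B n x) - iexp (A n x)) \<partial>M)"
      by (rule integral_norm_bound)
    also have "\<dots> = d n"
    proof -
      have "norm (iexp (A n x + B n x) - iexp (A n x)) = norm (iexp (B n x) - 1)" for x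
      proof -
        have "iexp (A n x + B n x) - iexp (A n x) = iexp (A n x) * (iexp (B n x) - 1)"
          by (simp add: exp_add ring_distribs)
        then show ?thesis by (simp add: norm_mult)
      qed
      then show ?thesis unfolding d_def by simp
    qed
    finally show ?thesis .
  qed
  then have "(\<lambda>n. (\<integral>x. iexp (A n x + B n x) \<partial>M) - (\<integral>x. iexp (A n x) \<partial>M)) \<longlonglongrightarrow> 0"
    by (intro Lim_null_comparison[OF always_eventually d0] allI)
  from tendsto_add[OF this A] show ?thesis by (simp only: diff_add_cancel add_0_left)
qed

text \<open>Convergence in law to the point mass \<open>gauss1 0\<close>, tested on the continuous
  function min 1 (|y| / \<epsilon>), which dominates the indicator of |y| > \<epsilon> and vanishes
  at 0.\<close>

lemma (in prob_space) conv_in_prob_of_char: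
  fixes Z :: "nat \<Rightarrow> 'a \<Rightarrow> real"
  assumes [measurable]: "\<And>n. Z n \<in> borel_measurable M"
    and char1: "\<And>s. (\<lambda>n. \<integral>x. iexp (s * Z n x) \<partial>M) \<longlonglongrightarrow> 1" and "\<epsilon> > 0"
  shows "(\<lambda>n. prob {x\<in>space M. \<bar>Z n x\<bar> > \<epsilon>}) \<longlonglongrightarrow> 0"
proof -
  have rd: "real_distribution (distr M borel (Z n))" for n
    unfolding real_distribution_def real_distribution_axioms_def by (auto intro!: prob_space_distr)
  have "weak_conv_m (\<lambda>n. distr M borel (Z n)) (gauss1 0)"
  proof (intro levy_continuity rd real_distribution_gauss1)
    fix t show "(\<lambda>n. char (distr M borel (Z n)) t) \<longlonglongrightarrow> char (gauss1 0) t"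
      using char1[of t] by (simp add: char_gauss1) (simp add: char_def integral_distr)
  qed simp
  then have "(\<lambda>n. integral\<^sup>L (distr M borel (Z n)) (\<lambda>y. min 1 (\<bar>y\<bar> / \<epsilon>))) \<longlonglongrightarrow> integral\<^sup>L (gauss1 0) (\<lambda>y. min 1 (\<bar>y\<bar> / \<epsilon>))"
    using rd real_distribution_gauss1[of 0] \<open>\<epsilon> > 0\<close>
    by (intro weak_conv_imp_integral_bdd_continuous_conv[where B=1]) (auto intro!: continuous_intros)
  then have lim: "(\<lambda>n. \<integral>x. min 1 (\<bar>Z n x\<bar> / \<epsilon>) \<partial>M) \<longlonglongrightarrow> 0"
    by (simp add: integral_distr gauss1_def integral_return)
  show ?thesis
  proof (rule Lim_null_comparison[OF always_eventually lim], intro allI)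
    fix n
    have "prob {x\<in>space M. \<bar>Z n x\<bar> > \<epsilon>} = (\<integral>x. indicator {x\<in>space M. \<bar>Z n x\<bar> > \<epsilon>} x \<partial>M)"
      by (simp add: Int_absorb2 subset_eq)
    also have "\<dots> \<le> (\<integral>x. min 1 (\<bar>Z n x\<bar> / \<epsilon>) \<partial>M)"
    proof (rule integral_mono)
      show "integrable M (indicat_real {x\<in>space M. \<bar>Z n x\<bar> > \<epsilon>})" by (simp add: emeasure_eq_measure)
      show "integrable M (\<lambda>x. min 1 (\<bar>Z n x\<bar> / \<epsilon>))"
        using \<open>\<epsilon> > 0\<close> by (intro integrable_const_bound[where B=1]) auto
    qed (use \<open>\<epsilon> > 0\<close> in \<open>auto simp: indicator_def\<close>)
    finally show "norm (prob {x\<in>space M. \<bar>Z n x\<bar> > \<epsilon>}) \<le> (\<integral>x. min 1 (\<bar>Z n x\<bar> / \<epsilon>) \<partial>M)" by simp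
  qed
qed

lemma sum_even_odd:
  fixes f :: "nat \<Rightarrow> 'a::comm_monoid_add"
  shows "(\<Sum>j<m. f j) = (\<Sum>j<(m + 1) div 2. f (2 * j)) + (\<Sum>j<m div 2. f (2 * j + 1))"
proof (induction m)
  case (Suc m)
  show ?case
  proof (cases "even m")
    case True
    then obtain k where "m = 2 * k" by (elim evenE)
    then show ?thesis using Suc.IH by (simp add: add_ac)
  next
    case False
    then obtain k where "m = 2 * k + 1" by (elim oddE)
    then show ?thesis using Suc.IH by (simp add: add_ac)
  qed
qed simp

section \<open>The sum over all blocks\<close>

context tail_sequence
begin

lemma block_eq: "block u r X n j \<omega> = trunc {1..int (r n)} (scale_seq (1 / u n) (shift ((int j - 1) * int (r n)) (path \<omega>)))"
  by (auto simp: block_def trunc_def scale_seq_def shift_def path_def add.commute)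

lemma div_r_le: "real (n div r n) \<le> real n / real (r n)"
  by (rule of_nat_div_le_of_nat)

text \<open>If r_n does not divide n, fewer than r_n observations remain, a vanishing share since
  r_n / n tends to 0.\<close>

lemma div_r_lim: "(\<lambda>n. real (n div r n) * real (r n) / real n) \<longlonglongrightarrow> 1"
proof (rule tendsto_sandwich)
  show "(\<lambda>n. 1 - real (r n) / real n) \<longlonglongrightarrow> 1"
    using tendsto_diff[OF tendsto_const[of 1] rn_lim] by simp
  have *: "real n - real (r n) \<le> real (n div r n) * real (r n) \<and> real (n div r n) * real (r n) \<le> real n" for n
  proof -
    have "n div r n * r n + n mod r n = n" by simp
    then have "real (n div r n) * real (r n) + real (n mod r n) = real n" by (metis of_nat_add of_nat_mult)
    moreover have "n mod r n < r n" using r_pos[of n] by simp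
    ultimately show ?thesis by linarith
  qed
  show "\<forall>\<^sub>F n in sequentially. 1 - real (r n) / real n \<le> real (n div r n) * real (r n) / real n"
    using eventually_gt_at_top[of 0]
  proof eventually_elim
    case (elim n)
    then have "1 - real (r n) / real n = (real n - real (r n)) / real n" by (simp add: field_simps)
    also have "\<dots> \<le> real (n div r n) * real (r n) / real n" using * by (intro divide_right_mono) auto
    finally show ?case .
  qed
  show "\<forall>\<^sub>F n in sequentially. real (n div r n) * real (r n) / real n \<le> 1"
    using eventually_gt_at_top[of 0] by eventually_elim (use * in simp)
qed simp

context
  fixes G :: "(int \<Rightarrow> real^'d) \<Rightarrow> real" and C \<gamma> :: real
  assumes G: "cluster_functional N MY Y G C" and \<gamma>: "\<gamma> > 0"
begin

lemmas [measurable] = G_measurable[OF G] block_fun_measurable[OF G]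

lemma TmaxG_block: "TmaxG N \<gamma> G (block u r X n j \<omega>) = block_fun \<gamma> G (r n) (scale_seq (1 / u n) (shift ((int j - 1) * int (r n)) (path \<omega>)))"
  by (simp add: block_eq block_fun_def)

lemma integral_block_fun_shift:
  "(\<integral>\<omega>. block_fun \<gamma> G R (scale_seq c (shift h (path \<omega>))) \<partial>M) = (\<integral>\<omega>. block_fun \<gamma> G R (scale_seq c (path \<omega>)) \<partial>M)"
  by (rule integral_shift[of "\<lambda>x. block_fun \<gamma> G R (scale_seq c x)"]) measurable

lemma integrable_TmaxG_block: "integrable M (\<lambda>\<omega>. TmaxG N \<gamma> G (block u r X n j \<omega>))"
  unfolding TmaxG_block by (rule integrable_block_fun[OF G \<gamma>])

lemma Ln_measurable [measurable]: "Ln N M u r w \<gamma> X G n \<in> borel_measurable M"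
  unfolding Ln_def TmaxG_block by measurable

lemma Ln_eq: "Ln N M u r w \<gamma> X G n \<omega> =
    (\<Sum>j<n div r n. block_fun \<gamma> G (r n) (scale_seq (1 / u n) (shift (int (r n) * int j) (path \<omega>)))
       - (\<integral>\<omega>. block_fun \<gamma> G (r n) (scale_seq (1 / u n) (path \<omega>)) \<partial>M)) / (sqrt (real n * w n) * real (r n) powr \<gamma>)"
  unfolding Ln_def TmaxG_block integral_block_fun_shift
  by (simp add: sum.atLeast1_atMost_eq mult.commute)

text \<open>Each centred block is split into its shortened version V, which leaves gaps of length
  l_n, and the correction D. The total variance of V tends to the claimed value because the squared
  means contribute O(r w) and the shortening O(l / r); the latter also bounds the total variance of
  D.\<close>

lemma block_sum_char_limit:
  fixes a :: "nat \<Rightarrow> real" and l :: "nat \<Rightarrow> nat"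
  assumes a: "a \<longlonglongrightarrow> a0" and lr: "(\<lambda>n. real (l n) / real (r n)) \<longlonglongrightarrow> 0"
    and mix: "(\<lambda>n. real n / real (r n) * beta_mix M X (l n)) \<longlonglongrightarrow> 0"
  shows "(\<lambda>n. \<integral>\<omega>. iexp (s * (a n * Ln N M u r w \<gamma> X G n \<omega>)) \<partial>M)
    \<longlonglongrightarrow> complex_of_real (exp (- (s\<^sup>2 * (a0\<^sup>2 * (nu_star N MY Y (\<lambda>x. (G x)\<^sup>2) / (1 + 2 * \<gamma>)))) / 2))"
proof -
  define m where "m = (\<lambda>n. n div r n)"
  define \<kappa> where "\<kappa> = (\<lambda>n. sqrt (real n * w n) * real (r n) powr \<gamma>)"
  define b where "b = (\<lambda>n. C * real (r n) powr \<gamma>)"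
  \<comment> \<open>\<open>q\<close> counts the dropped entries at the end of the block: 0 for the
    full block and \<open>l n\<close> for the shortened one.\<close>
  define H where "H = (\<lambda>q n x. block_fun \<gamma> G (r n - q) (scale_seq (1 / u n) x))"
  define E where "E = (\<lambda>q n. \<integral>\<omega>. H q n (path \<omega>) \<partial>M)"
  define V where "V = (\<lambda>n x. a n / \<kappa> n * (H (l n) n x - E (l n) n))"
  define D where "D = (\<lambda>n x. a n / \<kappa> n * ((H 0 n x - H (l n) n x) - (E 0 n - E (l n) n)))"
  define \<nu> where "\<nu> = nu_star N MY Y (\<lambda>x. (G x)\<^sup>2) / (1 + 2 * \<gamma>)"
  have C0: "C \<ge> 0" by (rule C_nonneg[OF G])
  have b0: "b n \<ge> 0" for n using C0 by (simp add: b_def)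
  have rp: "real (r n) powr \<gamma> > 0" for n using r_pos[of n] by simp
  have Hm [measurable]: "H q n \<in> borel_measurable seqM" for q n unfolding H_def by measurable
  have [measurable]: "V n \<in> borel_measurable seqM" "D n \<in> borel_measurable seqM" for n
    unfolding V_def D_def by measurable
  have Hb: "\<bar>H q n x\<bar> \<le> b n" for q n x
  proof -
    have "\<bar>H q n x\<bar> \<le> C * real (r n - q) powr \<gamma>" unfolding H_def by (rule block_fun_bound[OF G \<gamma>])
    also have "\<dots> \<le> b n" unfolding b_def using C0 \<gamma> by (intro mult_left_mono powr_mono2) auto
    finally show ?thesis .
  qed
  have Hi: "integrable M (\<lambda>\<omega>. H q n (path \<omega>))" for q n
    using Hb by (intro integrable_const_bound[where B="b n"]) auto
  have Eb: "\<bar>E q n\<bar> \<le> b n" for q n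
  proof -
    have "\<bar>E q n\<bar> \<le> (\<integral>\<omega>. \<bar>H q n (path \<omega>)\<bar> \<partial>M)" unfolding E_def by (rule integral_abs_bound)
    also have "\<dots> \<le> (\<integral>\<omega>. b n \<partial>M)" using Hb Hi by (intro integral_mono) auto
    finally show ?thesis by (simp add: prob_space)
  qed
  have Hdiff: "H q n (path \<omega>) = H 0 n (path \<omega>)"
    if "q \<le> r n" "\<not> (\<exists>j\<in>{int (r n) - int q + 1..int (r n)}. N (X j \<omega>) > u n)" for q n \<omega>
    unfolding H_def using that
  proof (intro block_fun_truncate[OF G \<gamma>, of "r n - q" "r n - 0"])
    fix j assume j: "int (r n - q) < j" "j \<le> int (r n - 0)"
    then have "j \<in> {int (r n) - int q + 1..int (r n)}" using that(1) by auto
    then have "\<not> N (X j \<omega>) > u n" using that(2) by blast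
    then show "N (scale_seq (1 / u n) (path \<omega>) j) \<le> 1" using N_scale_exceed[of n \<omega> j] by linarith
  qed auto
  have Hzero: "H 0 n (path \<omega>) = 0 \<and> H q n (path \<omega>) = 0" if "\<not> (\<exists>j\<in>{1..int (r n)}. N (X j \<omega>) > u n)" for q n \<omega>
  proof -
    have le: "N (scale_seq (1 / u n) (path \<omega>) j) \<le> 1" if "j \<in> {1..int (r n)}" for j
      using N_scale_exceed[of n \<omega> j] \<open>\<not> (\<exists>j\<in>{1..int (r n)}. N (X j \<omega>) > u n)\<close> that by force
    show ?thesis unfolding H_def by (intro conjI block_fun_no_exceed[OF G] le) auto
  qed
  define tl where "tl = (\<lambda>n. {\<omega>\<in>space M. \<exists>j\<in>{int (r n) - int (l n) + 1..int (r n)}. N (X j \<omega>) > u n})"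
  define bl where "bl = (\<lambda>n. {\<omega>\<in>space M. \<exists>j\<in>{1..int (r n)}. N (X j \<omega>) > u n})"
  have [measurable]: "tl n \<in> events" "bl n \<in> events" for n unfolding tl_def bl_def by measurable
  have ptl: "prob (tl n) \<le> real (l n) * w n" for n
    unfolding tl_def using prob_exceed_interval[of "int (r n) - int (l n) + 1" "int (r n)" n] by simp
  have pbl: "prob (bl n) \<le> real (r n) * w n" for n
    unfolding bl_def using prob_exceed_interval[of 1 "int (r n)" n] by simp
  have ind_int: "(\<integral>\<omega>. c * indicator A \<omega> \<partial>M) = c * prob A" "integrable M (\<lambda>\<omega>. c * indicator A \<omega>)"
    if [measurable]: "A \<in> events" for A and c :: real
    using sets.sets_into_space[OF that] by (auto simp: Int_absorb2 emeasure_eq_measure intro!: integrable_mult_right)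
  have sq_b: "y\<^sup>2 \<le> c\<^sup>2" if "\<bar>y\<bar> \<le> c" for y c :: real
    using power_mono[OF that abs_ge_zero, of 2] by simp
  have Hsqi: "integrable M (\<lambda>\<omega>. (H q n (path \<omega>))\<^sup>2)" for q n
    using sq_b[OF Hb] by (intro integrable_const_bound[where B="(b n)\<^sup>2"]) auto
  \<comment> \<open>The two squares differ only when one of the last l_n entries exceeds, an event
    of probability at most l_n w_n.\<close>
  have sq_diff: "\<bar>(\<integral>\<omega>. (H (l n) n (path \<omega>))\<^sup>2 \<partial>M) - (\<integral>\<omega>. (H 0 n (path \<omega>))\<^sup>2 \<partial>M)\<bar> \<le> (b n)\<^sup>2 * (real (l n) * w n)" if "l n \<le> r n" for n
  proof -
    have "\<bar>(\<integral>\<omega>. (H (l n) n (path \<omega>))\<^sup>2 \<partial>M) - (\<integral>\<omega>. (H 0 n (path \<omega>))\<^sup>2 \<partial>M)\<bar>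
      = \<bar>\<integral>\<omega>. (H (l n) n (path \<omega>))\<^sup>2 - (H 0 n (path \<omega>))\<^sup>2 \<partial>M\<bar>"
      by (simp add: Bochner_Integration.integral_diff[OF Hsqi Hsqi])
    also have "\<dots> \<le> (\<integral>\<omega>. \<bar>(H (l n) n (path \<omega>))\<^sup>2 - (H 0 n (path \<omega>))\<^sup>2\<bar> \<partial>M)" by (rule integral_abs_bound)
    also have "\<dots> \<le> (\<integral>\<omega>. (b n)\<^sup>2 * indicator (tl n) \<omega> \<partial>M)"
    proof (rule integral_mono)
      show "integrable M (\<lambda>\<omega>. \<bar>(H (l n) n (path \<omega>))\<^sup>2 - (H 0 n (path \<omega>))\<^sup>2\<bar>)"
        by (intro integrable_abs Bochner_Integration.integrable_diff Hsqi)
      fix \<omega> assume w: "\<omega> \<in> space M"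
      show "\<bar>(H (l n) n (path \<omega>))\<^sup>2 - (H 0 n (path \<omega>))\<^sup>2\<bar> \<le> (b n)\<^sup>2 * indicator (tl n) \<omega>"
      proof (cases "\<omega> \<in> tl n")
        case True
        have "0 \<le> (H (l n) n (path \<omega>))\<^sup>2" "0 \<le> (H 0 n (path \<omega>))\<^sup>2" by auto
        then have "\<bar>(H (l n) n (path \<omega>))\<^sup>2 - (H 0 n (path \<omega>))\<^sup>2\<bar> \<le> (b n)\<^sup>2"
          using sq_b[OF Hb[of "l n" n "path \<omega>"]] sq_b[OF Hb[of 0 n "path \<omega>"]] by linarith
        then show ?thesis using True by simp
      next
        case False
        then show ?thesis using Hdiff[OF that, of \<omega>] w by (simp add: tl_def)
      qed
    qed (rule ind_int(2), measurable)
    also have "\<dots> = (b n)\<^sup>2 * prob (tl n)" by (simp add: ind_int)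
    also have "\<dots> \<le> (b n)\<^sup>2 * (real (l n) * w n)" using ptl by (intro mult_left_mono) auto
    finally show ?thesis .
  qed
  \<comment> \<open>A block functional vanishes without an exceedance in the block, which makes the
    mean smaller than the trivial bound by a factor r w.\<close>
  have Esmall: "\<bar>E q n\<bar> \<le> b n * (real (r n) * w n)" for q n
  proof -
    have "\<bar>E q n\<bar> \<le> (\<integral>\<omega>. \<bar>H q n (path \<omega>)\<bar> \<partial>M)" unfolding E_def by (rule integral_abs_bound)
    also have "\<dots> \<le> (\<integral>\<omega>. b n * indicator (bl n) \<omega> \<partial>M)"
    proof (rule integral_mono)
      show "integrable M (\<lambda>\<omega>. \<bar>H q n (path \<omega>)\<bar>)" by (intro integrable_abs Hi)
      fix \<omega> assume w: "\<omega> \<in> space M"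
      show "\<bar>H q n (path \<omega>)\<bar> \<le> b n * indicator (bl n) \<omega>"
        using Hb[of q n "path \<omega>"] Hzero[of n \<omega> q] w by (cases "\<omega> \<in> bl n") (auto simp: bl_def)
    qed (rule ind_int(2), measurable)
    also have "\<dots> = b n * prob (bl n)" by (simp add: ind_int)
    also have "\<dots> \<le> b n * (real (r n) * w n)" using pbl b0 by (intro mult_left_mono) auto
    finally show ?thesis .
  qed
  have pw2: "(x powr \<gamma>)\<^sup>2 = x powr (2 * \<gamma>)" for x :: real
    by (simp only: power2_eq_square powr_add[symmetric] mult_2)
  have mom2: "(\<lambda>n. (\<integral>\<omega>. (H 0 n (path \<omega>))\<^sup>2 \<partial>M) / (real (r n) powr (1 + 2 * \<gamma>) * w n)) \<longlonglongrightarrow> \<nu>"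
  proof -
    have "(H 0 n x)\<^sup>2 = block_fun (2 * \<gamma>) (\<lambda>x. (G x)\<^sup>2) (r n) (scale_seq (1 / u n) x)" for n x
      unfolding H_def block_fun_def TmaxG_eq power_mult_distrib pw2 by simp
    then show ?thesis
      using block_moment_limit[OF cluster_functional_square[OF G], of "2 * \<gamma>"] \<gamma> by (simp add: \<nu>_def)
  qed
  have \<kappa>2: "(\<kappa> n)\<^sup>2 = real n * w n * real (r n) powr (2 * \<gamma>)" for n
    unfolding \<kappa>_def power_mult_distrib pw2 using w_pos[of n] by simp
  have b2: "(b n)\<^sup>2 = C\<^sup>2 * real (r n) powr (2 * \<gamma>)" for n
    unfolding b_def power_mult_distrib pw2 ..
  have rp2: "real (r n) powr (2 * \<gamma>) > 0" for n using r_pos[of n] by simp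
  have rpos: "real (r n) > 0" for n using r_pos[of n] by simp
  have mr_le: "real (m n) * real (r n) \<le> real n" for n
    using div_r_le[of n] rpos[of n] unfolding m_def by (simp add: field_simps)
  have nw: "filterlim (\<lambda>n. sqrt (real n * w n)) at_top sequentially"
    by (rule filterlim_compose[OF sqrt_at_top nw_lim])
  have b\<kappa>: "b n / \<kappa> n = C / sqrt (real n * w n)" for n
    unfolding b_def \<kappa>_def using rp[of n] by simp
  have e_lim: "(\<lambda>n. K * \<bar>a n\<bar> * (C / sqrt (real n * w n))) \<longlonglongrightarrow> 0" for K
  proof -
    have "(\<lambda>n. K * \<bar>a n\<bar> * (C / sqrt (real n * w n))) \<longlonglongrightarrow> K * \<bar>a0\<bar> * 0"
      by (intro tendsto_intros a tendsto_divide_0[OF tendsto_const filterlim_at_top_imp_at_infinity[OF nw]])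
    then show ?thesis by simp
  qed
  have scaled_bound: "\<bar>a n / \<kappa> n * y\<bar> \<le> K * \<bar>a n\<bar> * (C / sqrt (real n * w n))" if "\<bar>y\<bar> \<le> K * b n" for n y K
  proof -
    have k0: "\<kappa> n \<ge> 0" unfolding \<kappa>_def using w_pos[of n] by simp
    have "\<bar>a n / \<kappa> n * y\<bar> = \<bar>a n\<bar> / \<kappa> n * \<bar>y\<bar>" using k0 by (simp add: abs_mult abs_divide)
    also have "\<dots> \<le> \<bar>a n\<bar> / \<kappa> n * (K * b n)" using that k0 by (intro mult_left_mono) auto
    also have "\<dots> = K * \<bar>a n\<bar> * (b n / \<kappa> n)" by simp
    finally show ?thesis unfolding b\<kappa> .
  qed
  have l_le: "\<forall>\<^sub>F n in sequentially. l n \<le> r n"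
  proof -
    have "\<forall>\<^sub>F n in sequentially. real (l n) / real (r n) < 1" using lr by (rule order_tendstoD) simp
    then show ?thesis by eventually_elim (use rpos in \<open>simp add: field_simps\<close>)
  qed
  have mixm: "(\<lambda>n. real (k n) * beta_mix M X (l n)) \<longlonglongrightarrow> 0" if "\<And>n. k n \<le> m n" for k
  proof (rule Lim_null_comparison[OF always_eventually mix], intro allI)
    fix n
    have "real (k n) \<le> real n / real (r n)" using that[of n] div_r_le[of n] unfolding m_def by linarith
    from mult_right_mono[OF this beta_mix_nonneg[of "l n"]]
    show "norm (real (k n) * beta_mix M X (l n)) \<le> real n / real (r n) * beta_mix M X (l n)"
      using beta_mix_nonneg[of "l n"] by (simp only: real_norm_def abs_mult abs_of_nat abs_of_nonneg)
  qed
  have var_id: "(\<integral>\<omega>. (c * (Z \<omega> - (\<integral>\<omega>. Z \<omega> \<partial>M)))\<^sup>2 \<partial>M) = c\<^sup>2 * ((\<integral>\<omega>. (Z \<omega>)\<^sup>2 \<partial>M) - (\<integral>\<omega>. Z \<omega> \<partial>M)\<^sup>2)"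
    if "integrable M Z" "integrable M (\<lambda>\<omega>. (Z \<omega>)\<^sup>2)" for Z and c :: real
    unfolding power_mult_distrib by (simp add: variance_eq[OF that])

  have V_lim: "(\<lambda>n. \<integral>\<omega>. iexp (s * (\<Sum>j<m n. V n (shift (0 + int (r n) * int j) (path \<omega>)))) \<partial>M)
    \<longlonglongrightarrow> complex_of_real (exp (- (s\<^sup>2 * (a0\<^sup>2 * \<nu>)) / 2))"
  proof (rule clt_blocks[where p="\<lambda>_. 0" and e="\<lambda>n. 2 * \<bar>a n\<bar> * (C / sqrt (real n * w n))"])
    show "\<forall>\<^sub>F n in sequentially. depends_on (V n) {1..int (r n) - int (l n)}"
      using l_le
    proof eventually_elim
      case (elim n)
      then have "int (r n - l n) = int (r n) - int (l n)" by simp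
      then have "depends_on (H (l n) n) {1..int (r n) - int (l n)}"
        using block_fun_depends_on[OF G \<gamma>, of "r n - l n" "1 / u n"] unfolding H_def by simp
      then show ?case unfolding V_def depends_on_def by metis
    qed
    show "\<bar>V n x\<bar> \<le> 2 * \<bar>a n\<bar> * (C / sqrt (real n * w n))" for n x
      unfolding V_def using Hb[of "l n" n x] Eb[of "l n" n] by (intro scaled_bound) linarith
    show "(\<integral>\<omega>. V n (path \<omega>) \<partial>M) = 0" for n
      unfolding V_def using Hi by (simp add: E_def prob_space)
    show "(\<lambda>n. real (m n) * (\<integral>\<omega>. (V n (path \<omega>))\<^sup>2 \<partial>M)) \<longlonglongrightarrow> a0\<^sup>2 * \<nu>"
    proof -
      \<comment> \<open>T1 is the second moment of full blocks, T2 the effect of shortening them,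
        and T3 the squared mean.\<close>
      define T1 where "T1 = (\<lambda>n. real (m n) * real (r n) / real n * ((\<integral>\<omega>. (H 0 n (path \<omega>))\<^sup>2 \<partial>M) / (real (r n) powr (1 + 2 * \<gamma>) * w n)))"
      define T2 where "T2 = (\<lambda>n. real (m n) / (\<kappa> n)\<^sup>2 * ((\<integral>\<omega>. (H (l n) n (path \<omega>))\<^sup>2 \<partial>M) - (\<integral>\<omega>. (H 0 n (path \<omega>))\<^sup>2 \<partial>M)))"
      define T3 where "T3 = (\<lambda>n. real (m n) / (\<kappa> n)\<^sup>2 * (E (l n) n)\<^sup>2)"
      have eq: "real (m n) * (\<integral>\<omega>. (V n (path \<omega>))\<^sup>2 \<partial>M) = (a n)\<^sup>2 * (T1 n + T2 n - T3 n)" for n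
      proof -
        have "(\<integral>\<omega>. (V n (path \<omega>))\<^sup>2 \<partial>M) = (a n / \<kappa> n)\<^sup>2 * ((\<integral>\<omega>. (H (l n) n (path \<omega>))\<^sup>2 \<partial>M) - (E (l n) n)\<^sup>2)"
          unfolding V_def E_def by (rule var_id[OF Hi Hsqi])
        moreover have "T1 n = real (m n) / (\<kappa> n)\<^sup>2 * (\<integral>\<omega>. (H 0 n (path \<omega>))\<^sup>2 \<partial>M)"
        proof -
          have "real (r n) powr (1 + 2 * \<gamma>) = real (r n) * real (r n) powr (2 * \<gamma>)" using rpos[of n] by (simp add: powr_add)
          then show ?thesis unfolding T1_def \<kappa>2 using rpos[of n] by simp
        qed
        ultimately show ?thesis unfolding T2_def T3_def by (simp only: power_divide) (simp add: algebra_simps)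
      qed
      have T1: "T1 \<longlonglongrightarrow> 1 * \<nu>"
        unfolding T1_def m_def by (intro tendsto_mult div_r_lim mom2)
      have T2: "T2 \<longlonglongrightarrow> 0"
      proof (rule Lim_null_comparison)
        show "(\<lambda>n. C\<^sup>2 * (real (l n) / real (r n))) \<longlonglongrightarrow> 0" using tendsto_mult_left[OF lr, of "C\<^sup>2"] by simp
        show "\<forall>\<^sub>F n in sequentially. norm (T2 n) \<le> C\<^sup>2 * (real (l n) / real (r n))"
          using l_le eventually_gt_at_top[of 0]
        proof eventually_elim
          case (elim n)
          have "norm (T2 n) \<le> real (m n) / (\<kappa> n)\<^sup>2 * ((b n)\<^sup>2 * (real (l n) * w n))"
            unfolding T2_def real_norm_def abs_mult using sq_diff[OF elim(1)] by (intro mult_mono) auto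
          also have "\<dots> = C\<^sup>2 * (real (l n) * (real (m n) / real n))"
            unfolding \<kappa>2 b2 using rp2[of n] w_pos[of n] elim(2) by (simp add: field_simps)
          also have "\<dots> \<le> C\<^sup>2 * (real (l n) * (1 / real (r n)))"
            using mr_le[of n] rpos[of n] elim(2) by (intro mult_left_mono) (auto simp: field_simps)
          finally show ?case by simp
        qed
      qed
      have T3: "T3 \<longlonglongrightarrow> 0"
      proof (rule Lim_null_comparison)
        show "(\<lambda>n. C\<^sup>2 * (real (r n) * w n)) \<longlonglongrightarrow> 0" using tendsto_mult_left[OF rw_lim, of "C\<^sup>2"] by simp
        show "\<forall>\<^sub>F n in sequentially. norm (T3 n) \<le> C\<^sup>2 * (real (r n) * w n)"
          using eventually_gt_at_top[of 0]
        proof eventually_elim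
          case (elim n)
          have "norm (T3 n) \<le> real (m n) / (\<kappa> n)\<^sup>2 * (b n * (real (r n) * w n))\<^sup>2"
            unfolding T3_def real_norm_def abs_mult using sq_b[OF Esmall[of "l n" n]] by (intro mult_mono) auto
          also have "\<dots> = C\<^sup>2 * (real (r n) * w n) * (real (m n) * real (r n) / real n)"
            unfolding \<kappa>2 power_mult_distrib b2 using rp2[of n] w_pos[of n] elim by (simp add: field_simps power2_eq_square)
          also have "\<dots> \<le> C\<^sup>2 * (real (r n) * w n) * 1"
            using mr_le[of n] w_pos[of n] elim by (intro mult_left_mono) auto
          finally show ?case by simp
        qed
      qed
      have "(\<lambda>n. (a n)\<^sup>2 * (T1 n + T2 n - T3 n)) \<longlonglongrightarrow> a0\<^sup>2 * (1 * \<nu> + 0 - 0)"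
        by (intro tendsto_intros a T1 T2 T3)
      then show ?thesis by (simp add: eq)
    qed
    show "(\<lambda>n. real (m n) * beta_mix M X (l n)) \<longlonglongrightarrow> 0" by (rule mixm) simp
  qed (use e_lim[of 2] in auto)

  \<comment> \<open>D depends on a full block, so neighbouring corrections have no gap. With period
    2 r and entries 1 to r, the gap is r and at least l; the central limit theorem with limit
    variance 0 then applies at any offset \<open>p\<close>.\<close>
  have D_lim: "(\<lambda>n. \<integral>\<omega>. iexp (s * (\<Sum>j<k n. D n (shift (p n + int (2 * r n) * int j) (path \<omega>)))) \<partial>M) \<longlonglongrightarrow> 1"
    if k: "\<And>n. k n \<le> m n" for k and p :: "nat \<Rightarrow> int"
  proof -
    have "(\<lambda>n. \<integral>\<omega>. iexp (s * (\<Sum>j<k n. D n (shift (p n + int (2 * r n) * int j) (path \<omega>)))) \<partial>M)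
      \<longlonglongrightarrow> complex_of_real (exp (- (s\<^sup>2 * 0) / 2))"
    proof (rule clt_blocks[where l=l and e="\<lambda>n. 4 * \<bar>a n\<bar> * (C / sqrt (real n * w n))"])
      show "\<forall>\<^sub>F n in sequentially. depends_on (D n) {1..int (2 * r n) - int (l n)}"
        using l_le
      proof eventually_elim
        case (elim n)
        have "depends_on (H q n) {1..int (2 * r n) - int (l n)}" for q
          using block_fun_depends_on[OF G \<gamma>, of "r n - q" "1 / u n"] unfolding H_def
          by (rule depends_on_mono) (use elim in auto)
        then show ?case unfolding D_def depends_on_def by metis
      qed
      show "\<bar>D n x\<bar> \<le> 4 * \<bar>a n\<bar> * (C / sqrt (real n * w n))" for n x
        unfolding D_def using Hb[of "l n" n x] Eb[of "l n" n] Hb[of 0 n x] Eb[of 0 n] by (intro scaled_bound) linarith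
      show "(\<integral>\<omega>. D n (path \<omega>) \<partial>M) = 0" for n
        unfolding D_def using Hi by (simp add: E_def prob_space)
      show "(\<lambda>n. real (k n) * (\<integral>\<omega>. (D n (path \<omega>))\<^sup>2 \<partial>M)) \<longlonglongrightarrow> 0"
      proof (rule Lim_null_comparison)
        have "(\<lambda>n. (a n)\<^sup>2 * (4 * C\<^sup>2) * (real (l n) / real (r n))) \<longlonglongrightarrow> a0\<^sup>2 * (4 * C\<^sup>2) * 0"
          by (intro tendsto_intros a lr)
        then show "(\<lambda>n. (a n)\<^sup>2 * (4 * C\<^sup>2) * (real (l n) / real (r n))) \<longlonglongrightarrow> 0" by simp
        show "\<forall>\<^sub>F n in sequentially. norm (real (k n) * (\<integral>\<omega>. (D n (path \<omega>))\<^sup>2 \<partial>M)) \<le> (a n)\<^sup>2 * (4 * C\<^sup>2) * (real (l n) / real (r n))"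
          using l_le eventually_gt_at_top[of 0]
        proof eventually_elim
          case (elim n)
          define Z where "Z = (\<lambda>\<omega>. H 0 n (path \<omega>) - H (l n) n (path \<omega>))"
          have [measurable]: "Z \<in> borel_measurable M" unfolding Z_def by measurable
          have Zb: "\<bar>Z \<omega>\<bar> \<le> 2 * b n" for \<omega> unfolding Z_def using Hb[of 0 n "path \<omega>"] Hb[of "l n" n "path \<omega>"] by linarith
          have Zi: "integrable M Z" "integrable M (\<lambda>\<omega>. (Z \<omega>)\<^sup>2)"
            using Zb sq_b[OF Zb] by (auto intro: integrable_const_bound[where B="2 * b n"] integrable_const_bound[where B="(2 * b n)\<^sup>2"])
          have ZE: "(\<integral>\<omega>. Z \<omega> \<partial>M) = E 0 n - E (l n) n" unfolding Z_def E_def using Hi by simp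
          have "(\<integral>\<omega>. (D n (path \<omega>))\<^sup>2 \<partial>M) = (a n / \<kappa> n)\<^sup>2 * ((\<integral>\<omega>. (Z \<omega>)\<^sup>2 \<partial>M) - (\<integral>\<omega>. Z \<omega> \<partial>M)\<^sup>2)"
            using var_id[OF Zi, of "a n / \<kappa> n"] unfolding D_def ZE by (simp add: Z_def)
          also have "\<dots> \<le> (a n / \<kappa> n)\<^sup>2 * (\<integral>\<omega>. (Z \<omega>)\<^sup>2 \<partial>M)" by (intro mult_left_mono) auto
          \<comment> \<open>The correction vanishes unless one of the last \<open>l n\<close>
            entries exceeds.\<close>
          also have "(\<integral>\<omega>. (Z \<omega>)\<^sup>2 \<partial>M) \<le> (\<integral>\<omega>. (2 * b n)\<^sup>2 * indicator (tl n) \<omega> \<partial>M)"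
          proof (rule integral_mono)
            fix \<omega> assume w: "\<omega> \<in> space M"
            show "(Z \<omega>)\<^sup>2 \<le> (2 * b n)\<^sup>2 * indicator (tl n) \<omega>"
              using sq_b[OF Zb[of \<omega>]] Hdiff[OF elim(1), of \<omega>] w by (cases "\<omega> \<in> tl n") (auto simp: tl_def Z_def)
          qed (rule Zi(2), rule ind_int(2), measurable)
          also have "(\<integral>\<omega>. (2 * b n)\<^sup>2 * indicator (tl n) \<omega> \<partial>M) = (2 * b n)\<^sup>2 * prob (tl n)" by (simp add: ind_int)
          also have "\<dots> \<le> (2 * b n)\<^sup>2 * (real (l n) * w n)" using ptl by (intro mult_left_mono) auto
          finally have D2: "(\<integral>\<omega>. (D n (path \<omega>))\<^sup>2 \<partial>M) \<le> (a n / \<kappa> n)\<^sup>2 * ((2 * b n)\<^sup>2 * (real (l n) * w n))"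
            by (simp add: mult_left_mono)
          have "norm (real (k n) * (\<integral>\<omega>. (D n (path \<omega>))\<^sup>2 \<partial>M)) = real (k n) * (\<integral>\<omega>. (D n (path \<omega>))\<^sup>2 \<partial>M)" by simp
          also have "\<dots> \<le> real (m n) * ((a n / \<kappa> n)\<^sup>2 * ((2 * b n)\<^sup>2 * (real (l n) * w n)))"
            using k[of n] D2 by (intro mult_mono) auto
          also have "\<dots> = (a n)\<^sup>2 * (4 * C\<^sup>2) * (real (l n) * (real (m n) / real n))"
            unfolding power_divide power_mult_distrib \<kappa>2 b2 using rp2[of n] w_pos[of n] elim(2) by simp
          also have "\<dots> \<le> (a n)\<^sup>2 * (4 * C\<^sup>2) * (real (l n) * (1 / real (r n)))"
            using mr_le[of n] rpos[of n] elim(2) by (intro mult_left_mono) (auto simp: field_simps)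
          finally show ?case by simp
        qed
      qed
      show "(\<lambda>n. real (k n) * beta_mix M X (l n)) \<longlonglongrightarrow> 0" by (rule mixm[OF k])
    qed (use e_lim[of 4] in auto)
    then show ?thesis by simp
  qed
  \<comment> \<open>The blocks with even index have offset 0, those with odd index offset r.\<close>
  have decomp: "a n * Ln N M u r w \<gamma> X G n \<omega> = (\<Sum>j<m n. V n (shift (0 + int (r n) * int j) (path \<omega>)))
      + (\<Sum>j<(m n + 1) div 2. D n (shift (0 + int (2 * r n) * int j) (path \<omega>)))
      + (\<Sum>j<m n div 2. D n (shift (int (r n) + int (2 * r n) * int j) (path \<omega>)))" for n \<omega>
  proof -
    have VD: "V n x + D n x = a n / \<kappa> n * (H 0 n x - E 0 n)" for x
      unfolding V_def D_def by (simp add: algebra_simps)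
    have "a n * Ln N M u r w \<gamma> X G n \<omega> = (\<Sum>j<m n. V n (shift (int (r n) * int j) (path \<omega>)) + D n (shift (int (r n) * int j) (path \<omega>)))"
      unfolding Ln_eq VD H_def E_def \<kappa>_def m_def sum_distrib_left[symmetric] by simp
    also have "\<dots> = (\<Sum>j<m n. V n (shift (int (r n) * int j) (path \<omega>))) + (\<Sum>j<m n. D n (shift (int (r n) * int j) (path \<omega>)))"
      by (rule sum.distrib)
    also have "(\<Sum>j<m n. D n (shift (int (r n) * int j) (path \<omega>)))
      = (\<Sum>j<(m n + 1) div 2. D n (shift (int (r n) * int (2 * j)) (path \<omega>))) + (\<Sum>j<m n div 2. D n (shift (int (r n) * int (2 * j + 1)) (path \<omega>)))"
      by (rule sum_even_odd)
    finally show ?thesis by (simp add: algebra_simps)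
  qed
  have D1: "(\<lambda>n. \<integral>\<omega>. iexp (s * (\<Sum>j<(m n + 1) div 2. D n (shift (0 + int (2 * r n) * int j) (path \<omega>)))) \<partial>M) \<longlonglongrightarrow> 1"
    by (rule D_lim) linarith
  have D2: "(\<lambda>n. \<integral>\<omega>. iexp (s * (\<Sum>j<m n div 2. D n (shift (int (r n) + int (2 * r n) * int j) (path \<omega>)))) \<partial>M) \<longlonglongrightarrow> 1"
    by (rule D_lim) simp
  have "(\<lambda>n. \<integral>\<omega>. iexp ((s * (\<Sum>j<m n. V n (shift (0 + int (r n) * int j) (path \<omega>)))
      + s * (\<Sum>j<(m n + 1) div 2. D n (shift (0 + int (2 * r n) * int j) (path \<omega>))))
      + s * (\<Sum>j<m n div 2. D n (shift (int (r n) + int (2 * r n) * int j) (path \<omega>)))) \<partial>M)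
    \<longlonglongrightarrow> complex_of_real (exp (- (s\<^sup>2 * (a0\<^sup>2 * \<nu>)) / 2))"
    by (rule char_add_negligible[OF _ _ char_add_negligible[OF _ _ V_lim D1] D2]) measurable
  then show ?thesis unfolding decomp \<nu>_def ring_distribs .
qed

end

end

section \<open>Finite-dimensional limits\<close>

lemma inH0_cluster_functional:
  assumes "inH0 N MY Y G" shows "\<exists>C. cluster_functional N MY Y G C"
proof -
  obtain C where "\<forall>x. in_l0 x \<longrightarrow> G x \<le> C" using assms unfolding inH0_def by blast
  moreover have "\<forall>x. in_l0 x \<longrightarrow> 0 \<le> G x" using assms unfolding inH0_def by blast
  ultimately have "\<forall>x. in_l0 x \<longrightarrow> \<bar>G x\<bar> \<le> C" by simp
  then have "cluster_functional N MY Y G C" using assms unfolding inH0_def cluster_functional_def by simp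
  then show ?thesis ..
qed

lemma cluster_functional_sum:
  assumes "finite I" "\<And>i. i \<in> I \<Longrightarrow> cluster_functional N MY Y (Gs i) (Cs i)"
  shows "cluster_functional N MY Y (\<lambda>x. \<Sum>i\<in>I. t i * Gs i x) (\<Sum>i\<in>I. \<bar>t i\<bar> * Cs i)"
  using assms
proof (induction I rule: finite_induct)
  case empty
  show ?case by (auto simp: cluster_functional_def cont_l0_def intro: exI[of _ 1])
next
  case (insert i I)
  then show ?case by (simp add: cluster_functional_add cluster_functional_cmult)
qed

context tail_sequence
begin

text \<open>Identifies the limit variance of a linear combination with the quadratic form of the
  claimed covariance; as the integral of a square it also shows that this form is
  nonnegative.\<close>

lemma nu_star_quadratic:
  fixes Gs :: "'k::finite \<Rightarrow> (int \<Rightarrow> real^'d) \<Rightarrow> real"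
  assumes Gs: "\<And>a. cluster_functional N MY Y (Gs a) (Cs a)"
  shows "(\<Sum>a\<in>UNIV. \<Sum>b\<in>UNIV. t a * nu_star N MY Y (\<lambda>x. Gs a x * Gs b x) * t b)
    = nu_star N MY Y (\<lambda>x. (\<Sum>a\<in>UNIV. t a * Gs a x)\<^sup>2)"
proof -
  define ind where "ind = (indicator {\<eta>\<in>space MY. \<forall>j<0. N (Y j \<eta>) \<le> 1} :: 'e \<Rightarrow> real)"
  have [measurable]: "ind \<in> borel_measurable MY" unfolding ind_def by measurable
  note [measurable] = G_measurable[OF Gs]
  have int: "integrable MY (\<lambda>\<eta>. Gs a (\<lambda>j. Y j \<eta>) * Gs b (\<lambda>j. Y j \<eta>) * ind \<eta>)" for a b
  proof (rule MY.integrable_const_bound[where B="Cs a * Cs b"])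
    show "AE \<eta> in MY. norm (Gs a (\<lambda>j. Y j \<eta>) * Gs b (\<lambda>j. Y j \<eta>) * ind \<eta>) \<le> Cs a * Cs b"
      \<comment> \<open>The functionals are bounded on sequences tending to 0 only, so the bound on
        the integrand holds almost surely.\<close>
      using AE_Y_in_l0
    proof eventually_elim
      case (elim \<eta>)
      have "\<bar>Gs a (\<lambda>j. Y j \<eta>)\<bar> * \<bar>Gs b (\<lambda>j. Y j \<eta>)\<bar> \<le> Cs a * Cs b"
        using G_bound[OF Gs elim] C_nonneg[OF Gs] by (intro mult_mono) auto
      then show ?case using C_nonneg[OF Gs] by (auto simp: ind_def indicator_def abs_mult)
    qed
  qed measurable
  have "nu_star N MY Y (\<lambda>x. (\<Sum>a\<in>UNIV. t a * Gs a x)\<^sup>2)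
    = (\<integral>\<eta>. (\<Sum>a\<in>UNIV. \<Sum>b\<in>UNIV. (t a * t b) * (Gs a (\<lambda>j. Y j \<eta>) * Gs b (\<lambda>j. Y j \<eta>) * ind \<eta>)) \<partial>MY)"
    unfolding nu_star_def ind_def power2_eq_square sum_product
    by (intro Bochner_Integration.integral_cong refl) (simp add: sum_distrib_left sum_distrib_right mult_ac)
  also have "\<dots> = (\<Sum>a\<in>UNIV. \<Sum>b\<in>UNIV. (t a * t b) * nu_star N MY Y (\<lambda>x. Gs a x * Gs b x))"
    unfolding nu_star_def ind_def[symmetric]
    by (simp only: Bochner_Integration.integral_sum Bochner_Integration.integrable_sum integrable_mult_right int integral_mult_right_zero)
  finally show ?thesis by (simp add: mult_ac)
qed

text \<open>\<open>Tmax\<close> depends on the block alone, so \<open>TmaxG\<close> is linear in G.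
  Projections of the limit vector thereby become block sums of a single functional.\<close>

lemma Ln_sum:
  fixes Gs :: "'k::finite \<Rightarrow> (int \<Rightarrow> real^'d) \<Rightarrow> real"
  assumes Gs: "\<And>a. cluster_functional N MY Y (Gs a) (Cs a)" and \<gamma>: "\<gamma> > 0"
  shows "Ln N M u r w \<gamma> X (\<lambda>x. \<Sum>a\<in>UNIV. t a * Gs a x) n \<omega> = (\<Sum>a\<in>UNIV. t a * Ln N M u r w \<gamma> X (Gs a) n \<omega>)"
proof -
  define \<kappa> where "\<kappa> = sqrt (real n * w n) * real (r n) powr \<gamma>"
  define T where "T = (\<lambda>a j \<omega>. TmaxG N \<gamma> (Gs a) (block u r X n j \<omega>))"
  have T: "TmaxG N \<gamma> (\<lambda>x. \<Sum>a\<in>UNIV. t a * Gs a x) (block u r X n j \<omega>) = (\<Sum>a\<in>UNIV. t a * T a j \<omega>)" for j \<omega>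
    unfolding T_def TmaxG_eq by (simp add: sum_distrib_left mult_ac)
  have int: "(\<integral>\<omega>. (\<Sum>a\<in>UNIV. t a * T a j \<omega>) \<partial>M) = (\<Sum>a\<in>UNIV. t a * (\<integral>\<omega>. T a j \<omega> \<partial>M))" for j
    using integrable_TmaxG_block[OF Gs \<gamma>] unfolding T_def
    by (subst Bochner_Integration.integral_sum) auto
  have "Ln N M u r w \<gamma> X (\<lambda>x. \<Sum>a\<in>UNIV. t a * Gs a x) n \<omega>
     = (\<Sum>j=1..n div r n. \<Sum>a\<in>UNIV. t a * (T a j \<omega> - (\<integral>\<omega>. T a j \<omega> \<partial>M))) / \<kappa>"
    unfolding Ln_def T int \<kappa>_def by (simp add: sum_subtractf right_diff_distrib)
  also have "\<dots> = (\<Sum>a\<in>UNIV. t a * ((\<Sum>j=1..n div r n. T a j \<omega> - (\<integral>\<omega>. T a j \<omega> \<partial>M)) / \<kappa>))"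
    by (subst sum.swap) (simp add: sum_divide_distrib sum_distrib_left)
  finally show ?thesis unfolding Ln_def T_def \<kappa>_def .
qed

text \<open>Split into mean and centred part: the mean converges by
  \<open>block_moment_limit\<close>, and the centred part is \<open>Ln\<close> divided by sqrt(n
  w_n), hence negligible by the limit theorem with a factor tending to 0.\<close>

lemma nu_tt_conv_in_prob:
  assumes G: "cluster_functional N MY Y G C" and \<gamma>: "\<gamma> > 0"
    and lr: "(\<lambda>n. real (l n) / real (r n)) \<longlonglongrightarrow> 0"
    and mix: "(\<lambda>n. real n / real (r n) * beta_mix M X (l n)) \<longlonglongrightarrow> 0"
  shows "conv_in_prob M (nu_tt u r w \<gamma> X (TmaxG N \<gamma> G)) (nu_star N MY Y G / (1 + \<gamma>))"
  unfolding conv_in_prob_def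
proof (intro allI impI)
  fix \<epsilon> :: real assume "\<epsilon> > 0"
  define c where "c = nu_star N MY Y G / (1 + \<gamma>)"
  define E where "E = (\<lambda>n. \<integral>\<omega>. block_fun \<gamma> G (r n) (scale_seq (1 / u n) (path \<omega>)) \<partial>M)"
  define b where "b = (\<lambda>n. real (n div r n) * real (r n) / real n * (E n / (real (r n) powr (1 + \<gamma>) * w n)))"
  define Z where "Z = (\<lambda>n \<omega>. 1 / sqrt (real n * w n) * Ln N M u r w \<gamma> X G n \<omega>)"
  have [measurable]: "Z n \<in> borel_measurable M" for n
    unfolding Z_def using Ln_measurable[OF G \<gamma>] by measurable
  have nw: "filterlim (\<lambda>n. sqrt (real n * w n)) at_top sequentially"
    by (rule filterlim_compose[OF sqrt_at_top nw_lim])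
  have "(\<lambda>n. 1 / sqrt (real n * w n)) \<longlonglongrightarrow> 0"
    by (rule tendsto_divide_0[OF tendsto_const filterlim_at_top_imp_at_infinity[OF nw]])
  from block_sum_char_limit[OF G \<gamma> this lr mix]
  have "(\<lambda>n. \<integral>\<omega>. iexp (s * Z n \<omega>) \<partial>M) \<longlonglongrightarrow> 1" for s
    unfolding Z_def by simp
  then have Zlim: "(\<lambda>n. prob {\<omega>\<in>space M. \<bar>Z n \<omega>\<bar> > \<epsilon> / 2}) \<longlonglongrightarrow> 0"
    using \<open>\<epsilon> > 0\<close> by (intro conv_in_prob_of_char) auto
  have "b \<longlonglongrightarrow> 1 * c"
    unfolding b_def E_def c_def by (intro tendsto_mult div_r_lim block_moment_limit[OF G \<gamma>])
  then have "\<forall>\<^sub>F n in sequentially. \<bar>b n - c\<bar> < \<epsilon> / 2"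
    using \<open>\<epsilon> > 0\<close> by (auto dest!: tendstoD[where e="\<epsilon> / 2"] simp: dist_real_def)
  then have "\<forall>\<^sub>F n in sequentially. norm (prob {\<omega>\<in>space M. \<bar>nu_tt u r w \<gamma> X (TmaxG N \<gamma> G) n \<omega> - c\<bar> > \<epsilon>}) \<le> prob {\<omega>\<in>space M. \<bar>Z n \<omega>\<bar> > \<epsilon> / 2}"
    using eventually_gt_at_top[of 0]
  proof eventually_elim
    case (elim n)
    define S where "S = (\<lambda>\<omega>. \<Sum>j=1..n div r n. TmaxG N \<gamma> G (block u r X n j \<omega>))"
    have rn: "real (r n) > 0" "real (r n) powr \<gamma> > 0" using r_pos[of n] by auto
    have nwp: "real n * w n > 0" using elim(2) w_pos[of n] by simp
    have split: "nu_tt u r w \<gamma> X (TmaxG N \<gamma> G) n \<omega> = Z n \<omega> + b n" for \<omega>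
    proof -
      have "Ln N M u r w \<gamma> X G n \<omega> = (S \<omega> - real (n div r n) * E n) / (sqrt (real n * w n) * real (r n) powr \<gamma>)"
        unfolding Ln_def TmaxG_block[OF G \<gamma>] integral_block_fun_shift[OF G \<gamma>] E_def S_def by (simp add: sum_subtractf)
      then have "Z n \<omega> = (S \<omega> - real (n div r n) * E n) / (sqrt (real n * w n) * sqrt (real n * w n) * real (r n) powr \<gamma>)"
        unfolding Z_def by simp
      also have "sqrt (real n * w n) * sqrt (real n * w n) = real n * w n" using nwp by simp
      finally have Z: "Z n \<omega> = (S \<omega> - real (n div r n) * E n) / (real n * w n * real (r n) powr \<gamma>)" .
      have "real (r n) powr (1 + \<gamma>) = real (r n) * real (r n) powr \<gamma>" using rn by (simp add: powr_add)
      then have B: "b n = real (n div r n) * E n / (real n * w n * real (r n) powr \<gamma>)"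
        unfolding b_def using rn by simp
      show ?thesis unfolding Z B nu_tt_def S_def by (simp add: add_divide_distrib[symmetric] mult_ac)
    qed
    have "prob {\<omega>\<in>space M. \<bar>nu_tt u r w \<gamma> X (TmaxG N \<gamma> G) n \<omega> - c\<bar> > \<epsilon>} \<le> prob {\<omega>\<in>space M. \<bar>Z n \<omega>\<bar> > \<epsilon> / 2}"
    proof (rule finite_measure_mono)
      have "\<bar>Z n \<omega>\<bar> > \<epsilon> / 2" if "\<bar>Z n \<omega> + b n - c\<bar> > \<epsilon>" for \<omega> using that elim(1) by linarith
      then show "{\<omega>\<in>space M. \<bar>nu_tt u r w \<gamma> X (TmaxG N \<gamma> G) n \<omega> - c\<bar> > \<epsilon>} \<subseteq> {\<omega>\<in>space M. \<bar>Z n \<omega>\<bar> > \<epsilon> / 2}"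
        unfolding split by blast
    qed measurable
    then show ?case by simp
  qed
  from Lim_null_comparison[OF this Zlim]
  show "(\<lambda>n. prob {\<omega>\<in>space M. \<bar>nu_tt u r w \<gamma> X (TmaxG N \<gamma> G) n \<omega> - nu_star N MY Y G / (1 + \<gamma>)\<bar> > \<epsilon>}) \<longlonglongrightarrow> 0"
    unfolding c_def .
qed

text \<open>The Cramer-Wold device: every projection is the block sum of a signed cluster
  functional, with the variance that the Gaussian vector prescribes.\<close>

lemma Ln_fidi_limit:
  fixes Gs :: "'k::finite \<Rightarrow> (int \<Rightarrow> real^'d) \<Rightarrow> real"
  assumes Gs: "\<And>a. cluster_functional N MY Y (Gs a) (Cs a)" and \<gamma>: "\<gamma> > 0"
    and lr: "(\<lambda>n. real (l n) / real (r n)) \<longlonglongrightarrow> 0"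
    and mix: "(\<lambda>n. real n / real (r n) * beta_mix M X (l n)) \<longlonglongrightarrow> 0"
  shows "\<exists>\<mu>. centered_gaussian (\<lambda>a b. nu_star N MY Y (\<lambda>x. Gs a x * Gs b x) / (2 * \<gamma> + 1)) \<mu>
    \<and> weak_conv_to (\<lambda>n. distr M borel (\<lambda>\<omega>. \<chi> a. Ln N M u r w \<gamma> X (Gs a) n \<omega>)) \<mu> sequentially"
proof -
  define S where "S = (\<lambda>a b. nu_star N MY Y (\<lambda>x. Gs a x * Gs b x) / (2 * \<gamma> + 1))"
  define Gt where "Gt = (\<lambda>(t::'k \<Rightarrow> real) x. \<Sum>a\<in>UNIV. t a * Gs a x)"
  have Gt: "cluster_functional N MY Y (Gt t) (\<Sum>a\<in>UNIV. \<bar>t a\<bar> * Cs a)" for t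
    unfolding Gt_def using Gs by (intro cluster_functional_sum) auto
  \<comment> \<open>Shows positive semidefiniteness, hence existence of the Gaussian law, and below
    matches the variances of the projections.\<close>
  have quad: "(\<Sum>a\<in>UNIV. \<Sum>b\<in>UNIV. t a * S a b * t b) = nu_star N MY Y (\<lambda>x. (Gt t x)\<^sup>2) / (1 + 2 * \<gamma>)" for t
    unfolding Gt_def nu_star_quadratic[OF Gs, symmetric] S_def sum_divide_distrib
    by (intro sum.cong refl) (simp add: add.commute)
  have nn: "0 \<le> nu_star N MY Y (\<lambda>x. (Gt t x)\<^sup>2) / (1 + 2 * \<gamma>)" for t
    unfolding nu_star_def using \<gamma> by (intro divide_nonneg_pos integral_nonneg_AE) auto
  have "\<exists>\<mu>. centered_gaussian S \<mu>"
  proof (rule centered_gaussian_exists)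
    show "S a b = S b a" for a b by (simp add: S_def mult.commute)
    show "0 \<le> (\<Sum>a\<in>UNIV. \<Sum>b\<in>UNIV. t a * S a b * t b)" for t unfolding quad by (rule nn)
  qed
  then obtain \<mu> where \<mu>: "centered_gaussian S \<mu>" ..
  then have \<mu>': "prob_space \<mu>" "sets \<mu> = sets borel" by (auto simp: centered_gaussian_def)
  note [measurable_cong] = \<mu>'(2)
  define L where "L = (\<lambda>n \<omega>. (\<chi> a. Ln N M u r w \<gamma> X (Gs a) n \<omega>) :: real^'k)"
  have [measurable]: "L n \<in> borel_measurable M" for n
    unfolding L_def by (intro borel_measurable_vec_lambda Ln_measurable[OF Gs \<gamma>])
  have inner_m [measurable]: "(\<lambda>x::real^'k. t \<bullet> x) \<in> borel_measurable borel" for t by simp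
  have "weak_conv_to (\<lambda>n. distr M borel (L n)) \<mu> sequentially"
  proof (rule weak_conv_to_of_char[OF _ _ \<mu>'])
    show "prob_space (distr M borel (L n))" for n by (rule prob_space_distr) measurable
    fix t :: "real^'k"
    have "(\<integral>x. iexp (t \<bullet> x) \<partial>distr M borel (L n)) = (\<integral>\<omega>. iexp (1 * (1 * Ln N M u r w \<gamma> X (Gt (\<lambda>a. t $ a)) n \<omega>)) \<partial>M)" for n
    proof -
      have "t \<bullet> L n \<omega> = Ln N M u r w \<gamma> X (Gt (\<lambda>a. t $ a)) n \<omega>" for \<omega>
        unfolding Gt_def Ln_sum[OF Gs \<gamma>] L_def by (simp add: inner_vec_def)
      then show ?thesis by (subst integral_distr) auto
    qed
    moreover have "(\<lambda>n. \<integral>\<omega>. iexp (1 * (1 * Ln N M u r w \<gamma> X (Gt (\<lambda>a. t $ a)) n \<omega>)) \<partial>M)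
      \<longlonglongrightarrow> complex_of_real (exp (- (1\<^sup>2 * (1\<^sup>2 * (nu_star N MY Y (\<lambda>x. (Gt (\<lambda>a. t $ a) x)\<^sup>2) / (1 + 2 * \<gamma>)))) / 2))"
      by (rule block_sum_char_limit[OF Gt \<gamma> tendsto_const lr mix])
    moreover have "(\<integral>x. iexp (t \<bullet> x) \<partial>\<mu>) = complex_of_real (exp (- (1\<^sup>2 * (1\<^sup>2 * (nu_star N MY Y (\<lambda>x. (Gt (\<lambda>a. t $ a) x)\<^sup>2) / (1 + 2 * \<gamma>)))) / 2))"
    proof -
      have "(\<integral>x. iexp (t \<bullet> x) \<partial>\<mu>) = char (distr \<mu> borel (\<lambda>x. t \<bullet> x)) 1"
        unfolding char_def by (subst integral_distr) auto
      also have "distr \<mu> borel (\<lambda>x. t \<bullet> x) = gauss1 (nu_star N MY Y (\<lambda>x. (Gt (\<lambda>a. t $ a) x)\<^sup>2) / (1 + 2 * \<gamma>))"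
        using \<mu> unfolding centered_gaussian_def quad[of "\<lambda>a. t $ a", symmetric] by blast
      finally show ?thesis using char_gauss1[OF nn] by simp
    qed
    ultimately show "(\<lambda>n. \<integral>x. iexp (t \<bullet> x) \<partial>distr M borel (L n)) \<longlonglongrightarrow> (\<integral>x. iexp (t \<bullet> x) \<partial>\<mu>)" by simp
  qed simp
  then show ?thesis using \<mu> unfolding S_def L_def by blast
qed

end

theorem theorem4p4:
  fixes N :: "real^'d::finite \<Rightarrow> real"
    and M :: "'w measure" and X :: "int \<Rightarrow> 'w \<Rightarrow> real^'d"
    and MY :: "'e measure" and Y :: "int \<Rightarrow> 'e \<Rightarrow> real^'d"
    and u :: "nat \<Rightarrow> real" and r :: "nat \<Rightarrow> nat" and w :: "nat \<Rightarrow> real"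
    and \<gamma> :: real
  assumes "is_norm N"
    and "prob_space M"
    and "\<forall>j. X j \<in> borel_measurable M"
    and "stationary M X"
    and "reg_var_with_tail N M X MY Y"
    and "\<forall>n. u n > 0" and "filterlim u at_top sequentially"
    and "\<forall>n. r n \<ge> 1" and "filterlim r at_top sequentially"
    and "\<forall>n. w n = measure M {\<omega>\<in>space M. N (X 0 \<omega>) > u n}"
    and "filterlim (\<lambda>n. real n * w n) at_top sequentially"
    and "(\<lambda>n. real (r n) / real n) \<longlonglongrightarrow> 0"
    and "(\<lambda>n. real (r n) * w n) \<longlonglongrightarrow> 0"
    and "anticlust N M X u r"
    and "\<exists>l::nat \<Rightarrow> nat. filterlim l at_top sequentially
           \<and> (\<lambda>n. real (l n) / real (r n)) \<longlonglongrightarrow> 0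
           \<and> (\<lambda>n. real n / real (r n) * beta_mix M X (l n)) \<longlonglongrightarrow> 0"
    and "\<gamma> > 0"
  shows "(\<forall>G. inH0 N MY Y G \<longrightarrow>
            conv_in_prob M (nu_tt u r w \<gamma> X (TmaxG N \<gamma> G)) (nu_star N MY Y G / (1 + \<gamma>)))
       \<and> (\<forall>Gs :: 'k::finite \<Rightarrow> (int \<Rightarrow> real^'d) \<Rightarrow> real.
            (\<forall>a. inH0 N MY Y (Gs a)) \<longrightarrow>
            (\<exists>\<mu>. centered_gaussian (\<lambda>a b. nu_star N MY Y (\<lambda>x. Gs a x * Gs b x) / (2 * \<gamma> + 1)) \<mu>
                 \<and> weak_conv_to (\<lambda>n. distr M borel (\<lambda>\<omega>. \<chi> a. Ln N M u r w \<gamma> X (Gs a) n \<omega>)) \<mu> sequentially))"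
proof -
  interpret prob_space M by fact
  interpret tail_sequence M X N MY Y u r w
    by unfold_locales (use assms in auto)
  obtain l :: "nat \<Rightarrow> nat" where l: "(\<lambda>n. real (l n) / real (r n)) \<longlonglongrightarrow> 0"
    "(\<lambda>n. real n / real (r n) * beta_mix M X (l n)) \<longlonglongrightarrow> 0"
    using assms(15) by blast
  show ?thesis
  proof (intro conjI allI impI)
    fix G assume "inH0 N MY Y G"
    then obtain C where "cluster_functional N MY Y G C" using inH0_cluster_functional by blast
    then show "conv_in_prob M (nu_tt u r w \<gamma> X (TmaxG N \<gamma> G)) (nu_star N MY Y G / (1 + \<gamma>))"
      using \<open>\<gamma> > 0\<close> l by (rule nu_tt_conv_in_prob)
  next
    fix Gs :: "'k \<Rightarrow> (int \<Rightarrow> real^'d) \<Rightarrow> real" assume "\<forall>a. inH0 N MY Y (Gs a)"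
    then have "\<forall>a. \<exists>C. cluster_functional N MY Y (Gs a) C" using inH0_cluster_functional by blast
    then obtain Cs where "\<And>a. cluster_functional N MY Y (Gs a) (Cs a)" by metis
    then show "\<exists>\<mu>. centered_gaussian (\<lambda>a b. nu_star N MY Y (\<lambda>x. Gs a x * Gs b x) / (2 * \<gamma> + 1)) \<mu>
        \<and> weak_conv_to (\<lambda>n. distr M borel (\<lambda>\<omega>. \<chi> a. Ln N M u r w \<gamma> X (Gs a) n \<omega>)) \<mu> sequentially"
      using \<open>\<gamma> > 0\<close> l by (rule Ln_fidi_limit)
  qed
qed

end
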